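(* Let $K$ be a CM-field with a CM-type $\{\varphi_1,\dots,\varphi_n\}$ and reflex field $K^*$ such that (C1) the complex torus $\mathbb{C}^g/\Psi(\mathcal{O}_{K^*})$ can be given a structure of a principally polarized abelian variety, and (C2) $(K^* )^*=K$. Fix $\xi\in K^*$ satisfying (P1)–(P3) of the context. Let $\mathfrak{f}=\mathfrak{f}_0\mathcal{O}_K$ for a proper nontrivial ideal $\mathfrak{f}_0$ of $\mathcal{O}_{K_0}$, let $C\in\mathrm{Cl}(\mathfrak{f})$, and let $\mathfrak{c}$ be an integral ideal in $C$. Then the Siegel invariant $\Theta_\mathfrak{f}(C)$, computed from $\mathfrak{c}$ and a symplectic basis of $\mathcal{P}_\mathfrak{c}$ as in the context, does not depend on the choice of the symplectic basis of $\mathcal{P}_\mathfrak{c}$. That is, if two symplectic bases of $\mathcal{P}_\mathfrak{c}$ give the integers $r_1,\dots,r_{2g}$ and CM-point $Z_0^*$, respectively $\widetilde{r}_1,\dots,\widetilde{r}_{2g}$ and $\widetilde{Z}_0^*$, then $$\Theta\left((\widetilde{r}_1/N,\dots,\widetilde{r}_{2g}/N)^T,\widetilde{Z}_0^*\right)=\Theta\left((r_1/N,\dots,r_{2g}/N)^T,Z_0^*\right)$$ (as values of meromorphic functions: one is finite if and only if the other is, and then they are equal).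
   Context: **CM data.** $K\subset\mathbb{C}$ is a CM-field, $[K:\mathbb{Q}]=2n$; $\{\varphi_1,\dots,\varphi_n\}$ is a CM-type of $K$: $\varphi_1,\dots,\varphi_n,\overline{\varphi}_1,\dots,\overline{\varphi}_n$ are all the embeddings $K\to\mathbb{C}$. $L\subset\mathbb{C}$ is a finite Galois extension of $\mathbb{Q}$ containing $K$. Galois elements act on the right, $(a^\sigma)^\tau=a^{\sigma\tau}$. Put $S=\{\sigma\in\mathrm{Gal}(L/\mathbb{Q}) : \sigma|_K=\varphi_i\text{ for some }i\}$, $S^*=\{\sigma^{-1}:\sigma\in S\}$, $H^*=\{\gamma\in\mathrm{Gal}(L/\mathbb{Q}):\gamma S^*=S^*\}$. The reflex field $K^*$ is the fixed field of $H^*$ in $L$; $\{\psi_1,\dots,\psi_g\}$ is the set of embeddings of $K^*$ into $\mathbb{C}$ obtained from elements of $S^*$. Then $K^*=\mathbb{Q}(\sum_i a^{\varphi_i} : a\in K)$ is a CM-field with CM-type $\{\psi_1,\dots,\psi_g\}$, $[K^*:\mathbb{Q}]=2g$. $(K^* )^*$ denotes the reflex field of $(K^*;\{\psi_j\})$. Let $\Psi:K^*\to\mathbb{C}^g$, $\Psi(a)=(a^{\psi_1},\dots,a^{\psi_g})^T$. For a purely imaginary $c\in K^*$ let $E_c(\mathbf{u},\mathbf{v})=\sum_{j=1}^g c^{\psi_j}(u_j\overline{v}_j-\overline{u}_jv_j)$ for $\mathbf{u},\mathbf{v}\in\mathbb{C}^g$. **Polarization.** (C1) is equivalent to the existence of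 $\xi\in K^*$ with: (P1) $\xi^{\psi_i}$ lies on the positive imaginary axis for all $1\le i\le g$; (P2) $E_\xi$ yields a Riemann form on $\mathbb{C}^g/\Psi(\mathcal{O}_{K^*})$; (P3) $\delta_{K^*}^{-1}=\xi\mathcal{O}_{K^*}$, where $\delta_{K^*}$ is the different ideal of $K^*$. One such $\xi$ is fixed. **Reflex norm.** $\varphi:K^\times\to(K^* )^\times$, $\varphi(a)=\prod_{i=1}^n a^{\varphi_i}$ (well defined by (C2)). For a fractional ideal $\mathfrak{a}$ of $K$, $\varphi(\mathfrak{a})$ is the fractional ideal of $K^*$ with $\varphi(\mathfrak{a})\mathcal{O}_L=\prod_{i=1}^n(\mathfrak{a}\mathcal{O}_L)^{\varphi_i}$. **Ideals.** $K_0$ is the fixed field in $L$ of the subgroup generated by $\{\sigma\in\mathrm{Gal}(L/\mathbb{Q}):\sigma|_K=\varphi_i\text{ for some }i\}$; it is either $\mathbb{Q}$ or an imaginary quadratic subfield of $K$ and $K^*$. $\mathfrak{f}_0$ is a proper nontrivial ideal of $\mathcal{O}_{K_0}$, $\mathfrak{f}=\mathfrak{f}_0\mathcal{O}_K$, $\mathfrak{f}^*=\mathfrak{f}_0\mathcal{O}_{K^*}$, and $N$ is the smallest positive integer in $\mathfrak{f}$. $\mathrm{Cl}(\mathfrak{f})$ is the ray class group of $K$ modulo $\mathfrak{f}$ (classes of fractional ideals prime to $\mathfrak{f}$ modulo principal ideals $\nu\mathcal{O}_K$ with $\nu\equiv^*1\pmod{\mathfrak{f}}$). **The function $\Theta$.**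 $\mathbb{H}_g$ is the Siegel upper half-space of degree $g$, $e(x)=e^{2\pi \mathrm{i}x}$. For $\mathbf{r},\mathbf{s}\in\mathbb{Q}^g$, $Z\in\mathbb{H}_g$, $$\theta(\left[\begin{smallmatrix}\mathbf{r}\\ \mathbf{s}\end{smallmatrix}\right],Z)=\sum_{\mathbf{n}\in\mathbb{Z}^g}e\left(\tfrac12(\mathbf{n}+\mathbf{r})^TZ(\mathbf{n}+\mathbf{r})+(\mathbf{n}+\mathbf{r})^T\mathbf{s}\right).$$ Let $S_-$ (resp. $S_+$) be the set of $\left[\begin{smallmatrix}\mathbf{a}\\ \mathbf{b}\end{smallmatrix}\right]$ with $\mathbf{a},\mathbf{b}\in\{0,1/2\}^g$ and $e(2\mathbf{a}^T\mathbf{b})=-1$ (resp. $=1$). For $\mathbf{r},\mathbf{s}\in\frac1N\mathbb{Z}^g$ put $$\Theta(\left[\begin{smallmatrix}\mathbf{r}\\ \mathbf{s}\end{smallmatrix}\right],Z)=2^{4N}e\left(-2^gN(2^g-1)(2^g+1)\mathbf{r}^T\mathbf{s}\right)\frac{\prod_{\left[\begin{smallmatrix}\mathbf{a}\\ \mathbf{b}\end{smallmatrix}\right]\in S_-}\theta(\left[\begin{smallmatrix}\mathbf{a}\\ \mathbf{b}\end{smallmatrix}\right]-\left[\begin{smallmatrix}\mathbf{r}\\ \mathbf{s}\end{smallmatrix}\right],Z)^{4N(2^g+1)}}{\prod_{\left[\begin{smallmatrix}\mathbf{c}\\ \mathbf{d}\end{smallmatrix}\right]\in S_+}\theta(\left[\begin{smallmatrix}\mathbf{c}\\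 \mathbf{d}\end{smallmatrix}\right],Z)^{4N(2^g-1)}},$$ a meromorphic function on $\mathbb{H}_g$. **Siegel invariant.** Let $C\in\mathrm{Cl}(\mathfrak{f})$ and let $\mathfrak{c}$ be an integral ideal in $C$. Put $m_\mathfrak{c}=\sqrt[g]{\mathcal{N}_{K^*}((\mathfrak{f}^* )^{-1}\varphi(\mathfrak{c}))}$ with $\mathcal{N}_{K^*}$ the absolute norm of fractional ideals. Then $\mathcal{P}_\mathfrak{c}=(\mathbb{C}^g/\Psi(\mathfrak{f}^*\varphi(\mathfrak{c})^{-1}),E_{\xi m_\mathfrak{c}})$ is a principally polarized abelian variety. A symplectic basis of $\mathcal{P}_\mathfrak{c}$ is a $\mathbb{Z}$-basis $\{\mathbf{b}_1,\dots,\mathbf{b}_{2g}\}$ of $\Psi(\mathfrak{f}^*\varphi(\mathfrak{c})^{-1})$ with $[E_{\xi m_\mathfrak{c}}(\mathbf{b}_i,\mathbf{b}_j)]_{i,j}=\left[\begin{smallmatrix} O & -I_g \\ I_g & O \end{smallmatrix}\right]$. Given one, write $\mathbf{b}_j=\Psi(y_j)$ with $y_j\in\mathfrak{f}^*\varphi(\mathfrak{c})^{-1}$, define its CM-point $Z_0^*=[\mathbf{b}_{g+1}\cdots\mathbf{b}_{2g}]^{-1}[\mathbf{b}_1\cdots\mathbf{b}_g]\in\mathbb{H}_g$, and write $N=\sum_{j=1}^{2g}r_jy_j$ with unique integers $r_j$ (possible since $N\in\mathfrak{f}^*\varphi(\mathfrak{c})^{-1}$). Then $$\Theta_\mathfrak{f}(C)=\Theta\left((r_1/N,\dots,r_{2g}/N)^T,\;Z_0^*\right).$$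 *)

theory Defs
  imports
    "HOL-Analysis.Analysis"
    "HOL-Algebra.Algebraic_Closure_Type"
    "HOL-Algebra.Ideal_Product"
    "HOL-Algebra.Coset"
begin

section \<open>Number fields inside the complex numbers\<close>

abbreviation CC :: "complex ring"
  where "CC \<equiv> ring_of_type_algebra"

definition number_field :: "complex set \<Rightarrow> bool"
  where "number_field K \<longleftrightarrow> subfield K CC \<and> ring.finite_dimension CC \<rat> K"

definition embeddings :: "complex set \<Rightarrow> (complex \<Rightarrow> complex) set"
  where "embeddings K = ring_hom (CC\<lparr>carrier := K\<rparr>) CC \<inter> extensional K"

definition conj_emb :: "complex set \<Rightarrow> (complex \<Rightarrow> complex) \<Rightarrow> complex \<Rightarrow> complex"
  where "conj_emb K \<phi> = (\<lambda>x\<in>K. cnj (\<phi> x))"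

definition totally_real :: "complex set \<Rightarrow> bool"
  where "totally_real F \<longleftrightarrow> (\<forall>\<sigma>\<in>embeddings F. \<sigma> ` F \<subseteq> \<real>)"

definition totally_imaginary :: "complex set \<Rightarrow> bool"
  where "totally_imaginary K \<longleftrightarrow> (\<forall>\<sigma>\<in>embeddings K. \<not> \<sigma> ` K \<subseteq> \<real>)"

definition CM_field :: "complex set \<Rightarrow> bool"
  where "CM_field K \<longleftrightarrow> number_field K \<and> totally_imaginary K \<and>
    (\<exists>F. number_field F \<and> F \<subseteq> K \<and> totally_real F \<and> ring.dimension CC 2 F K)"

text \<open>Since a number field of degree \<open>2n\<close> has exactly \<open>2n\<close> embeddings, a CM-type
  consists of \<open>n\<close> embeddings.\<close>

definition CM_type :: "complex set \<Rightarrow> (complex \<Rightarrow> complex) set \<Rightarrow> bool"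
  where "CM_type K \<Phi> \<longleftrightarrow>
    \<Phi> \<union> conj_emb K ` \<Phi> = embeddings K \<and> \<Phi> \<inter> conj_emb K ` \<Phi> = {}"

definition Gal :: "complex set \<Rightarrow> (complex \<Rightarrow> complex) set"
  where "Gal L = {\<sigma> \<in> embeddings L. \<sigma> ` L = L}"

text \<open>Galois elements act on the right, so the product of \<open>\<sigma>\<close> and \<open>\<tau>\<close> applies \<open>\<sigma>\<close> first.\<close>

definition gal_group :: "complex set \<Rightarrow> (complex \<Rightarrow> complex) monoid"
  where "gal_group L =
    \<lparr>carrier = Gal L, monoid.mult = (\<lambda>\<sigma> \<tau>. compose L \<tau> \<sigma>), one = (\<lambda>x\<in>L. x)\<rparr>"

definition fixed_field :: "complex set \<Rightarrow> (complex \<Rightarrow> complex) set \<Rightarrow> complex set"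
  where "fixed_field L A = {x \<in> L. \<forall>\<sigma>\<in>A. \<sigma> x = x}"

definition finite_galois :: "complex set \<Rightarrow> bool"
  where "finite_galois L \<longleftrightarrow> number_field L \<and> fixed_field L (Gal L) = \<rat>"


section \<open>Reflex field and reflex type\<close>

definition lifts :: "complex set \<Rightarrow> complex set \<Rightarrow> (complex \<Rightarrow> complex) set
    \<Rightarrow> (complex \<Rightarrow> complex) set"
  where "lifts L K \<Phi> = {\<sigma> \<in> Gal L. restrict \<sigma> K \<in> \<Phi>}"

definition inv_lifts :: "complex set \<Rightarrow> complex set \<Rightarrow> (complex \<Rightarrow> complex) set
    \<Rightarrow> (complex \<Rightarrow> complex) set"
  where "inv_lifts L K \<Phi> = set_inv\<^bsub>gal_group L\<^esub> (lifts L K \<Phi>)"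

definition reflex_field :: "complex set \<Rightarrow> complex set \<Rightarrow> (complex \<Rightarrow> complex) set \<Rightarrow> complex set"
  where "reflex_field L K \<Phi> = fixed_field L
    {\<gamma> \<in> Gal L. \<gamma> <#\<^bsub>gal_group L\<^esub> inv_lifts L K \<Phi> = inv_lifts L K \<Phi>}"

definition reflex_type :: "complex set \<Rightarrow> complex set \<Rightarrow> (complex \<Rightarrow> complex) set
    \<Rightarrow> (complex \<Rightarrow> complex) set"
  where "reflex_type L K \<Phi> = (\<lambda>\<sigma>. restrict \<sigma> (reflex_field L K \<Phi>)) ` inv_lifts L K \<Phi>"

definition base_field :: "complex set \<Rightarrow> complex set \<Rightarrow> (complex \<Rightarrow> complex) set \<Rightarrow> complex set"
  where "base_field L K \<Phi> = fixed_field L (generate (gal_group L) (lifts L K \<Phi>))"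


section \<open>Ideals\<close>

definition ring_of_integers :: "complex set \<Rightarrow> complex set"
  where "ring_of_integers K = {x \<in> K. algebraic_int x}"

definition integral_ideal :: "complex set \<Rightarrow> complex set \<Rightarrow> bool"
  where "integral_ideal K I \<longleftrightarrow> ideal I (CC\<lparr>carrier := ring_of_integers K\<rparr>) \<and> I \<noteq> {0}"

definition fractional_ideal :: "complex set \<Rightarrow> complex set \<Rightarrow> bool"
  where "fractional_ideal K I \<longleftrightarrow>
    I \<subseteq> K \<and> (\<exists>d \<in> ring_of_integers K - {0}. integral_ideal K ((*) d ` I))"

definition frac_ideals :: "complex set \<Rightarrow> complex set monoid"
  where "frac_ideals K = \<lparr>carrier = {I. fractional_ideal K I},
    monoid.mult = ideal_prod CC, one = ring_of_integers K\<rparr>"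

definition ideal_inverse :: "complex set \<Rightarrow> complex set \<Rightarrow> complex set"
  where "ideal_inverse K I = {x \<in> K. \<forall>y\<in>I. x * y \<in> ring_of_integers K}"

definition principal_ideal :: "complex set \<Rightarrow> complex \<Rightarrow> complex set"
  where "principal_ideal K \<nu> = (*) \<nu> ` ring_of_integers K"

text \<open>The \<open>\<O>\<^sub>K\<close>-module generated by a set of complex numbers that is closed under
  addition; used for the extension of an ideal to a larger field.\<close>

definition extend_ideal :: "complex set \<Rightarrow> complex set \<Rightarrow> complex set"
  where "extend_ideal K I = I \<cdot>\<^bsub>CC\<^esub> ring_of_integers K"

definition field_trace :: "complex set \<Rightarrow> complex \<Rightarrow> complex"
  where "field_trace K x = (\<Sum>\<sigma>\<in>embeddings K. \<sigma> x)"

definition codifferent :: "complex set \<Rightarrow> complex set"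
  where "codifferent K = {x \<in> K. \<forall>y\<in>ring_of_integers K. field_trace K (x * y) \<in> \<int>}"

definition different :: "complex set \<Rightarrow> complex set"
  where "different K = ideal_inverse K (codifferent K)"

definition add_index :: "complex set \<Rightarrow> complex set \<Rightarrow> nat"
  where "add_index A B = card ((\<lambda>a. (+) a ` B) ` A)"

text \<open>The absolute norm of a fractional ideal is the generalized index \<open>[\<O>\<^sub>K : I]\<close>; for an
  integral ideal it is the cardinality of the residue ring.\<close>

definition ideal_norm :: "complex set \<Rightarrow> complex set \<Rightarrow> real"
  where "ideal_norm K I =
    real (add_index (ring_of_integers K) (ring_of_integers K \<inter> I)) /
    real (add_index I (ring_of_integers K \<inter> I))"

definition coprime_ideals :: "complex set \<Rightarrow> complex set \<Rightarrow> complex set \<Rightarrow> bool"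
  where "coprime_ideals K I J \<longleftrightarrow> I <+>\<^bsub>CC\<^esub> J = ring_of_integers K"

definition ideals_prime_to :: "complex set \<Rightarrow> complex set \<Rightarrow> complex set monoid"
  where "ideals_prime_to K \<ff> = (frac_ideals K)\<lparr>carrier :=
    {\<aa> \<cdot>\<^bsub>CC\<^esub> (ideal_inverse K \<bb>) | \<aa> \<bb>. integral_ideal K \<aa> \<and> coprime_ideals K \<aa> \<ff> \<and>
       integral_ideal K \<bb> \<and> coprime_ideals K \<bb> \<ff>}\<rparr>"

text \<open>\<open>\<nu> \<equiv>\<^sup>* 1 (mod \<ff>)\<close>, without a condition at infinity because the fields considered
  are totally imaginary.\<close>

definition mult_cong_one :: "complex set \<Rightarrow> complex set \<Rightarrow> complex \<Rightarrow> bool"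
  where "mult_cong_one K \<ff> \<nu> \<longleftrightarrow>
    (\<exists>\<alpha> \<in> ring_of_integers K - {0}. \<exists>\<beta> \<in> ring_of_integers K - {0}.
       coprime_ideals K (principal_ideal K \<alpha>) \<ff> \<and> coprime_ideals K (principal_ideal K \<beta>) \<ff> \<and>
       \<alpha> - \<beta> \<in> \<ff> \<and> \<nu> = \<alpha> / \<beta>)"

definition ray_class_group :: "complex set \<Rightarrow> complex set \<Rightarrow> complex set set monoid"
  where "ray_class_group K \<ff> =
    ideals_prime_to K \<ff> Mod (principal_ideal K ` {\<nu>. mult_cong_one K \<ff> \<nu>})"

text \<open>\<open>(\<aa>\<O>\<^sub>L)\<^sup>\<phi>\<close> is the image of \<open>\<aa>\<O>\<^sub>L\<close> under any \<open>\<sigma> \<in> Gal(L/\<rat>)\<close> extending \<open>\<phi>\<close>, i.e.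
  the ideal of \<open>\<O>\<^sub>L\<close> generated by \<open>\<phi>(\<aa>)\<close>.\<close>

definition reflex_norm :: "complex set \<Rightarrow> complex set \<Rightarrow> (complex \<Rightarrow> complex) set
    \<Rightarrow> complex set \<Rightarrow> complex set"
  where "reflex_norm L K \<Phi> \<aa> = (THE \<bb>. fractional_ideal (reflex_field L K \<Phi>) \<bb> \<and>
    extend_ideal L \<bb> = finprod (frac_ideals L) (\<lambda>\<phi>. extend_ideal L (\<phi> ` \<aa>)) \<Phi>)"


section \<open>Polarized complex tori\<close>

text \<open>Vectors and matrices over an index type \<open>'g\<close> with \<open>g\<close> elements. The index type
  \<open>'g + 'g\<close> stands for \<open>{1, \<dots>, 2g}\<close>, with \<open>Inl\<close> for the first and \<open>Inr\<close> for
  the last \<open>g\<close> indices.\<close>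

definition Psi :: "('g \<Rightarrow> complex \<Rightarrow> complex) \<Rightarrow> complex \<Rightarrow> complex ^ 'g"
  where "Psi \<psi> a = (\<chi> j. \<psi> j a)"

definition E_form :: "('g::finite \<Rightarrow> complex \<Rightarrow> complex) \<Rightarrow> complex
    \<Rightarrow> complex ^ 'g \<Rightarrow> complex ^ 'g \<Rightarrow> complex"
  where "E_form \<psi> c u v = (\<Sum>j\<in>UNIV. \<psi> j c * (u $ j * cnj (v $ j) - cnj (u $ j) * v $ j))"

definition riemann_form :: "(complex ^ 'g::finite) set
    \<Rightarrow> (complex ^ 'g \<Rightarrow> complex ^ 'g \<Rightarrow> complex) \<Rightarrow> bool"
  where "riemann_form \<Lambda> E \<longleftrightarrow>
    (\<forall>u v. E u v \<in> \<real>) \<and> bilinear E \<and> (\<forall>u v. E v u = - E u v) \<and>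
    (\<forall>u\<in>\<Lambda>. \<forall>v\<in>\<Lambda>. E u v \<in> \<int>) \<and>
    (\<forall>u v. E u (\<i> *s v) = E v (\<i> *s u)) \<and>
    (\<forall>u. u \<noteq> 0 \<longrightarrow> Re (E u (\<i> *s u)) > 0)"

definition is_Z_basis :: "(complex ^ 'g) set \<Rightarrow> ('i::finite \<Rightarrow> complex ^ 'g) \<Rightarrow> bool"
  where "is_Z_basis \<Lambda> b \<longleftrightarrow>
    bij_betw (\<lambda>k :: 'i \<Rightarrow> int. \<Sum>j\<in>UNIV. of_int (k j) *s b j) UNIV \<Lambda>"

fun standard_symplectic :: "'g + 'g \<Rightarrow> 'g + 'g \<Rightarrow> complex" where
  "standard_symplectic (Inl i) (Inr j) = (if i = j then -1 else 0)"
| "standard_symplectic (Inr i) (Inl j) = (if i = j then 1 else 0)"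
| "standard_symplectic (Inl i) (Inl j) = 0"
| "standard_symplectic (Inr i) (Inr j) = 0"

definition symplectic_basis :: "(complex ^ 'g) set
    \<Rightarrow> (complex ^ 'g \<Rightarrow> complex ^ 'g \<Rightarrow> complex) \<Rightarrow> ('g::finite + 'g \<Rightarrow> complex ^ 'g) \<Rightarrow> bool"
  where "symplectic_basis \<Lambda> E b \<longleftrightarrow>
    is_Z_basis \<Lambda> b \<and> (\<forall>i j. E (b i) (b j) = standard_symplectic i j)"

definition principal_polarization :: "(complex ^ 'g::finite) set
    \<Rightarrow> (complex ^ 'g \<Rightarrow> complex ^ 'g \<Rightarrow> complex) \<Rightarrow> bool"
  where "principal_polarization \<Lambda> E \<longleftrightarrow> riemann_form \<Lambda> E \<and> (\<exists>b. symplectic_basis \<Lambda> E b)"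

definition CM_point :: "('g::finite + 'g \<Rightarrow> complex ^ 'g) \<Rightarrow> complex ^ 'g ^ 'g"
  where "CM_point b = matrix_inv (\<chi> i j. b (Inr j) $ i) ** (\<chi> i j. b (Inl j) $ i)"

text \<open>\<open>P\<^sub>\<cc>\<close> is the torus with lattice \<open>Psi \<psi> ` lattice_ideal L K \<Phi> \<ff>\<^sub>0 \<cc>\<close> and form
  \<open>E\<^bsub>\<xi>m\<^esub>\<close>, \<open>m = polar_scale\<close>.\<close>

definition lattice_ideal :: "complex set \<Rightarrow> complex set \<Rightarrow> (complex \<Rightarrow> complex) set
    \<Rightarrow> complex set \<Rightarrow> complex set \<Rightarrow> complex set"
  where "lattice_ideal L K \<Phi> \<ff>0 \<cc> =
    extend_ideal (reflex_field L K \<Phi>) \<ff>0 \<cdot>\<^bsub>CC\<^esub>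
      (ideal_inverse (reflex_field L K \<Phi>) (reflex_norm L K \<Phi> \<cc>))"

definition polar_scale :: "nat \<Rightarrow> complex set \<Rightarrow> complex set \<Rightarrow> (complex \<Rightarrow> complex) set
    \<Rightarrow> complex set \<Rightarrow> complex set \<Rightarrow> real"
  where "polar_scale g L K \<Phi> \<ff>0 \<cc> = root g (ideal_norm (reflex_field L K \<Phi>)
    ((ideal_inverse (reflex_field L K \<Phi>) (extend_ideal (reflex_field L K \<Phi>) \<ff>0))
       \<cdot>\<^bsub>CC\<^esub> reflex_norm L K \<Phi> \<cc>))"

text \<open>The form \<open>E\<^bsub>\<xi>m\<^esub>\<close> for a scalar \<open>m\<close> given as a real number. For rational \<open>m\<close>, in
  particular for \<open>m = polar_scale\<close>, one has \<open>\<psi>\<^sub>j (\<xi>m) = m \<psi>\<^sub>j \<xi>\<close>, which is the coefficient used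
  here because \<open>\<psi>\<^sub>j\<close> is only defined on the reflex field.\<close>

definition scaled_E_form :: "('g::finite \<Rightarrow> complex \<Rightarrow> complex) \<Rightarrow> complex \<Rightarrow> real
    \<Rightarrow> complex ^ 'g \<Rightarrow> complex ^ 'g \<Rightarrow> complex"
  where "scaled_E_form \<psi> \<xi> m u v =
    (\<Sum>j\<in>UNIV. (of_real m * \<psi> j \<xi>) * (u $ j * cnj (v $ j) - cnj (u $ j) * v $ j))"


section \<open>Theta functions on the Siegel upper half-space\<close>

definition siegel :: "(complex ^ 'g::finite ^ 'g) set"
  where "siegel = {Z. transpose Z = Z \<and>
    (\<forall>x :: real ^ 'g. x \<noteq> 0 \<longrightarrow> x \<bullet> ((\<chi> i j. Im (Z $ i $ j)) *v x) > 0)}"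

definition e2pi :: "complex \<Rightarrow> complex"
  where "e2pi x = exp (2 * of_real pi * \<i> * x)"

text \<open>A characteristic \<open>v\<close> is a column of length \<open>2g\<close>, with upper half \<open>\<r>\<close>
  and lower half \<open>\<s>\<close>.\<close>

definition upper_half :: "real ^ ('g + 'g) \<Rightarrow> real ^ 'g"
  where "upper_half v = (\<chi> i. v $ Inl i)"

definition lower_half :: "real ^ ('g + 'g) \<Rightarrow> real ^ 'g"
  where "lower_half v = (\<chi> i. v $ Inr i)"

definition theta :: "real ^ ('g::finite + 'g) \<Rightarrow> complex ^ 'g ^ 'g \<Rightarrow> complex"
  where "theta v Z = (\<Sum>\<^sub>\<infinity>n :: int ^ 'g.
    let x = (\<chi> i. of_real (of_int (n $ i) + upper_half v $ i)) :: complex ^ 'g in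
    e2pi (1/2 * (\<Sum>i\<in>UNIV. x $ i * (Z *v x) $ i) +
      (\<Sum>i\<in>UNIV. x $ i * of_real (lower_half v $ i))))"

definition S_minus :: "(real ^ ('g::finite + 'g)) set"
  where "S_minus = {v. (\<forall>i. v $ i \<in> {0, 1/2}) \<and>
    e2pi (of_real (2 * (upper_half v \<bullet> lower_half v))) = -1}"

definition S_plus :: "(real ^ ('g::finite + 'g)) set"
  where "S_plus = {v. (\<forall>i. v $ i \<in> {0, 1/2}) \<and>
    e2pi (of_real (2 * (upper_half v \<bullet> lower_half v))) = 1}"

definition Theta_num :: "nat \<Rightarrow> real ^ ('g::finite + 'g) \<Rightarrow> complex ^ 'g ^ 'g \<Rightarrow> complex"
  where "Theta_num N v Z = 2 ^ (4 * N) *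
    e2pi (- of_real (2 ^ CARD('g) * real N * (2 ^ CARD('g) - 1) * (2 ^ CARD('g) + 1)
          * (upper_half v \<bullet> lower_half v))) *
    (\<Prod>a\<in>S_minus. theta (a - v) Z ^ (4 * N * (2 ^ CARD('g) + 1)))"

definition Theta_den :: "nat \<Rightarrow> complex ^ 'g::finite ^ 'g \<Rightarrow> complex"
  where "Theta_den N Z = (\<Prod>c\<in>S_plus. theta c Z ^ (4 * N * (2 ^ CARD('g) - 1)))"

definition holomorphic_on_siegel :: "(complex ^ 'g::finite ^ 'g \<Rightarrow> complex)
    \<Rightarrow> (complex ^ 'g ^ 'g) set \<Rightarrow> bool"
  where "holomorphic_on_siegel F U \<longleftrightarrow> (\<forall>Z\<in>U. \<exists>D.
    (F has_derivative D) (at Z within U) \<and>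
    (\<forall>c A. D (\<chi> i j. c * A $ i $ j) = c * D A))"

text \<open>The meromorphic function \<open>\<Theta>(v, \<cdot>)\<close> is finite at \<open>Z\<close> with value \<open>w\<close>: it extends
  holomorphically over a neighbourhood of \<open>Z\<close> in the half-space. Its denominator may vanish at
  \<open>Z\<close> itself, so the pointwise quotient would not do.\<close>

definition Theta_has_value :: "nat \<Rightarrow> real ^ ('g::finite + 'g) \<Rightarrow> complex ^ 'g ^ 'g
    \<Rightarrow> complex \<Rightarrow> bool"
  where "Theta_has_value N v Z w \<longleftrightarrow>
    (\<exists>U F. openin (top_of_set siegel) U \<and> Z \<in> U \<and> holomorphic_on_siegel F U \<and>
       (\<forall>Z'\<in>U. Theta_den N Z' \<noteq> 0 \<longrightarrow> F Z' = Theta_num N v Z' / Theta_den N Z') \<and>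
       F Z = w)"

definition Theta_finite :: "nat \<Rightarrow> real ^ ('g::finite + 'g) \<Rightarrow> complex ^ 'g ^ 'g \<Rightarrow> bool"
  where "Theta_finite N v Z \<longleftrightarrow> (\<exists>w. Theta_has_value N v Z w)"

definition Theta :: "nat \<Rightarrow> real ^ ('g::finite + 'g) \<Rightarrow> complex ^ 'g ^ 'g \<Rightarrow> complex"
  where "Theta N v Z = (THE w. Theta_has_value N v Z w)"

end

theory Submission
  imports Defs "HOL-Complex_Analysis.Cauchy_Integral_Formula"
begin

text \<open>
  Two symplectic bases differ by an integral symplectic matrix \<open>M\<close>, which moves the CM-point by
  \<open>Z \<mapsto> M Z\<close> and the characteristic by \<open>v \<mapsto> M\<^sup>-\<^sup>T v\<close>; so the claim is the invariance of
  \<open>\<Theta>\<close> under \<open>Sp\<^bsub>2g\<^esub>(\<int>)\<close>. The transformation law of theta functions is obtained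
  directly for every \<open>M\<close>, without generators of the group: after normalisation, the transformed
  theta function is an entire function with the same quasi-periods as \<open>\<theta>(\<cdot>, Z)\<close>, and such functions
  form a one-dimensional space (compare Fourier coefficients). The resulting factor
  \<open>\<kappa>(M, Z)\<close> is not determined; it does not depend on the characteristic, and it cancels because
  \<open>(2^g + 1) |S\<^sub>-| = (2^g - 1) |S\<^sub>+|\<close>. The remaining roots of unity disappear in the
  \<open>4N\<close>-th powers, using that \<open>S\<^sub>-\<close> and \<open>S\<^sub>+\<close> have the same sum.
\<close>

text \<open>From the CM data the proof extracts three facts: the coefficients of the polarization
  are positive multiples of Im (\<psi> j \<xi>), the lattice comes from elements of the reflex
  field, where every \<psi> j is additive, and N is the same element for both bases. The rest is
  analysis on \<open>siegel\<close>. Writing z = Z r + s with independent r and s makes the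
  transformation law linear: in these coordinates the quasi-periods of the normalised theta function
  are governed by the symplectic form r \<star> n - m \<star> s, which M^-T preserves. The obstacle
  is the remaining sign e(m \<star> n / 2), preserved only up to a linear character given by the
  diagonals of C^T A and D^T B. A translation by half of this vector together with an exponential
  factor removes it; the two shares must be equal for the result to be a function of z alone. Since
  a value of \<Theta> is defined through a holomorphic extension, a pointwise identity is not
  enough: the extension has to be pulled back along the action, which must therefore be shown to be
  holomorphic.\<close>

no_notation fps_nth (infixl "$" 75)


section \<open>Averages over a period\<close>

definition cavg :: "'g::finite \<Rightarrow> (complex ^ 'g \<Rightarrow> complex) \<Rightarrow> complex ^ 'g \<Rightarrow> complex"
  where "cavg j F z = integral {0..1} (\<lambda>t. F (z + axis j (of_real t)))"

text \<open>Iterated one-variable integrals replace an integral over the unit cube. Properties then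
  follow by induction on the list, and averages over some coordinates with the others frozen are
  available for the Fourier argument.\<close>

definition avg :: "'g::finite list \<Rightarrow> (complex ^ 'g \<Rightarrow> complex) \<Rightarrow> complex ^ 'g \<Rightarrow> complex"
  where "avg js F = foldr cavg js F"

lemma avg_Nil [simp]: "avg [] F = F"
  and avg_Cons [simp]: "avg (j # js) F = cavg j (avg js F)"
  by (simp_all add: avg_def)

lemma continuous_on_axis [continuous_intros]:
  assumes "continuous_on S f"
  shows "continuous_on S (\<lambda>x. axis j (f x) :: complex ^ 'g::finite)"
  unfolding axis_def
proof (rule continuous_on_vec_lambda)
  show "continuous_on S (\<lambda>x. if i = j then f x else 0)" for i
    using assms by (cases "i = j") auto
qed

lemma axis_add: "axis j (x + y) = axis j x + (axis j y :: 'a::monoid_add ^ 'g)"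
  by (simp add: axis_def vec_eq_iff)

lemma continuous_on_cavg:
  assumes "continuous_on UNIV F"
  shows "continuous_on UNIV (cavg j F)"
proof -
  have "continuous_on (UNIV \<times> cbox 0 (1::real)) (\<lambda>(z, t). F (z + axis j (of_real t)))"
    unfolding split_beta
    by (rule continuous_on_compose2[OF assms]) (auto intro!: continuous_intros)
  then have "continuous_on UNIV (\<lambda>z. integral (cbox 0 (1::real)) (\<lambda>t. F (z + axis j (of_real t))))"
    by (rule integral_continuous_on_param)
  then show ?thesis by (simp add: cavg_def[abs_def])
qed

lemma continuous_on_avg: "continuous_on UNIV F \<Longrightarrow> continuous_on UNIV (avg js F)"
  by (induction js) (auto intro: continuous_on_cavg)

lemma integrable_cavg:
  fixes F :: "complex ^ 'g::finite \<Rightarrow> complex"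
  assumes "continuous_on UNIV F"
  shows "(\<lambda>t. F (z + axis j (of_real t))) integrable_on {0..1::real}"
proof -
  have "continuous_on {0..1::real} (\<lambda>t. F (z + axis j (of_real t)))"
    by (rule continuous_on_compose2[OF assms]) (auto intro!: continuous_intros)
  then show ?thesis by (rule integrable_continuous_real)
qed

lemma cavg_commute:
  assumes "continuous_on UNIV F"
  shows "cavg j (cavg k F) = cavg k (cavg j F)"
proof
  fix z
  have "continuous_on (cbox (0, 0) (1::real, 1::real))
      (\<lambda>(t, s). F (z + axis j (of_real t) + axis k (of_real s)))"
    unfolding split_beta
    by (rule continuous_on_compose2[OF assms]) (auto intro!: continuous_intros)
  from integral_swap_continuous[OF this]
  show "cavg j (cavg k F) z = cavg k (cavg j F) z"
    by (simp add: cavg_def add_ac)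
qed

lemma cavg_avg_commute:
  assumes "continuous_on UNIV F"
  shows "cavg j (avg js F) = avg js (cavg j F)"
  using assms
proof (induction js)
  case (Cons k js)
  show ?case
    unfolding avg_Cons using Cons cavg_commute[OF continuous_on_avg[OF assms]] by metis
qed simp

lemma cavg_translate: "cavg j (\<lambda>z. F (z + a)) z = cavg j F (z + a)"
  by (simp add: cavg_def add_ac)

lemma avg_translate: "avg js (\<lambda>z. F (z + a)) z = avg js F (z + a)"
proof (induction js arbitrary: z)
  case (Cons j js)
  have "avg (j # js) (\<lambda>z. F (z + a)) z = cavg j (\<lambda>z. avg js F (z + a)) z"
    using Cons by (simp add: cavg_def)
  then show ?case by (simp add: cavg_translate)
qed simp

lemma avg_cmult: "avg js (\<lambda>z. c * F z) z = c * avg js F z"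
  by (induction js arbitrary: z) (simp_all add: cavg_def)

lemma cavg_add:
  assumes "continuous_on UNIV F" "continuous_on UNIV G"
  shows "cavg j (\<lambda>z. F z + G z) z = cavg j F z + cavg j G z"
  unfolding cavg_def by (intro integral_add integrable_cavg assms)

lemma avg_add:
  assumes "continuous_on UNIV F" "continuous_on UNIV G"
  shows "avg js (\<lambda>z. F z + G z) z = avg js F z + avg js G z"
proof (induction js arbitrary: z)
  case (Cons j js)
  then have "avg js (\<lambda>z. F z + G z) = (\<lambda>z. avg js F z + avg js G z)" by blast
  then show ?case
    using assms by (simp add: cavg_add continuous_on_avg)
qed simp

lemma avg_zero: "avg js (\<lambda>_. 0) z = 0"
  by (induction js arbitrary: z) (simp_all add: cavg_def)

lemma avg_sum:
  assumes "finite A" "\<And>a. a \<in> A \<Longrightarrow> continuous_on UNIV (F a)"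
  shows "avg js (\<lambda>z. \<Sum>a\<in>A. F a z) z = (\<Sum>a\<in>A. avg js (F a) z)"
  using assms
proof (induction A rule: finite_induct)
  case (insert a A)
  then have "continuous_on UNIV (F a)" "continuous_on UNIV (\<lambda>z. \<Sum>a\<in>A. F a z)"
    by (auto intro: continuous_on_sum)
  from avg_add[OF this] show ?case using insert by simp
qed (simp add: avg_zero)

definition real_vec :: "complex ^ 'g \<Rightarrow> bool"
  where "real_vec z \<longleftrightarrow> (\<forall>i. z $ i \<in> \<real>)"

text \<open>Averaging translates by real amounts only, so real points stay real and a bound there
  suffices. This is what makes uniform convergence of the theta series on real vectors enough to
  compute its average.\<close>

lemma norm_avg_le:
  assumes "continuous_on UNIV F" "\<And>z. real_vec z \<Longrightarrow> norm (F z) \<le> B" "real_vec z"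
  shows "norm (avg js F z) \<le> B"
  using assms(3)
proof (induction js arbitrary: z)
  case Nil
  then show ?case using assms by simp
next
  case (Cons j js)
  have *: "norm (avg js F (z + axis j (of_real t))) \<le> B" for t
    using Cons by (intro Cons.IH) (auto simp: real_vec_def axis_def)
  have "norm (integral (cbox 0 1) (\<lambda>t. avg js F (z + axis j (of_real t)))) \<le> B * measure lborel (cbox 0 (1::real))"
  proof (rule integrable_bound)
    show "0 \<le> B" using *[of 0] norm_ge_zero order_trans by blast
    show "(\<lambda>t. avg js F (z + axis j (of_real t))) integrable_on cbox 0 1"
      using integrable_cavg[OF continuous_on_avg[OF assms(1)]] by simp
  qed (use * in auto)
  then show ?case by (simp add: cavg_def)
qed

text \<open>Differentiating under the integral sign gives the integral of g' over a unit segment,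
  which is g (w + 1) - g w = 0; so the average is constant in w, with no contour to deform.\<close>

lemma integral_one_periodic_entire:
  fixes g :: "complex \<Rightarrow> complex"
  assumes "g holomorphic_on UNIV" "\<And>w. g (w + 1) = g w"
  shows "integral {0..1} (\<lambda>t. g (w + of_real t)) = integral {0..1} (\<lambda>t. g (of_real t))"
proof -
  have dg: "(g has_field_derivative deriv g w) (at w)" for w
    using assms(1) holomorphic_derivI[OF assms(1) open_UNIV] by simp
  have cg: "continuous_on UNIV g" using assms(1) holomorphic_on_imp_continuous_on by blast
  have cdg: "continuous_on UNIV (deriv g)"
    using holomorphic_deriv[OF assms(1) open_UNIV] holomorphic_on_imp_continuous_on by blast
  have "((\<lambda>w. integral (cbox 0 1) (\<lambda>t. g (w + of_real t))) has_field_derivative 0) (at w)" for w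
  proof -
    have "((\<lambda>w. integral (cbox 0 1) (\<lambda>t. g (w + of_real t))) has_field_derivative
       integral (cbox 0 1) (\<lambda>t::real. deriv g (w + of_real t))) (at w within UNIV)"
    proof (rule leibniz_rule_field_derivative)
      show "((\<lambda>w. g (w + of_real t)) has_field_derivative deriv g (w + of_real t)) (at w within UNIV)"
        for w and t :: real
        using DERIV_shift[of g "deriv g (w + of_real t)" w "of_real t"] dg by simp
      show "(\<lambda>t::real. g (w + of_real t)) integrable_on cbox 0 1" for w
        by (rule integrable_continuous)
          (rule continuous_on_compose2[OF cg], auto intro!: continuous_intros)
      show "continuous_on (UNIV \<times> cbox 0 1) (\<lambda>(w, t::real). deriv g (w + of_real t))"
        unfolding split_beta
        by (rule continuous_on_compose2[OF cdg]) (auto intro!: continuous_intros)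
    qed auto
    moreover have "integral (cbox 0 1) (\<lambda>t::real. deriv g (w + of_real t)) = 0"
    proof -
      have "((\<lambda>t::real. deriv g (w + of_real t)) has_integral
          g (w + of_real 1) - g (w + of_real 0)) {0..1}"
      proof (rule fundamental_theorem_of_calculus)
        fix t :: real
        have "((\<lambda>u. g (w + u)) has_field_derivative deriv g (w + of_real t)) (at (of_real t))"
          using DERIV_shift[of g "deriv g (w + of_real t)" "of_real t" w] dg by (simp add: add.commute)
        then show "((\<lambda>t. g (w + of_real t)) has_vector_derivative deriv g (w + of_real t)) (at t within {0..1})"
          by (rule has_vector_derivative_real_field)
      qed auto
      then show ?thesis using assms(2) by (simp add: has_integral_iff)
    qed
    ultimately show ?thesis by simp
  qed
  then have "\<exists>c. \<forall>w\<in>UNIV. integral (cbox 0 1) (\<lambda>t::real. g (w + of_real t)) = c"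
    by (intro has_field_derivative_zero_constant) simp_all
  then obtain c where c: "\<And>w. integral (cbox 0 1) (\<lambda>t::real. g (w + of_real t)) = c" by auto
  show ?thesis using c[of w] c[of 0] by simp
qed

lemma cavg_const_dir:
  assumes "(\<lambda>w. F (z + axis j w)) holomorphic_on UNIV" "\<And>z. F (z + axis j 1) = F z"
  shows "cavg j F (z + axis j w) = cavg j F z"
proof -
  define g where "g w = F (z + axis j w)" for w
  have "g (w + 1) = g w" for w
    using assms(2)[of "z + axis j w"] by (simp add: g_def axis_add add_ac)
  from integral_one_periodic_entire[of g w, OF _ this] assms(1)
  show ?thesis by (simp add: g_def[abs_def] cavg_def axis_add add_ac)
qed

text \<open>Commuting \<open>cavg j\<close> to the inside means that only \<open>F\<close> itself has to be holomorphic.\<close>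

lemma avg_const_dir:
  assumes "continuous_on UNIV F" "\<And>z j. (\<lambda>w. F (z + axis j w)) holomorphic_on UNIV"
    "\<And>z j. F (z + axis j 1) = F z" "j \<in> set js"
  shows "avg js F (z + axis j w) = avg js F z"
  using assms(4)
proof (induction js arbitrary: z)
  case (Cons k js)
  show ?case
  proof (cases "k = j")
    case True
    have "avg (k # js) F = avg js (cavg j F)"
      using True cavg_avg_commute[OF assms(1)] by simp
    moreover have "avg js (cavg j F) (z + axis j w) = avg js (\<lambda>z. cavg j F (z + axis j w)) z"
      by (simp add: avg_translate)
    moreover have "(\<lambda>z. cavg j F (z + axis j w)) = cavg j F"
      using cavg_const_dir[OF assms(2,3)] by blast
    ultimately show ?thesis by simp
  next
    case False
    then have "avg js F (z + axis j w + axis k v) = avg js F (z + axis k v)" for v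
      using Cons.IH[of "z + axis k v"] Cons.prems by (simp add: add_ac)
    then show ?thesis by (simp add: cavg_def)
  qed
qed simp

lemma avg_const:
  assumes "continuous_on UNIV F" "\<And>z j. (\<lambda>w. F (z + axis j w)) holomorphic_on UNIV"
    "\<And>z j. F (z + axis j 1) = F z" "set js = UNIV"
  shows "avg js F z = avg js F 0"
proof -
  have "avg js F (\<Sum>j\<in>A. axis j (z $ j)) = avg js F 0" if "finite A" for A
    using that
  proof (induction A rule: finite_induct)
    case (insert j A)
    have "avg js F ((\<Sum>j\<in>A. axis j (z $ j)) + axis j (z $ j)) = avg js F (\<Sum>j\<in>A. axis j (z $ j))"
      by (rule avg_const_dir) (use assms in auto)
    with insert show ?case by (simp add: add.commute)
  qed simp
  from this[of UNIV] have "avg js F (\<Sum>j\<in>UNIV. axis j (z $ j)) = avg js F 0" by simp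
  moreover have "(\<Sum>j\<in>UNIV. axis j (z $ j)) = z"
    by (simp add: vec_eq_iff axis_def)
  ultimately show ?thesis by simp
qed


text \<open>Close to t0 the powers \<open>Q ^ m\<close> are at least \<open>\<rho>' ^ m\<close>,
  while far from t0 they are at most \<open>\<rho> ^ m\<close> with \<rho> < \<rho>'. For large m
  the positive contribution of the peak outweighs the rest.\<close>

lemma peak_integral_pos:
  fixes h Q :: "real \<Rightarrow> real"
  assumes h: "continuous_on {0..1} h" and Q: "continuous_on {0..1} Q"
    and t0: "t0 \<in> {0<..<1}" "Q t0 = 1" "h t0 > 0"
    and Q1: "\<And>t. t \<in> {0..1} \<Longrightarrow> t \<noteq> t0 \<Longrightarrow> 0 \<le> Q t \<and> Q t < 1"
  shows "\<exists>m. integral {0..1} (\<lambda>t. h t * Q t ^ m) > 0"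
proof -
  define c where "c = h t0 / 2"
  have c: "c > 0" using t0 by (simp add: c_def)
  have t0': "t0 \<in> {0..1}" using t0 by auto
  have "\<exists>d>0. \<forall>t\<in>{0..1}. dist t t0 < d \<longrightarrow> dist (h t) (h t0) < c"
    using h t0' c unfolding continuous_on_iff by blast
  then obtain d1 where d1: "d1 > 0" "\<And>t. t \<in> {0..1} \<Longrightarrow> dist t t0 < d1 \<Longrightarrow> dist (h t) (h t0) < c"
    by blast
  define d where "d = min (d1 / 2) (min t0 (1 - t0))"
  have d: "d > 0" "d < d1" "d \<le> t0" "d \<le> 1 - t0"
    using d1 t0 by (auto simp: d_def min_def)
  have hc: "h t \<ge> c" if "t \<in> {t0 - d..t0 + d}" for t
  proof -
    have "dist (h t) (h t0) < c" using that d by (intro d1) (auto simp: dist_real_def)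
    then show ?thesis by (simp add: dist_real_def c_def abs_if split: if_splits)
  qed
  obtain B where B: "\<And>t. t \<in> {0..1} \<Longrightarrow> \<bar>h t\<bar> \<le> B"
  proof -
    have "bounded (h ` {0..1})" by (intro compact_imp_bounded compact_continuous_image h compact_Icc)
    then obtain B where "\<forall>x\<in>{0..1}. \<bar>h x\<bar> \<le> B" by (auto simp: bounded_iff)
    then show ?thesis using that by blast
  qed
  define W where "W = {0..t0 - d} \<union> {t0 + d..1}"
  have W: "compact W" "W \<noteq> {}" "W \<subseteq> {0..1} - {t0}" using d t0 by (auto simp: W_def)
  obtain x where x: "x \<in> W" "\<And>t. t \<in> W \<Longrightarrow> Q t \<le> Q x"
    using continuous_attains_sup[OF W(1,2) continuous_on_subset[OF Q]] W(3) by blast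
  define \<rho> where "\<rho> = Q x"
  have \<rho>: "0 \<le> \<rho>" "\<rho> < 1" using Q1[of x] subsetD[OF W(3) x(1)] by (auto simp: \<rho>_def)
  \<comment> \<open>A value strictly between the supremum \<rho> of Q away from the peak and Q t0 =
    1; the ratio \<rho> / \<rho>' < 1 decides the comparison at the end.\<close>
  define \<rho>' where "\<rho>' = (1 + \<rho>) / 2"
  have \<rho>': "\<rho> < \<rho>'" "\<rho>' < 1" "0 < \<rho>'" using \<rho> by (auto simp: \<rho>'_def)
  have "\<exists>d>0. \<forall>t\<in>{0..1}. dist t t0 < d \<longrightarrow> dist (Q t) (Q t0) < 1 - \<rho>'"
    using Q t0' diff_gt_0_iff_gt[THEN iffD2, OF \<rho>'(2)] unfolding continuous_on_iff by blast
  then obtain d2 where d2: "d2 > 0"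
      "\<And>t. t \<in> {0..1} \<Longrightarrow> dist t t0 < d2 \<Longrightarrow> dist (Q t) (Q t0) < 1 - \<rho>'"
    by blast
  define d' where "d' = min d (d2 / 2)"
  have d': "d' > 0" "d' \<le> d" "d' < d2" using d d2 by (auto simp: d'_def)
  have Q': "Q t \<ge> \<rho>'" if "t \<in> {t0 - d'..t0 + d'}" for t
  proof -
    have "dist (Q t) (Q t0) < 1 - \<rho>'" using that d d' by (intro d2) (auto simp: dist_real_def)
    then show ?thesis using t0 by (simp add: dist_real_def abs_if split: if_splits)
  qed
  have Q01: "0 \<le> Q t" "Q t \<le> 1" if "t \<in> {0..1}" for t
    using Q1[of t] that t0 by (cases "t = t0"; auto)+
  have B0: "B \<ge> 0" using B[OF t0'] by linarith
  \<comment> \<open>The error \<open>B * \<rho> ^ m\<close> is subtracted on all of [0, 1], so that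
    one comparison function serves three regions: the peak, the part of its neighbourhood where the
    integrand is merely nonnegative, and W.\<close>
  have lower: "2 * d' * (c * \<rho>' ^ m) - B * \<rho> ^ m \<le> integral {0..1} (\<lambda>t. h t * Q t ^ m)" for m
  proof -
    let ?I = "{t0 - d'..t0 + d'}"
    have "((\<lambda>t. c * \<rho>' ^ m) has_integral ((t0 + d') - (t0 - d')) * (c * \<rho>' ^ m)) ?I"
      using has_integral_const_real[of "c * \<rho>' ^ m" "t0 - d'" "t0 + d'"] d' by simp
    then have "((\<lambda>t. if t \<in> ?I then c * \<rho>' ^ m else 0) has_integral 2 * d' * (c * \<rho>' ^ m)) {0..1}"
      using d d' by (subst has_integral_restrict) auto
    moreover have "((\<lambda>t. B * \<rho> ^ m) has_integral B * \<rho> ^ m) {0..1::real}"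
      using has_integral_const_real[of "B * \<rho> ^ m" 0 1] by simp
    ultimately have 1: "((\<lambda>t. (if t \<in> ?I then c * \<rho>' ^ m else 0) - B * \<rho> ^ m) has_integral
        2 * d' * (c * \<rho>' ^ m) - B * \<rho> ^ m) {0..1}"
      by (rule has_integral_diff)
    have "(\<lambda>t. h t * Q t ^ m) integrable_on {0..1}"
      by (intro integrable_continuous_real continuous_intros h Q)
    then have 2: "((\<lambda>t. h t * Q t ^ m) has_integral integral {0..1} (\<lambda>t. h t * Q t ^ m)) {0..1}"
      by (rule integrable_integral)
    show ?thesis
    proof (rule has_integral_le[OF 1 2])
      fix t :: real
      assume t: "t \<in> {0..1}"
      have B\<rho>: "0 \<le> B * \<rho> ^ m" using B0 \<rho> by simp
      have Qm: "0 \<le> Q t ^ m" using Q01 t by simp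
      consider "t \<in> ?I" | "t \<notin> ?I" "t \<in> {t0 - d..t0 + d}" | "t \<in> W"
        using t by (force simp: W_def)
      then show "(if t \<in> ?I then c * \<rho>' ^ m else 0) - B * \<rho> ^ m \<le> h t * Q t ^ m"
      proof cases
        case 1
        then have "c * \<rho>' ^ m \<le> h t * Q t ^ m"
          using hc[of t] Q'[of t] c d' \<rho>' by (intro mult_mono power_mono) auto
        with 1 B\<rho> show ?thesis by simp
      next
        case 2
        then have "0 \<le> h t * Q t ^ m" using hc[of t] c Qm by simp
        moreover have "(if t \<in> ?I then c * \<rho>' ^ m else 0) = 0" using 2(1) by presburger
        ultimately show ?thesis using B\<rho> by linarith
      next
        case 3
        then have I: "t \<notin> ?I \<or> t = t0 - d' \<or> t = t0 + d'" using d d' by (auto simp: W_def)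
        have "Q t ^ m \<le> \<rho> ^ m" using x(2)[OF 3] Q01 t by (intro power_mono) (auto simp: \<rho>_def)
        then have "\<bar>h t * Q t ^ m\<bar> \<le> B * \<rho> ^ m"
          using B[OF t] Qm B0 by (simp add: abs_mult mult_mono)
        \<comment> \<open>W is closed and meets the inner interval in its endpoints when d' = d;
          there Q would be both at least \<rho>' and at most \<rho>.\<close>
        moreover have "t \<notin> ?I"
        proof
          assume "t \<in> ?I"
          then have "\<rho>' \<le> Q t" by (rule Q')
          with x(2)[OF 3] \<rho>' show False by (simp add: \<rho>_def)
        qed
        ultimately show ?thesis using abs_le_D2 by fastforce
      qed
    qed
  qed
  have "(\<lambda>m. B * (\<rho> / \<rho>') ^ m) \<longlonglongrightarrow> B * 0"
    using \<rho> \<rho>' by (intro tendsto_intros LIMSEQ_power_zero) auto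
  then have "\<forall>\<^sub>F m in sequentially. B * (\<rho> / \<rho>') ^ m < 2 * d' * c"
    by (rule order_tendstoD(2)) (use d' c in simp)
  then obtain m where "B * (\<rho> / \<rho>') ^ m < 2 * d' * c"
    by (auto simp: eventually_sequentially)
  then have "B * \<rho> ^ m < 2 * d' * (c * \<rho>' ^ m)"
    using \<rho>' by (simp add: power_divide field_simps)
  with lower[of m] have "0 < integral {0..1} (\<lambda>t. h t * Q t ^ m)" by linarith
  then show ?thesis by blast
qed

section \<open>The exponential e(x) and uniqueness of Fourier coefficients\<close>

lemma e2pi_add: "e2pi (x + y) = e2pi x * e2pi y"
  by (simp add: e2pi_def ring_distribs exp_add)

lemma e2pi_0 [simp]: "e2pi 0 = 1"
  by (simp add: e2pi_def)

lemma e2pi_nonzero [simp]: "e2pi x \<noteq> 0"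
  by (simp add: e2pi_def)

lemma e2pi_minus: "e2pi (- x) = inverse (e2pi x)"
  by (simp add: e2pi_def exp_minus)

lemma e2pi_Ints: "x \<in> \<int> \<Longrightarrow> e2pi x = 1"
  by (auto simp: e2pi_def exp_eq_1 elim!: Ints_cases)

lemma e2pi_of_nat_mult: "e2pi (of_nat n * x) = e2pi x ^ n"
  by (induction n) (simp_all add: ring_distribs e2pi_add)

lemma continuous_on_e2pi [continuous_intros]:
  "continuous_on S f \<Longrightarrow> continuous_on S (\<lambda>x. e2pi (f x))"
  unfolding e2pi_def by (intro continuous_intros)

lemma holomorphic_on_e2pi [holomorphic_intros]:
  "f holomorphic_on S \<Longrightarrow> (\<lambda>x. e2pi (f x)) holomorphic_on S"
  unfolding e2pi_def by (intro holomorphic_intros)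

lemma cos_2pi_e2pi: "of_real (cos (2 * pi * t)) = (e2pi (of_real t) + e2pi (- of_real t)) / 2"
proof -
  have "of_real (cos (2 * pi * t)) = cos (of_real (2 * pi * t) :: complex)"
    by (simp only: cos_of_real)
  then show ?thesis by (simp add: cos_exp_eq e2pi_def mult_ac)
qed

text \<open>Q is a trigonometric polynomial with its only peak at t0, so g is orthogonal to all its
  powers. But h, the real part of cnj (g t0) * g, is positive at t0, which contradicts
  \<open>peak_integral_pos\<close>.\<close>

lemma Fourier_unique_interval:
  fixes g :: "real \<Rightarrow> complex"
  assumes "continuous_on {0..1} g"
    and "\<And>k::int. integral {0..1} (\<lambda>t. g t * e2pi (of_int k * of_real t)) = 0"
    and t0: "t0 \<in> {0<..<1}"
  shows "g t0 = 0"
proof (rule ccontr)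
  assume nz: "g t0 \<noteq> 0"
  define Q where "Q t = (1 + cos (2 * pi * (t - t0))) / 2" for t
  have Qe: "of_real (Q t) = 1/2 + e2pi (- of_real t0) / 4 * e2pi (of_real t)
      + e2pi (of_real t0) / 4 * e2pi (- of_real t)" for t
  proof -
    have "of_real (Q t) = (1 + of_real (cos (2 * pi * (t - t0)))) / (2::complex)" by (simp add: Q_def)
    also have "of_real (cos (2 * pi * (t - t0))) =
        (e2pi (of_real t - of_real t0) + e2pi (of_real t0 - of_real t)) / 2"
      by (subst cos_2pi_e2pi) simp
    also have "e2pi (of_real t - of_real t0) = e2pi (- of_real t0) * e2pi (of_real t)"
      by (simp flip: e2pi_add)
    also have "e2pi (of_real t0 - of_real t) = e2pi (of_real t0) * e2pi (- of_real t)"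
      by (simp flip: e2pi_add)
    finally show ?thesis by (simp add: add_divide_distrib)
  qed
  have cQ: "continuous_on A Q" for A unfolding Q_def by (intro continuous_intros) auto
  \<comment> \<open>All frequencies k are treated at once, because multiplication by Q mixes k - 1,
    k and k + 1.\<close>
  have zero: "integral {0..1} (\<lambda>t. g t * of_real (Q t) ^ m * e2pi (of_int k * of_real t)) = 0"
    for m :: nat and k :: int
  proof (induction m arbitrary: k)
    case 0
    then show ?case using assms by simp
  next
    case (Suc m)
    let ?G = "\<lambda>k t. g t * of_real (Q t) ^ m * e2pi (of_int k * of_real t)"
    have int: "(\<lambda>t. ?G k t) integrable_on {0..1}" for k :: int
      by (intro integrable_continuous_real continuous_intros assms cQ)
    have "g t * of_real (Q t) ^ Suc m * e2pi (of_int k * of_real t) =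
       1/2 * ?G k t + e2pi (- of_real t0) / 4 * ?G (k + 1) t + e2pi (of_real t0) / 4 * ?G (k - 1) t" for t
    proof -
      have "e2pi (of_int (k + 1) * of_real t) = e2pi (of_real t) * e2pi (of_int k * of_real t)"
        "e2pi (of_int (k - 1) * of_real t) = e2pi (- of_real t) * e2pi (of_int k * of_real t)"
        by (simp_all add: e2pi_add[symmetric] ring_distribs add.commute)
      then show ?thesis unfolding power_Suc Qe by (simp only: ring_distribs mult_ac)
    qed
    then have "integral {0..1} (\<lambda>t. g t * of_real (Q t) ^ Suc m * e2pi (of_int k * of_real t)) =
      integral {0..1} (\<lambda>t. 1/2 * ?G k t + e2pi (- of_real t0) / 4 * ?G (k + 1) t + e2pi (of_real t0) / 4 * ?G (k - 1) t)"
      by (simp only:)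
    also have "\<dots> = 1/2 * integral {0..1} (?G k) + e2pi (- of_real t0) / 4 * integral {0..1} (?G (k + 1))
       + e2pi (of_real t0) / 4 * integral {0..1} (?G (k - 1))"
      by (simp only: integral_add integral_mult_right integrable_add integrable_on_mult_right int)
    finally show ?case by (simp only: Suc.IH mult_zero_right add_0)
  qed
  define h where "h t = Re (cnj (g t0) * g t)" for t
  have ch: "continuous_on {0..1} h" unfolding h_def by (intro continuous_intros assms)
  have "\<exists>m. integral {0..1} (\<lambda>t. h t * Q t ^ m) > 0"
  proof (rule peak_integral_pos[OF ch cQ t0])
    show "Q t0 = 1" by (simp add: Q_def)
    show "h t0 > 0" using nz by (simp add: h_def complex_neq_0 power2_eq_square)
    show "0 \<le> Q t \<and> Q t < 1" if "t \<in> {0..1}" "t \<noteq> t0" for t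
    proof -
      have "cos (2 * pi * (t - t0)) \<noteq> 1"
      proof
        assume "cos (2 * pi * (t - t0)) = 1"
        then obtain n :: int where "2 * pi * (t - t0) = of_int n * 2 * pi"
          using cos_one_2pi_int by blast
        then have "2 * pi * (t - t0) = 2 * pi * of_int n" by simp
        then have "t - t0 = of_int n" by (subst (asm) mult_cancel_left) simp
        moreover have "\<bar>t - t0\<bar> < 1" using that t0 by auto
        ultimately have "n = 0" by simp
        with \<open>t - t0 = of_int n\<close> that show False by simp
      qed
      then have "cos (2 * pi * (t - t0)) < 1" using cos_le_one[of "2 * pi * (t - t0)"] by linarith
      moreover have "0 \<le> 1 + cos (2 * pi * (t - t0))"
        using cos_ge_minus_one[of "2 * pi * (t - t0)"] by linarith
      ultimately show ?thesis by (simp add: Q_def)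
    qed
  qed
  then obtain m where m: "integral {0..1} (\<lambda>t. h t * Q t ^ m) > 0" by blast
  have "((\<lambda>t. g t * of_real (Q t) ^ m) has_integral 0) {0..1}"
    using zero[of m 0] by (simp add: has_integral_iff)
      (intro integrable_continuous_real continuous_intros assms cQ)
  from has_integral_linear[OF has_integral_mult_right[OF this, of "cnj (g t0)"] bounded_linear_Re]
  have "((\<lambda>t. h t * Q t ^ m) has_integral 0) {0..1}"
    by (simp add: o_def h_def mult.assoc[symmetric] flip: of_real_power)
  with m show False by (simp add: has_integral_iff)
qed

lemma avg_cmult_indep:
  assumes "\<And>z i w. i \<in> set js \<Longrightarrow> c (z + axis i w) = c z"
  shows "avg js (\<lambda>z. c z * F z) z = c z * avg js F z"
  using assms
proof (induction js arbitrary: z)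
  case (Cons j js)
  then have "avg js (\<lambda>z. c z * F z) = (\<lambda>z. c z * avg js F z)" by force
  then show ?case using Cons.prems by (simp add: cavg_def)
qed simp

text \<open>Induction on the coordinates. A partial Fourier coefficient over the remaining
  coordinates, restricted to a real segment in direction j, is a function of one real variable; its
  own Fourier coefficients are coefficients of F in one coordinate more, hence vanish.\<close>

lemma Fourier_unique_avg:
  fixes F :: "complex ^ 'g::finite \<Rightarrow> complex"
  assumes F: "continuous_on UNIV F" and per: "\<And>z j. F (z + axis j 1) = F z"
    and js: "distinct js"
    and "\<And>(k :: int ^ 'g) z. avg js (\<lambda>z. e2pi (\<Sum>i\<in>set js. of_int (k $ i) * z $ i) * F z) z = 0"
  shows "F z = 0"
  using js assms(4)
proof (induction js)
  case Nil
  then show ?case by simp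
next
  case (Cons j js)
  let ?e = "\<lambda>k z. e2pi (\<Sum>i\<in>set js. of_int (k $ i) * z $ i)"
  have j: "j \<notin> set js" and dist: "distinct js" using Cons.prems by auto
  have "avg js (\<lambda>z. ?e k z * F z) z = 0" for k :: "int ^ 'g" and z
  proof -
    define H where "H = avg js (\<lambda>z. ?e k z * F z)"
    have eF: "continuous_on UNIV (\<lambda>z. ?e k z * F z)"
      by (intro continuous_intros F)
    have cH: "continuous_on UNIV H" unfolding H_def by (rule continuous_on_avg[OF eF])
    have ej: "?e k (z + axis j w) = ?e k z" for z w
      using j by (intro arg_cong[where f=e2pi] sum.cong) (auto simp: axis_def)
    have perH: "H (z + axis j 1) = H z" for z
    proof -
      have "avg js (\<lambda>z. ?e k (z + axis j 1) * F (z + axis j 1)) z = H (z + axis j 1)"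
        unfolding H_def by (rule avg_translate)
      then show ?thesis unfolding H_def ej per by (rule sym)
    qed
    define G where "G t = H (z + axis j (of_real t))" for t :: real
    have cG: "continuous_on A G" for A
      unfolding G_def by (rule continuous_on_compose2[OF cH]) (auto intro!: continuous_intros)
    have "integral {0..1} (\<lambda>t. G t * e2pi (of_int l * of_real t)) = 0" for l :: int
    proof -
      \<comment> \<open>Overwriting entry j of k by l makes the one-variable character of frequency
        l part of the character on \<open>j # js\<close>.\<close>
      define k' where "k' = (\<chi> i. if i = j then l else k $ i)"
      have k': "e2pi (\<Sum>i\<in>set (j # js). of_int (k' $ i) * z $ i) = e2pi (of_int l * z $ j) * ?e k z" for z :: "complex ^ 'g"
      proof -
        have "(\<Sum>i\<in>set js. of_int (k' $ i) * z $ i) = (\<Sum>i\<in>set js. of_int (k $ i) * z $ i)"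
          using j by (intro sum.cong) (auto simp: k'_def)
        then show ?thesis using j by (simp add: e2pi_add k'_def)
      qed
      have "0 = avg (j # js) (\<lambda>z. e2pi (\<Sum>i\<in>set (j # js). of_int (k' $ i) * z $ i) * F z) z"
        using Cons.prems(2) by simp
      also have "\<dots> = cavg j (avg js (\<lambda>z. e2pi (of_int l * z $ j) * (?e k z * F z))) z"
        unfolding k' by (simp add: mult.assoc)
      also have "avg js (\<lambda>z. e2pi (of_int l * z $ j) * (?e k z * F z)) = (\<lambda>z. e2pi (of_int l * z $ j) * H z)"
        unfolding H_def by (intro ext avg_cmult_indep) (use j in \<open>auto simp: axis_def\<close>)
      also have "cavg j (\<lambda>z. e2pi (of_int l * z $ j) * H z) z =
          integral {0..1} (\<lambda>t. e2pi (of_int l * z $ j) * (G t * e2pi (of_int l * of_real t)))"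
        by (simp add: cavg_def G_def axis_def ring_distribs e2pi_add mult_ac)
      finally show ?thesis by simp
    qed
    then have "G t = 0" if "t \<in> {0<..<1}" for t
      using that cG by (intro Fourier_unique_interval[of G]) auto
    \<comment> \<open>The one-variable result covers interior points only; continuity carries it to
      the endpoint 0, which corresponds to z itself.\<close>
    then have "G 0 = 0"
    proof -
      have "closure {0<..<1::real} = {0..1}" by simp
      then have "G t = 0" if "t \<in> {0..1}" for t
        using continuous_constant_on_closure[of "{0<..<1}" G 0 t] cG that
          \<open>\<And>t. t \<in> {0<..<1} \<Longrightarrow> G t = 0\<close> by simp
      then show ?thesis by simp
    qed
    then show ?thesis by (simp add: G_def H_def axis_def zero_vec_def[symmetric])
  qed
  with dist show ?case by (rule Cons.IH)
qed


section \<open>Quasi-periodic functions and the Riemann theta function\<close>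

text \<open>Bilinear, without complex conjugation, so that exponents built from it are holomorphic
  in z.\<close>

definition cdot :: "complex ^ 'g::finite \<Rightarrow> complex ^ 'g \<Rightarrow> complex" (infixl "\<star>" 70)
  where "x \<star> y = (\<Sum>i\<in>UNIV. x $ i * y $ i)"

lemma cdot_commute: "x \<star> y = y \<star> x"
  by (simp add: cdot_def mult.commute)

lemma cdot_add_left: "(x + y) \<star> z = x \<star> z + y \<star> z"
  and cdot_add_right: "z \<star> (x + y) = z \<star> x + z \<star> y"
  and cdot_diff_left: "(x - y) \<star> z = x \<star> z - y \<star> z"
  and cdot_diff_right: "z \<star> (x - y) = z \<star> x - z \<star> y"
  by (simp_all add: cdot_def ring_distribs sum.distrib sum_subtractf)

lemma cdot_minus_left: "(- x) \<star> z = - (x \<star> z)"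
  and cdot_minus_right: "z \<star> (- x) = - (z \<star> x)"
  by (simp_all add: cdot_def sum_negf)

lemma cdot_scale_left: "(c *s x) \<star> z = c * (x \<star> z)"
  and cdot_scale_right: "z \<star> (c *s x) = c * (z \<star> x)"
  by (simp_all add: cdot_def sum_distrib_left mult_ac)

lemma cdot_zero [simp]: "0 \<star> x = 0" "x \<star> 0 = 0"
  by (simp_all add: cdot_def)

lemmas cdot_linear = cdot_add_left cdot_add_right cdot_diff_left cdot_diff_right
  cdot_minus_left cdot_minus_right

lemma cdot_axis: "x \<star> axis j w = x $ j * w"
  by (simp add: cdot_def axis_def if_distrib[of "(*) _"] cong: if_cong)

lemma cdot_matrix: "x \<star> (A *v y) = (transpose A *v x) \<star> y"
proof -
  have "x \<star> (A *v y) = (\<Sum>i\<in>UNIV. \<Sum>j\<in>UNIV. x $ i * (A $ i $ j * y $ j))"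
    by (simp add: cdot_def matrix_vector_mult_def sum_distrib_left)
  also have "\<dots> = (\<Sum>j\<in>UNIV. \<Sum>i\<in>UNIV. x $ i * (A $ i $ j * y $ j))"
    by (rule sum.swap)
  finally show ?thesis
    by (simp add: cdot_def matrix_vector_mult_def transpose_def sum_distrib_left sum_distrib_right mult_ac)
qed

lemma cdot_symmetric_matrix: "transpose Z = Z \<Longrightarrow> x \<star> (Z *v y) = y \<star> (Z *v x)"
  by (metis cdot_commute cdot_matrix)

lemma continuous_on_cdot [continuous_intros]:
  "continuous_on S f \<Longrightarrow> continuous_on S g \<Longrightarrow> continuous_on S (\<lambda>x. f x \<star> g x)"
  unfolding cdot_def by (intro continuous_intros)

definition Zvec :: "(complex ^ 'g) set"
  where "Zvec = {x. \<forall>i. x $ i \<in> \<int>}"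

definition of_ivec :: "int ^ 'g \<Rightarrow> complex ^ 'g"
  where "of_ivec n = (\<chi> i. of_int (n $ i))"

lemma of_ivec_nth [simp]: "of_ivec n $ i = of_int (n $ i)"
  by (simp add: of_ivec_def)

lemma of_ivec_Zvec [simp]: "of_ivec n \<in> Zvec"
  by (simp add: Zvec_def)

lemma Zvec_cases:
  assumes "x \<in> Zvec"
  obtains n where "x = of_ivec n"
proof
  have "x $ i = of_int \<lfloor>Re (x $ i)\<rfloor>" for i
  proof -
    have "x $ i \<in> \<int>" using assms by (simp add: Zvec_def)
    then show ?thesis by (elim Ints_cases) simp
  qed
  then show "x = of_ivec (\<chi> i. \<lfloor>Re (x $ i)\<rfloor>)" by (simp add: vec_eq_iff)
qed

lemma of_ivec_add: "of_ivec (m + n) = of_ivec m + of_ivec n"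
  and of_ivec_minus: "of_ivec (- n) = - of_ivec n"
  by (simp_all add: vec_eq_iff)

lemma of_ivec_0 [simp]: "of_ivec 0 = 0"
  by (simp add: vec_eq_iff)

lemma Zvec_add [simp]: "x \<in> Zvec \<Longrightarrow> y \<in> Zvec \<Longrightarrow> x + y \<in> Zvec"
  and Zvec_minus [simp]: "x \<in> Zvec \<Longrightarrow> - x \<in> Zvec"
  and Zvec_diff [simp]: "x \<in> Zvec \<Longrightarrow> y \<in> Zvec \<Longrightarrow> x - y \<in> Zvec"
  by (simp_all add: Zvec_def)

lemma Zvec_axis [simp]: "axis j 1 \<in> Zvec"
  by (simp add: Zvec_def axis_def)

lemma cdot_Ints: "x \<in> Zvec \<Longrightarrow> y \<in> Zvec \<Longrightarrow> x \<star> y \<in> \<int>"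
  by (auto simp: Zvec_def cdot_def intro!: Ints_sum Ints_mult)

text \<open>The amount of several-variable holomorphy that the averages need. All complex lines are
  taken, not only those parallel to an axis, so that the property survives the linear substitution
  in \<open>tr_fun\<close>.\<close>

definition entire_on_lines :: "(complex ^ 'g::finite \<Rightarrow> complex) \<Rightarrow> bool"
  where "entire_on_lines f \<longleftrightarrow> continuous_on UNIV f \<and> (\<forall>z v. (\<lambda>w. f (z + w *s v)) holomorphic_on UNIV)"

lemma entire_on_lines_axis:
  assumes "entire_on_lines f"
  shows "(\<lambda>w. f (z + axis j w)) holomorphic_on UNIV"
proof -
  have "(\<lambda>w. f (z + axis j w)) = (\<lambda>w. f (z + w *s axis j 1))"
    by (intro ext arg_cong[where f="\<lambda>x. f (z + x)"]) (simp add: vec_eq_iff axis_def)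
  then show ?thesis using assms by (simp add: entire_on_lines_def)
qed

definition quasi_periodic :: "complex ^ 'g ^ 'g::finite \<Rightarrow> (complex ^ 'g \<Rightarrow> complex) \<Rightarrow> bool"
  where "quasi_periodic Z f \<longleftrightarrow> (\<forall>n\<in>Zvec. \<forall>z. f (z + n) = f z \<and>
    f (z + Z *v n) = e2pi (- (n \<star> (Z *v n)) / 2 - n \<star> z) * f z)"

text \<open>The Fourier coefficients of \<open>f\<close> do not depend on the height at which they are computed, and
  translation by \<open>Z n\<close> shifts them; hence all of them are multiples of the constant one.\<close>

lemma quasi_periodic_eq_0:
  fixes f :: "complex ^ 'g::finite \<Rightarrow> complex"
  assumes f: "entire_on_lines f" "quasi_periodic Z f"
    and js: "distinct js" "set js = UNIV" and avg0: "avg js f 0 = 0"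
  shows "f z = 0"
proof (rule Fourier_unique_avg[OF _ _ js(1)])
  show cf: "continuous_on UNIV f" using f by (simp add: entire_on_lines_def)
  show per: "f (z + axis j 1) = f z" for z j
    using f(2) by (simp add: quasi_periodic_def)
  fix k :: "int ^ 'g" and z :: "complex ^ 'g"
  define n where "n = of_ivec k"
  define G where "G z = e2pi (n \<star> z) * f z" for z
  have G_eq: "avg js (\<lambda>z. e2pi (\<Sum>i\<in>set js. of_int (k $ i) * z $ i) * f z) = avg js G"
    by (simp add: js G_def[abs_def] n_def cdot_def)
  have n: "n \<in> Zvec" by (simp add: n_def)
  have const: "avg js G z = avg js G 0" for z
  proof (rule avg_const[OF _ _ _ js(2)])
    show "continuous_on UNIV G" unfolding G_def by (intro continuous_intros cf)
    show "(\<lambda>w. G (z + axis j w)) holomorphic_on UNIV" for z j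
      using entire_on_lines_axis[OF f(1)] unfolding G_def cdot_add_right cdot_axis
      by (intro holomorphic_intros)
    show "G (z + axis j 1) = G z" for z j
      using cdot_Ints[OF n Zvec_axis[of j]] by (simp add: G_def cdot_add_right e2pi_add per e2pi_Ints)
  qed
  \<comment> \<open>The quasi-period contributes - n \<star> z to the exponent, which cancels the
    character; only a constant is left in front of f.\<close>
  have "G (z + Z *v n) = e2pi (n \<star> (Z *v n) / 2) * f z" for z
  proof -
    have "G (z + Z *v n) = e2pi (n \<star> (z + Z *v n)) * (e2pi (- (n \<star> (Z *v n)) / 2 - n \<star> z) * f z)"
      using f(2) n by (simp add: G_def quasi_periodic_def)
    also have "\<dots> = e2pi (n \<star> (z + Z *v n) + (- (n \<star> (Z *v n)) / 2 - n \<star> z)) * f z"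
      by (simp only: e2pi_add mult.assoc)
    also have "n \<star> (z + Z *v n) + (- (n \<star> (Z *v n)) / 2 - n \<star> z) = n \<star> (Z *v n) / 2"
      by (simp add: cdot_linear)
    finally show ?thesis .
  qed
  then have "avg js (\<lambda>z. G (z + Z *v n)) 0 = e2pi (n \<star> (Z *v n) / 2) * avg js f 0"
    by (simp add: avg_cmult)
  then have "avg js G (0 + Z *v n) = 0" unfolding avg_translate by (simp add: avg0)
  then have "avg js G z = 0" using const[of z] const[of "0 + Z *v n"] by simp
  then show "avg js (\<lambda>z. e2pi (\<Sum>i\<in>set js. of_int (k $ i) * z $ i) * f z) z = 0"
    by (simp only: G_eq)
qed

abbreviation theta_term :: "complex ^ 'g ^ 'g::finite \<Rightarrow> int ^ 'g \<Rightarrow> complex ^ 'g \<Rightarrow> complex"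
  where "theta_term Z n z \<equiv> e2pi (of_ivec n \<star> (Z *v of_ivec n) / 2 + of_ivec n \<star> z)"

definition riemann_theta :: "complex ^ 'g ^ 'g::finite \<Rightarrow> complex ^ 'g \<Rightarrow> complex"
  where "riemann_theta Z z =
    (\<Sum>\<^sub>\<infinity>n :: int ^ 'g. theta_term Z n z)"

section \<open>Convergence of the theta series\<close>

lemma summable_on_exp_neg_abs: "(\<lambda>n::int. exp (- \<bar>real_of_int n\<bar>)) summable_on UNIV"
proof -
  have "summable (\<lambda>n. exp (-1::real) ^ n)" by (intro summable_geometric) simp
  then have "(\<lambda>n::nat. exp (-1::real) ^ n) summable_on UNIV"
    by (subst summable_on_UNIV_nonneg_real_iff) auto
  then have s: "(\<lambda>n::nat. exp (- real n)) summable_on UNIV"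
    by (simp flip: exp_of_nat_mult)
  have "(\<lambda>n::int. exp (- \<bar>real_of_int n\<bar>)) summable_on (range int)"
    using s by (subst summable_on_reindex) (auto simp: o_def)
  moreover have "(\<lambda>n::int. exp (- \<bar>real_of_int n\<bar>)) summable_on (range (\<lambda>n. - int n))"
    using s by (subst summable_on_reindex) (auto simp: o_def inj_on_def)
  ultimately have "(\<lambda>n::int. exp (- \<bar>real_of_int n\<bar>)) summable_on (range int \<union> range (\<lambda>n. - int n))"
    by (rule summable_on_union)
  moreover have "range int \<union> range (\<lambda>n. - int n) = UNIV"
    by (auto simp: image_iff) (metis int_cases2)
  ultimately show ?thesis by simp
qed

lemma summable_on_Gaussian:
  fixes a b :: real
  assumes "a > 0"
  shows "(\<lambda>n::int. exp (b * \<bar>real_of_int n\<bar> - a * (real_of_int n)\<^sup>2)) summable_on UNIV"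
proof -
  \<comment> \<open>The exponential of the maximum of (b + 1) x - a \<open>x^2\<close>, so that C
    exp (- |n|) dominates the Gaussian.\<close>
  define C where "C = exp ((b + 1)\<^sup>2 / (4 * a))"
  have "(\<lambda>n::int. C * exp (- \<bar>real_of_int n\<bar>)) summable_on UNIV"
    by (intro summable_on_cmult_right summable_on_exp_neg_abs)
  moreover have "norm (exp (b * \<bar>real_of_int n\<bar> - a * (real_of_int n)\<^sup>2)) \<le> C * exp (- \<bar>real_of_int n\<bar>)" for n
  proof -
    let ?x = "\<bar>real_of_int n\<bar>"
    have "0 \<le> (2 * a * ?x - (b + 1))\<^sup>2 / (4 * a)" using assms by simp
    also have "\<dots> = a * ?x\<^sup>2 - (b + 1) * ?x + (b + 1)\<^sup>2 / (4 * a)"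
      using assms by (simp add: power2_eq_square field_simps)
    finally have "b * ?x - a * (real_of_int n)\<^sup>2 \<le> (b + 1)\<^sup>2 / (4 * a) - ?x"
      by (simp add: algebra_simps)
    then show ?thesis by (simp add: C_def flip: exp_add)
  qed
  ultimately show ?thesis
    by (auto intro: abs_summable_summable[OF Infinite_Sum.abs_summable_on_comparison_test'])
qed

lemma summable_on_prod_vec:
  fixes g :: "int \<Rightarrow> real"
  assumes "g summable_on UNIV" "\<And>n. g n > 0"
  shows "(\<lambda>n :: int ^ 'g::finite. \<Prod>i\<in>UNIV. g (n $ i)) summable_on UNIV"
proof -
  have abs: "(\<lambda>n. norm (g n)) summable_on UNIV"
    using assms by (simp add: less_imp_le)
  \<comment> \<open>A divergent \<open>infsum\<close> equals 0 by convention. The multiple sum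
    equals a power of this number, so its being nonzero proves that the multiple series
    converges.\<close>
  have "infsum g UNIV \<noteq> 0"
  proof
    assume "infsum g UNIV = 0"
    then have "g 0 = 0"
      by (intro nonneg_infsum_le_0D[of g UNIV]) (use assms in \<open>auto intro: less_imp_le\<close>)
    with assms(2)[of 0] show False by simp
  qed
  then have "infsum (\<lambda>f. \<Prod>i\<in>(UNIV :: 'g set). g (f i)) (Pi\<^sub>E UNIV (\<lambda>_. UNIV)) \<noteq> 0"
    using abs by (subst infsum_prod_PiE_abs) auto
  then have "(\<lambda>f. \<Prod>i\<in>(UNIV :: 'g set). g (f i)) summable_on (Pi\<^sub>E UNIV (\<lambda>_. UNIV))"
    using infsum_not_exists by blast
  then have "(\<lambda>f. \<Prod>i\<in>(UNIV :: 'g set). g (f i)) summable_on UNIV"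
    by (simp add: PiE_UNIV_domain)
  moreover have "bij_betw (vec_nth :: int ^ 'g \<Rightarrow> _) UNIV UNIV"
    by (rule bij_betw_byWitness[where f'=vec_lambda]) auto
  ultimately show ?thesis
    using summable_on_reindex_bij_betw[of "vec_nth :: int ^ 'g \<Rightarrow> _" UNIV UNIV "\<lambda>f. \<Prod>i\<in>UNIV. g (f i)"]
    by simp
qed

lemma norm_axis: "norm (axis j w :: 'a::real_normed_vector ^ 'g::finite) = norm w"
proof -
  have "(\<Sum>i\<in>UNIV. (norm (axis j w $ i :: 'a))\<^sup>2) = (\<Sum>i\<in>(UNIV :: 'g set). if i = j then (norm w)\<^sup>2 else 0)"
    by (intro sum.cong) (auto simp: axis_def)
  then show ?thesis by (simp add: norm_vec_def L2_set_def)
qed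

lemma norm_smult: "norm (c *s x :: complex ^ 'g::finite) = norm c * norm x"
  by (simp add: norm_vec_def norm_mult L2_set_right_distrib)

text \<open>The constant is the minimum of the quadratic form on the compact unit sphere;
  homogeneity extends the bound to all vectors.\<close>

lemma siegel_coercive:
  fixes Z :: "complex ^ 'g ^ 'g::finite"
  assumes "Z \<in> siegel"
  obtains c where "c > 0" "\<And>x :: real ^ 'g. x \<bullet> ((\<chi> i j. Im (Z $ i $ j)) *v x) \<ge> c * (norm x)\<^sup>2"
proof -
  define Y where "Y = (\<chi> i j. Im (Z $ i $ j))"
  have pos: "x \<bullet> (Y *v x) > 0" if "x \<noteq> 0" for x
    using assms that by (simp add: siegel_def Y_def)
  have cont: "continuous_on (sphere 0 1) (\<lambda>x. x \<bullet> (Y *v x))"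
    by (intro continuous_intros linear_continuous_on) (simp add: linear_linear)
  have ne: "sphere (0::real^'g) 1 \<noteq> {}"
  proof -
    have "axis undefined 1 \<in> sphere (0::real^'g) 1" by (simp add: norm_axis)
    then show ?thesis by blast
  qed
  obtain u where u: "u \<in> sphere 0 1" "\<And>x. x \<in> sphere 0 1 \<Longrightarrow> u \<bullet> (Y *v u) \<le> x \<bullet> (Y *v x)"
    using continuous_attains_inf[OF compact_sphere ne cont] by blast
  have "u \<noteq> 0" using u(1) by auto
  have "u \<bullet> (Y *v u) * (norm x)\<^sup>2 \<le> x \<bullet> (Y *v x)" for x
  proof (cases "x = 0")
    case False
    then have "u \<bullet> (Y *v u) \<le> (x /\<^sub>R norm x) \<bullet> (Y *v (x /\<^sub>R norm x))" by (intro u) auto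
    also have "\<dots> = (x \<bullet> (Y *v x)) / (norm x)\<^sup>2"
      using False by (simp add: matrix_vector_mult_scaleR power2_eq_square field_simps)
    finally show ?thesis using False by (simp add: field_simps)
  qed simp
  then show ?thesis using that[of "u \<bullet> (Y *v u)"] pos[OF \<open>u \<noteq> 0\<close>] by (simp add: Y_def)
qed

lemma norm_e2pi: "norm (e2pi w) = exp (- 2 * pi * Im w)"
  by (simp add: e2pi_def norm_exp_eq_Re)

text \<open>The majorant is uniform on strips of bounded imaginary part and has product form, which
  reduces its summability to the one-dimensional Gaussian. It is used on bounded sets and, with R =
  0, on real vectors.\<close>

lemma theta_term_bound:
  fixes Z :: "complex ^ 'g ^ 'g::finite"
  assumes Z: "Z \<in> siegel"
  obtains M :: "int ^ 'g \<Rightarrow> real" where "M summable_on UNIV"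
    "\<And>n (z :: complex ^ 'g). (\<And>i. \<bar>Im (z $ i)\<bar> \<le> R) \<Longrightarrow>
      norm (theta_term Z n z) \<le> M n"
proof -
  obtain c where c: "c > 0" "\<And>x :: real ^ 'g. x \<bullet> ((\<chi> i j. Im (Z $ i $ j)) *v x) \<ge> c * (norm x)\<^sup>2"
    using siegel_coercive[OF Z] by blast
  define g where "g k = exp (2 * pi * R * \<bar>real_of_int k\<bar> - pi * c * (real_of_int k)\<^sup>2)" for k
  define M where "M n = (\<Prod>i\<in>UNIV. g (n $ i))" for n :: "int ^ 'g"
  have "M summable_on UNIV"
    unfolding M_def[abs_def]
    by (rule summable_on_prod_vec) (use c in \<open>auto simp: g_def[abs_def] intro!: summable_on_Gaussian\<close>)
  moreover have "norm (theta_term Z n z) \<le> M n"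
    if R: "\<And>i. \<bar>Im (z $ i)\<bar> \<le> R" for n and z :: "complex ^ 'g"
  proof -
    define x :: "real ^ 'g" where "x = (\<chi> i. of_int (n $ i))"
    have "Im (of_ivec n \<star> (Z *v of_ivec n)) = x \<bullet> ((\<chi> i j. Im (Z $ i $ j)) *v x)"
      by (simp add: cdot_def matrix_vector_mult_def inner_vec_def x_def Im_sum)
    also have "\<dots> \<ge> c * (norm x)\<^sup>2" by (rule c)
    finally have 1: "Im (of_ivec n \<star> (Z *v of_ivec n)) \<ge> c * (norm x)\<^sup>2" .
    have "(norm x)\<^sup>2 = (\<Sum>i\<in>UNIV. (real_of_int (n $ i))\<^sup>2)"
      by (simp only: power2_norm_eq_inner inner_vec_def) (simp add: x_def power2_eq_square)
    with 1 have 1: "Im (of_ivec n \<star> (Z *v of_ivec n)) \<ge> (\<Sum>i\<in>UNIV. c * (real_of_int (n $ i))\<^sup>2)"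
      by (simp add: sum_distrib_left)
    have 2: "Im (of_ivec n \<star> z) \<ge> - (\<Sum>i\<in>UNIV. R * \<bar>real_of_int (n $ i)\<bar>)"
    proof -
      have "- (real_of_int (n $ i) * Im (z $ i)) \<le> R * \<bar>real_of_int (n $ i)\<bar>" for i
      proof -
        have "- (real_of_int (n $ i) * Im (z $ i)) \<le> \<bar>real_of_int (n $ i) * Im (z $ i)\<bar>" by linarith
        also have "\<dots> \<le> R * \<bar>real_of_int (n $ i)\<bar>"
          using R[of i] by (simp add: abs_mult mult.commute mult_right_mono)
        finally show ?thesis .
      qed
      then have "(\<Sum>i\<in>UNIV. - (real_of_int (n $ i) * Im (z $ i))) \<le> (\<Sum>i\<in>UNIV. R * \<bar>real_of_int (n $ i)\<bar>)"
        by (intro sum_mono)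
      then show ?thesis by (simp add: cdot_def Im_sum sum_negf)
    qed
    have "norm (theta_term Z n z) =
       exp (- pi * Im (of_ivec n \<star> (Z *v of_ivec n)) - 2 * pi * Im (of_ivec n \<star> z))"
      by (simp add: norm_e2pi algebra_simps)
    also have "\<dots> \<le> exp (- pi * (\<Sum>i\<in>UNIV. c * (real_of_int (n $ i))\<^sup>2)
         - 2 * pi * (- (\<Sum>i\<in>UNIV. R * \<bar>real_of_int (n $ i)\<bar>)))"
      unfolding exp_le_cancel_iff using 1 2
      by (intro diff_mono mult_left_mono mult_left_mono_neg) auto
    also have "\<dots> = exp (\<Sum>i\<in>UNIV. 2 * pi * R * \<bar>real_of_int (n $ i)\<bar> - pi * c * (real_of_int (n $ i))\<^sup>2)"
      by (simp add: sum_subtractf sum_distrib_left sum_negf mult.assoc)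
    also have "\<dots> = M n" by (simp add: M_def g_def exp_sum)
    finally show ?thesis .
  qed
  ultimately show ?thesis using that by blast
qed

lemma entire_on_lines_riemann_theta:
  fixes Z :: "complex ^ 'g ^ 'g::finite"
  assumes Z: "Z \<in> siegel"
  shows "entire_on_lines (riemann_theta Z)"
proof -
  \<comment> \<open>The parametrisation h is left open: the identity on balls yields continuity, and
    w \<mapsto> z + w v yields holomorphy along lines.\<close>
  have unif: "uniform_limit Y (\<lambda>A y. \<Sum>n\<in>A. theta_term Z n (h y))
      (\<lambda>y. riemann_theta Z (h y)) (finite_subsets_at_top UNIV)"
    if hR: "\<And>y. y \<in> Y \<Longrightarrow> norm (h y) \<le> R" for R and h :: "'b \<Rightarrow> complex ^ 'g" and Y
  proof -
    obtain M where M: "M summable_on UNIV"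
      "\<And>n (z :: complex ^ 'g). (\<And>i. \<bar>Im (z $ i)\<bar> \<le> R) \<Longrightarrow>
        norm (theta_term Z n z) \<le> M n"
      using theta_term_bound[OF Z] by blast
    have R: "\<bar>Im (h y $ i)\<bar> \<le> R" if "y \<in> Y" for i y
      using abs_Im_le_cmod[of "h y $ i"] Finite_Cartesian_Product.norm_nth_le[of "h y" i] hR[OF that] by linarith
    show ?thesis
      unfolding riemann_theta_def by (rule Weierstrass_m_test_general[OF _ M(1)]) (use M(2) R in auto)
  qed
  have cont_term: "continuous_on A (\<lambda>z. \<Sum>n\<in>B. theta_term Z n z)"
    for A B by (intro continuous_intros) auto
  have "isCont (riemann_theta Z) z" for z
  proof -
    have "continuous_on (ball 0 (norm z + 1)) (riemann_theta Z)"
      by (rule uniform_limit_theorem[OF _ unif[of _ "\<lambda>z. z" "norm z + 1"]])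
        (auto intro!: always_eventually cont_term)
    then show ?thesis by (rule continuous_on_interior) simp
  qed
  then have "continuous_on UNIV (riemann_theta Z)" by (simp add: continuous_at_imp_continuous_on)
  moreover have "(\<lambda>w. riemann_theta Z (z + w *s v)) holomorphic_on UNIV" for z v
  proof -
    have "(\<lambda>w. riemann_theta Z (z + w *s v)) holomorphic_on ball 0 r" for r
    proof (rule holomorphic_uniform_limit)
      have *: "(\<lambda>w. \<Sum>n\<in>B. theta_term Z n (z + w *s v)) holomorphic_on A" for A B
        unfolding cdot_add_right cdot_scale_right by (intro holomorphic_intros)
      show "\<forall>\<^sub>F B in finite_subsets_at_top UNIV.
        continuous_on (cball 0 r) (\<lambda>w. \<Sum>n\<in>B. theta_term Z n (z + w *s v)) \<and>
        (\<lambda>w. \<Sum>n\<in>B. theta_term Z n (z + w *s v)) holomorphic_on ball 0 r"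
        using * holomorphic_on_imp_continuous_on by (intro always_eventually) blast
      show "uniform_limit (cball 0 r)
         (\<lambda>B w. \<Sum>n\<in>B. theta_term Z n (z + w *s v))
         (\<lambda>w. riemann_theta Z (z + w *s v)) (finite_subsets_at_top UNIV)"
      proof (rule unif)
        fix w :: complex
        assume "w \<in> cball 0 r"
        then show "norm (z + w *s v) \<le> norm z + r * norm v"
          by (intro norm_triangle_mono) (simp_all add: norm_smult mult_right_mono)
      qed
    qed auto
    then have "(\<lambda>w. riemann_theta Z (z + w *s v)) field_differentiable at w" for w
      by (rule holomorphic_on_imp_differentiable_at[of _ "ball 0 (norm w + 1)"]) auto
    then show ?thesis
      by (simp add: holomorphic_on_def field_differentiable_at_within)
  qed
  ultimately show ?thesis by (simp add: entire_on_lines_def)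
qed

text \<open>If n has a nonzero entry j, translation by 1 / (2 * n $ j) in direction j multiplies the
  character by e(1/2) = -1, yet leaves its average unchanged; so the average is 0.\<close>

lemma avg_character:
  fixes n :: "complex ^ 'g::finite"
  assumes n: "n \<in> Zvec" and js: "set js = UNIV"
  shows "avg js (\<lambda>z. e2pi (n \<star> z)) 0 = (if n = 0 then 1 else 0)"
proof (cases "n = 0")
  case True
  have "avg js (\<lambda>_. 1) z = 1" for z :: "complex ^ 'g"
    by (induction js arbitrary: z) (simp_all add: cavg_def)
  with True show ?thesis by simp
next
  case False
  then obtain j where j: "n $ j \<noteq> 0" by (auto simp: vec_eq_iff)
  define F where "F z = e2pi (n \<star> z)" for z
  have "avg js F (0 + axis j (1 / (2 * n $ j))) = avg js F 0"
  proof (rule avg_const_dir)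
    show "continuous_on UNIV F" unfolding F_def by (intro continuous_intros)
    show "(\<lambda>w. F (z + axis j w)) holomorphic_on UNIV" for z j
      unfolding F_def cdot_add_right cdot_axis by (intro holomorphic_intros)
    show "F (z + axis j 1) = F z" for z j
      using cdot_Ints[OF n Zvec_axis[of j]] by (simp add: F_def cdot_add_right e2pi_add e2pi_Ints)
  qed (simp add: js)
  moreover have "avg js F (0 + axis j (1 / (2 * n $ j))) = avg js (\<lambda>z. F (z + axis j (1 / (2 * n $ j)))) 0"
    by (rule avg_translate[symmetric])
  moreover have "(\<lambda>z. F (z + axis j (1 / (2 * n $ j)))) = (\<lambda>z. e2pi (1 / 2) * F z)"
    using j by (simp add: F_def cdot_add_right cdot_axis e2pi_add mult.commute)
  moreover have "e2pi (1 / 2) = -1" by (simp add: e2pi_def)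
  ultimately have "avg js F 0 = - avg js F 0"
    using avg_cmult[of js "e2pi (1 / 2)" F 0] by (metis mult_minus1)
  then show ?thesis using False by (simp add: F_def[abs_def])
qed

text \<open>Only the term n = 0 has a nonzero average. Sum and average are interchanged by
  approximating theta uniformly on real vectors by a finite partial sum that contains this
  term.\<close>

lemma avg_riemann_theta:
  fixes Z :: "complex ^ 'g ^ 'g::finite"
  assumes Z: "Z \<in> siegel" and js: "set js = UNIV"
  shows "avg js (riemann_theta Z) 0 = 1"
proof -
  have "norm (avg js (riemann_theta Z) 0 - 1) \<le> \<epsilon>" if "\<epsilon> > 0" for \<epsilon>
  proof -
    let ?t = "\<lambda>n z. theta_term Z n z"
    obtain M where M: "M summable_on UNIV"
      "\<And>n (z :: complex ^ 'g). (\<And>i. \<bar>Im (z $ i)\<bar> \<le> 0) \<Longrightarrow> norm (?t n z) \<le> M n"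
      using theta_term_bound[OF Z] by blast
    have "uniform_limit {z. real_vec z} (\<lambda>A z. \<Sum>n\<in>A. ?t n z) (riemann_theta Z) (finite_subsets_at_top UNIV)"
      unfolding riemann_theta_def
      by (rule Weierstrass_m_test_general[OF _ M(1)])
        (use M(2) in \<open>auto simp: real_vec_def complex_is_Real_iff\<close>)
    then have "\<forall>\<^sub>F A in finite_subsets_at_top UNIV. \<forall>z\<in>{z. real_vec z}. dist (\<Sum>n\<in>A. ?t n z) (riemann_theta Z z) < \<epsilon>"
      using that by (auto simp: uniform_limit_iff)
    moreover have "\<forall>\<^sub>F A in finite_subsets_at_top UNIV. finite A \<and> (0 :: int ^ 'g) \<in> A"
      by (auto simp: eventually_finite_subsets_at_top intro!: exI[of _ "{0}"])
    ultimately have "\<forall>\<^sub>F A in finite_subsets_at_top UNIV. finite A \<and> 0 \<in> A \<and>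
        (\<forall>z\<in>{z. real_vec z}. dist (\<Sum>n\<in>A. ?t n z) (riemann_theta Z z) < \<epsilon>)"
      by eventually_elim auto
    from eventually_happens'[OF finite_subsets_at_top_neq_bot this]
    obtain A where A: "finite A" "0 \<in> A"
        "\<forall>z\<in>{z. real_vec z}. dist (\<Sum>n\<in>A. ?t n z) (riemann_theta Z z) < \<epsilon>"
      by (elim exE conjE)
    define P where "P z = (\<Sum>n\<in>A. ?t n z)" for z
    have ct: "continuous_on UNIV (?t n)" for n by (intro continuous_intros)
    have cP: "continuous_on UNIV P" unfolding P_def by (intro continuous_intros)
    have cR: "continuous_on UNIV (riemann_theta Z)"
      using entire_on_lines_riemann_theta[OF Z] by (simp add: entire_on_lines_def)
    have cD: "continuous_on UNIV (\<lambda>z. riemann_theta Z z - P z)" by (intro continuous_intros cP cR)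
    have "avg js P 0 = (\<Sum>n\<in>A. avg js (?t n) 0)"
      unfolding P_def by (rule avg_sum[OF A(1) ct])
    also have "\<dots> = (\<Sum>n\<in>A. if n = 0 then 1 else 0)"
    proof (rule sum.cong)
      fix n :: "int ^ 'g"
      have "of_ivec n = 0 \<longleftrightarrow> n = 0" by (simp add: vec_eq_iff)
      then show "avg js (?t n) 0 = (if n = 0 then 1 else 0)"
        using avg_character[OF of_ivec_Zvec js, of n] by (simp add: e2pi_add avg_cmult)
    qed simp
    also have "\<dots> = 1" using A by simp
    finally have 1: "avg js P 0 = 1" .
    have "avg js (\<lambda>z. P z + (riemann_theta Z z - P z)) 0 = avg js P 0 + avg js (\<lambda>z. riemann_theta Z z - P z) 0"
      by (rule avg_add[OF cP cD])
    then have 2: "avg js (riemann_theta Z) 0 = 1 + avg js (\<lambda>z. riemann_theta Z z - P z) 0"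
      by (simp add: 1)
    have "norm (avg js (\<lambda>z. riemann_theta Z z - P z) 0) \<le> \<epsilon>"
    proof (rule norm_avg_le[OF cD])
      show "norm (riemann_theta Z z - P z) \<le> \<epsilon>" if "real_vec z" for z
        using A(3) that by (auto simp: P_def dist_norm norm_minus_commute less_imp_le)
    qed (simp add: real_vec_def)
    with 2 show ?thesis by simp
  qed
  then have "norm (avg js (riemann_theta Z) 0 - 1) \<le> 0" by (rule field_le_epsilon[of _ 0, simplified])
  then show ?thesis by simp
qed

lemma quasi_periodic_riemann_theta:
  fixes Z :: "complex ^ 'g ^ 'g::finite"
  assumes Z: "transpose Z = Z"
  shows "quasi_periodic Z (riemann_theta Z)"
  unfolding quasi_periodic_def
proof (intro ballI allI conjI)
  fix k z :: "complex ^ 'g"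
  assume "k \<in> Zvec"
  then obtain m where k: "k = of_ivec m" by (rule Zvec_cases)
  show "riemann_theta Z (z + k) = riemann_theta Z z"
    unfolding riemann_theta_def
    by (intro infsum_cong) (simp add: cdot_add_right e2pi_add k cdot_Ints e2pi_Ints)
  let ?t = "\<lambda>n z. theta_term Z n z"
  have "?t n (z + Z *v k) = e2pi (- (k \<star> (Z *v k)) / 2 - k \<star> z) * ?t (n + m) z" for n
  proof -
    have "of_ivec n \<star> (Z *v of_ivec n) / 2 + of_ivec n \<star> (z + Z *v k) =
       (- (k \<star> (Z *v k)) / 2 - k \<star> z) +
       (of_ivec (n + m) \<star> (Z *v of_ivec (n + m)) / 2 + of_ivec (n + m) \<star> z)"
    proof -
      have "of_ivec (n + m) \<star> (Z *v of_ivec (n + m)) =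
          of_ivec n \<star> (Z *v of_ivec n) + 2 * (of_ivec n \<star> (Z *v k)) + k \<star> (Z *v k)"
        using cdot_symmetric_matrix[OF Z, of "of_ivec n" k]
        by (simp add: of_ivec_add cdot_linear matrix_vector_right_distrib k[symmetric])
      then show ?thesis by (simp add: of_ivec_add k[symmetric] cdot_linear add_divide_distrib)
    qed
    then show ?thesis by (simp only: e2pi_add)
  qed
  then have "riemann_theta Z (z + Z *v k) =
      e2pi (- (k \<star> (Z *v k)) / 2 - k \<star> z) * (\<Sum>\<^sub>\<infinity>n. ?t (n + m) z)"
    unfolding riemann_theta_def by (simp add: infsum_cmult_right')
  also have "(\<Sum>\<^sub>\<infinity>n. ?t (n + m) z) = riemann_theta Z z"
    unfolding riemann_theta_def
    by (rule infsum_reindex_bij_betw[where g="\<lambda>n. n + m" and f="\<lambda>n. ?t n z"])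
      (rule bij_betw_byWitness[where f'="\<lambda>n. n - m"], auto)
  finally show "riemann_theta Z (z + Z *v k) = e2pi (- (k \<star> (Z *v k)) / 2 - k \<star> z) * riemann_theta Z z" .
qed

lemma riemann_theta_minus: "riemann_theta Z (- z) = riemann_theta Z z"
proof -
  let ?t = "\<lambda>n z. theta_term Z n z"
  have neg: "Z *v (- x) = - (Z *v x)" for x
    by (simp add: vec_eq_iff matrix_vector_mult_def sum_negf)
  have "riemann_theta Z (- z) = (\<Sum>\<^sub>\<infinity>n. ?t (- n) z)"
    unfolding riemann_theta_def by (simp add: of_ivec_minus cdot_linear neg)
  also have "\<dots> = riemann_theta Z z"
    unfolding riemann_theta_def
    by (rule infsum_reindex_bij_betw[where g=uminus and f="\<lambda>n. ?t n z"])
      (rule bij_betw_byWitness[where f'=uminus], auto)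
  finally show ?thesis .
qed

theorem quasi_periodic_unique:
  fixes Z :: "complex ^ 'g ^ 'g::finite"
  assumes Z: "Z \<in> siegel" and f: "entire_on_lines f" "quasi_periodic Z f"
  obtains \<kappa> where "\<And>z. f z = \<kappa> * riemann_theta Z z"
proof -
  obtain js :: "'g list" where js: "distinct js" "set js = UNIV"
    using finite_distinct_list[OF finite[of UNIV]] by blast
  \<comment> \<open>Forced by the value 1 of the average of theta: the difference h then has average
    0 and vanishes by \<open>quasi_periodic_eq_0\<close>.\<close>
  define \<kappa> where "\<kappa> = avg js f 0"
  define h where "h z = f z + (- \<kappa>) * riemann_theta Z z" for z
  have t: "entire_on_lines (riemann_theta Z)" "quasi_periodic Z (riemann_theta Z)"
    using Z entire_on_lines_riemann_theta quasi_periodic_riemann_theta by (auto simp: siegel_def)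
  have "h z = 0" for z
  proof (rule quasi_periodic_eq_0[OF _ _ js])
    show "entire_on_lines h" using f(1) t(1) unfolding h_def entire_on_lines_def
      by (auto intro!: continuous_intros holomorphic_intros)
    show "quasi_periodic Z h" using f(2) t(2) unfolding h_def quasi_periodic_def
      by (simp add: algebra_simps)
    have "avg js h 0 = avg js f 0 + avg js (\<lambda>z. (- \<kappa>) * riemann_theta Z z) 0"
      using f(1) t(1) unfolding h_def
      by (intro avg_add) (auto simp: entire_on_lines_def intro!: continuous_intros)
    then show "avg js h 0 = 0"
      unfolding avg_cmult avg_riemann_theta[OF Z js(2)] by (simp add: \<kappa>_def)
  qed
  then have "f z = \<kappa> * riemann_theta Z z" for z by (simp add: h_def)
  then show ?thesis by (rule that)
qed

lemma riemann_theta_nonzero: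
  assumes Z: "Z \<in> siegel"
  obtains z where "riemann_theta Z z \<noteq> 0"
proof -
  obtain js :: "'a list" where js: "set js = UNIV"
    using finite_list[OF finite[of UNIV]] by blast
  have "riemann_theta Z \<noteq> (\<lambda>_. 0)"
    using avg_riemann_theta[OF Z js] by (auto simp: avg_zero)
  then show ?thesis using that by blast
qed


section \<open>Transformation of theta functions\<close>

declare transpose_matrix_vector [simp del]

lemma matrix_inv_right: "invertible A \<Longrightarrow> A ** matrix_inv A = mat 1"
  and matrix_inv_left: "invertible A \<Longrightarrow> matrix_inv A ** A = mat 1"
  unfolding invertible_def matrix_inv_def by (metis (mono_tags, lifting) someI_ex)+

text \<open>Allowing complex \<open>r\<close> and \<open>s\<close> means that functions of \<open>z = Z r + s\<close> can be read off at
  \<open>r = 0\<close>, without solving for real \<open>r\<close>, \<open>s\<close>.\<close>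

definition theta_phi :: "complex ^ 'g ^ 'g::finite \<Rightarrow> complex ^ 'g \<Rightarrow> complex ^ 'g \<Rightarrow> complex"
  where "theta_phi Z r s = e2pi (r \<star> (Z *v r + s) / 2) * riemann_theta Z (Z *v r + s)"

lemma matrix_vector_mult_minus: "A *v (- x) = - (A *v (x :: 'a::ring_1 ^ 'n))"
  by (simp add: vec_eq_iff matrix_vector_mult_def sum_negf)

lemma theta_phi_minus: "theta_phi Z (- r) (- s) = theta_phi Z r s"
proof -
  have "Z *v (- r) + - s = - (Z *v r + s)" by (simp add: matrix_vector_mult_minus)
  then show ?thesis by (simp only: theta_phi_def riemann_theta_minus cdot_minus_left cdot_minus_right minus_minus)
qed

text \<open>The purpose of the normalisation: apart from m \<star> n / 2 the exponent is half the
  symplectic form of (r, s) and (m, n), and Z no longer occurs in it.\<close>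

lemma theta_phi_quasi_periodic:
  assumes Z: "transpose Z = Z" and mn: "m \<in> Zvec" "n \<in> Zvec"
  shows "theta_phi Z (r + m) (s + n) =
    e2pi (m \<star> n / 2 + (r \<star> n - m \<star> s) / 2) * theta_phi Z r s"
proof -
  define z where "z = Z *v r + s"
  have z: "Z *v (r + m) + (s + n) = z + n + Z *v m"
    by (simp add: z_def matrix_vector_right_distrib)
  have "riemann_theta Z (z + n + Z *v m) =
      e2pi (- (m \<star> (Z *v m)) / 2 - m \<star> (z + n)) * riemann_theta Z z"
    using quasi_periodic_riemann_theta[OF Z] mn by (simp add: quasi_periodic_def)
  then have "theta_phi Z (r + m) (s + n) =
      e2pi ((r + m) \<star> (z + n + Z *v m) / 2 + (- (m \<star> (Z *v m)) / 2 - m \<star> (z + n))) * riemann_theta Z z"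
    unfolding theta_phi_def z by (simp only: e2pi_add mult.assoc)
  \<comment> \<open>The expansion produces - m \<star> n / 2; as m \<star> n is an integer, its sign
    may be switched at the cost of the last summand, which e kills.\<close>
  also have "(r + m) \<star> (z + n + Z *v m) / 2 + (- (m \<star> (Z *v m)) / 2 - m \<star> (z + n)) =
      m \<star> n / 2 + (r \<star> n - m \<star> s) / 2 + r \<star> z / 2 + - (m \<star> n)"
    using cdot_symmetric_matrix[OF Z, of r m]
    by (simp add: z_def cdot_linear field_simps)
  also have "e2pi \<dots> = e2pi (m \<star> n / 2 + (r \<star> n - m \<star> s) / 2) * e2pi (r \<star> z / 2)"
    by (simp only: e2pi_add e2pi_Ints[OF Ints_minus[OF cdot_Ints[OF mn]]] mult_1_right)
  finally show ?thesis by (simp add: theta_phi_def z_def)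
qed

section \<open>From bilinear relations to points of the Siegel half-space\<close>

definition cnj_vec :: "complex ^ 'n \<Rightarrow> complex ^ 'n"
  where "cnj_vec x = (\<chi> i. cnj (x $ i))"

definition cnj_mat :: "complex ^ 'n ^ 'm \<Rightarrow> complex ^ 'n ^ 'm"
  where "cnj_mat A = (\<chi> i j. cnj (A $ i $ j))"

lemma cnj_mat_mult_vec: "cnj_vec (A *v x) = cnj_mat A *v cnj_vec x"
  by (simp add: cnj_vec_def cnj_mat_def matrix_vector_mult_def vec_eq_iff)

lemma transpose_cnj_mat: "transpose (cnj_mat A) = cnj_mat (transpose A)"
  by (simp add: cnj_mat_def transpose_def)

lemma cnj_cdot: "cnj (x \<star> y) = cnj_vec x \<star> cnj_vec y"
  by (simp add: cdot_def cnj_vec_def)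

lemma cnj_mat_integral:
  fixes M :: "complex ^ 'n ^ 'm"
  assumes "\<And>i j. M $ i $ j \<in> \<int>"
  shows "cnj_mat M = M"
proof -
  have "cnj (M $ i $ j) = M $ i $ j" for i j
    using assms[of i j] by (elim Ints_cases) simp
  then show ?thesis by (simp add: cnj_mat_def vec_eq_iff)
qed

lemma transpose_add: "transpose (U + Y) = transpose U + transpose (Y :: 'a::semigroup_add ^ 'n ^ 'm)"
  by (simp add: transpose_def vec_eq_iff)

lemma cnj_mat_add: "cnj_mat (U + Y) = cnj_mat U + cnj_mat Y"
  and cnj_mat_mult: "cnj_mat (U ** Y) = cnj_mat U ** cnj_mat Y"
  by (simp_all add: cnj_mat_def vec_eq_iff matrix_matrix_mult_def)

definition positive_definite :: "complex ^ 'n ^ 'n::finite \<Rightarrow> bool"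
  where "positive_definite H \<longleftrightarrow> (\<forall>x. x \<noteq> 0 \<longrightarrow> Re (x \<star> (H *v cnj_vec x)) > 0)"

text \<open>The hypotheses are Riemann's relations for the period matrix (p, q). A vector killed by
  q^T would make the positive hermitian form vanish, so q is invertible; cancelling q on both sides
  gives symmetry. Applied both to the action on \<open>siegel\<close> and to CM-points.\<close>

lemma siegel_quotient:
  fixes p q H :: "complex ^ 'g ^ 'g::finite"
  assumes sym: "p ** transpose q = q ** transpose p"
    and herm: "\<And>x. p *v (cnj_mat (transpose q) *v x) - q *v (cnj_mat (transpose p) *v x) = 2 * \<i> *s (H *v x)"
    and H: "positive_definite H"
  shows "invertible q" "matrix_inv q ** p \<in> siegel"
proof -
  have eq: "(transpose p *v x) \<star> cnj_vec (transpose q *v x) - (transpose q *v x) \<star> cnj_vec (transpose p *v x)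
      = 2 * \<i> * (x \<star> (H *v cnj_vec x))" for x
  proof -
    have "2 * \<i> * (x \<star> (H *v cnj_vec x)) = x \<star> (2 * \<i> *s (H *v cnj_vec x))"
      by (simp add: cdot_scale_right)
    also have "\<dots> = x \<star> (p *v (cnj_mat (transpose q) *v cnj_vec x)) - x \<star> (q *v (cnj_mat (transpose p) *v cnj_vec x))"
      by (simp flip: herm add: cdot_diff_right)
    finally show ?thesis by (simp only: cdot_matrix[of x] cnj_mat_mult_vec)
  qed
  have "x = 0" if "transpose q *v x = 0" for x
  proof (rule ccontr)
    assume "x \<noteq> 0"
    then have "Re (x \<star> (H *v cnj_vec x)) > 0" using H by (simp add: positive_definite_def)
    moreover have "x \<star> (H *v cnj_vec x) = 0"
      using eq[of x] that by (simp add: cnj_vec_def zero_vec_def[symmetric])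
    ultimately show False by simp
  qed
  then have "invertible (transpose q)"
    using matrix_left_invertible_ker[of "transpose q"] invertible_left_inverse by blast
  then show q: "invertible q"
    unfolding invertible_def by (metis matrix_transpose_mul transpose_mat transpose_transpose)
  define W where "W = matrix_inv q ** p"
  have qi: "q ** matrix_inv q = mat 1" "matrix_inv q ** q = mat 1"
    using q by (auto simp: matrix_inv_left matrix_inv_right)
  have qW: "q ** W = p" by (simp add: W_def matrix_mul_assoc qi)
  have "q ** W ** transpose q = q ** transpose W ** transpose q"
    using sym by (simp add: matrix_transpose_mul matrix_mul_assoc flip: qW)
  moreover have "transpose q ** transpose (matrix_inv q) = mat 1"
    by (simp flip: matrix_transpose_mul add: qi)
  moreover have qi': "matrix_inv q ** (q ** U) = U" for U
    by (simp add: matrix_mul_assoc qi)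
  ultimately have cancel: "matrix_inv q ** (q ** U ** transpose q) ** transpose (matrix_inv q) = U" for U
    by (simp add: matrix_mul_assoc[symmetric] qi')
  have W: "W = transpose W"
    using cancel[of W] cancel[of "transpose W"] \<open>q ** W ** transpose q = q ** transpose W ** transpose q\<close>
    by metis
  have "x \<bullet> ((\<chi> i j. Im (W $ i $ j)) *v x) > 0" if "x \<noteq> 0" for x :: "real ^ 'g"
  proof -
    define c where "c = (\<chi> i. complex_of_real (x $ i))"
    \<comment> \<open>Solves q^T w = c; evaluated at w, the hermitian form becomes the imaginary
      part of the quadratic form of W at the real vector c.\<close>
    define w where "w = transpose (matrix_inv q) *v c"
    have c: "transpose q *v w = c"
      using \<open>transpose q ** transpose (matrix_inv q) = mat 1\<close>
      by (simp add: w_def matrix_vector_mul_assoc)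
    have "c \<noteq> 0" using that by (auto simp: c_def vec_eq_iff)
    then have "w \<noteq> 0" using c by auto
    then have pos: "Re (w \<star> (H *v cnj_vec w)) > 0" using H by (simp add: positive_definite_def)
    have pw: "transpose p *v w = W *v c"
      using W by (simp add: matrix_transpose_mul flip: qW c matrix_vector_mul_assoc)
    have cc: "cnj_vec c = c" by (simp add: c_def cnj_vec_def)
    have "(W *v c) \<star> c - c \<star> cnj_vec (W *v c) = 2 * \<i> * (w \<star> (H *v cnj_vec w))"
      using eq[of w] by (simp add: c pw cc)
    moreover have "c \<star> cnj_vec (W *v c) = cnj (c \<star> (W *v c))" by (simp add: cnj_cdot cc)
    ultimately have "c \<star> (W *v c) - cnj (c \<star> (W *v c)) = 2 * \<i> * (w \<star> (H *v cnj_vec w))"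
      by (simp add: cdot_commute)
    then have "Im (c \<star> (W *v c)) = Re (w \<star> (H *v cnj_vec w))"
      by (simp add: complex_eq_iff)
    moreover have "Im (c \<star> (W *v c)) = x \<bullet> ((\<chi> i j. Im (W $ i $ j)) *v x)"
      by (simp add: cdot_def matrix_vector_mult_def inner_vec_def c_def)
    ultimately show ?thesis using pos by simp
  qed
  then show "matrix_inv q ** p \<in> siegel"
    using W by (simp add: siegel_def W_def)
qed

section \<open>Parity of integral quadratic forms\<close>

lemma halve_identity:
  fixes x t a a' b c :: complex
  assumes "a' = a"
  shows "((x * (t * x) + (a + a') + b) - (x * t + c)) / 2 = t * ((x\<^sup>2 - x) / 2) + a + (b - c) / 2"
  unfolding assms
  by (simp add: power2_eq_square add_divide_distrib diff_divide_distrib ring_distribs mult_ac)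

lemma sum_insert_insert:
  fixes h :: "'b \<Rightarrow> 'b \<Rightarrow> complex"
  assumes "finite F" "k \<notin> F"
  shows "(\<Sum>i\<in>insert k F. \<Sum>j\<in>insert k F. h i j) =
    h k k + ((\<Sum>j\<in>F. h k j) + (\<Sum>i\<in>F. h i k)) + (\<Sum>i\<in>F. \<Sum>j\<in>F. h i j)"
  using assms by (simp add: sum.distrib)

text \<open>Off-diagonal terms occur twice by symmetry, and \<open>x^2\<close> - x is even for every
  integer x; so modulo 2 the quadratic form is linear, with the diagonal of S as
  coefficients.\<close>

lemma quadratic_parity:
  fixes S :: "complex ^ 'g ^ 'g::finite"
  assumes S: "\<And>i j. S $ i $ j \<in> \<int>" "transpose S = S" and m: "m \<in> Zvec"
  shows "(m \<star> (S *v m) - m \<star> (\<chi> i. S $ i $ i)) / 2 \<in> \<int>"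
proof -
  have mi: "m $ i \<in> \<int>" for i using m by (simp add: Zvec_def)
  have sym: "S $ i $ j = S $ j $ i" for i j
    using arg_cong[OF S(2), of "\<lambda>S. S $ i $ j"] by (simp add: transpose_def)
  have "((\<Sum>i\<in>F. \<Sum>j\<in>F. m $ i * (S $ i $ j * m $ j)) - (\<Sum>i\<in>F. m $ i * S $ i $ i)) / 2 \<in> \<int>"
    if "finite F" for F
    using that
  proof (induction F rule: finite_induct)
    case (insert k F)
    have "((m $ k)\<^sup>2 - m $ k) / 2 \<in> \<int>"
    proof -
      obtain a where a: "m $ k = of_int a" using mi[of k] by (elim Ints_cases)
      have "even (a\<^sup>2 - a)" by simp
      then obtain c where "a\<^sup>2 - a = 2 * c" by (elim evenE)
      then have "(of_int (a\<^sup>2 - a) :: complex) = 2 * of_int c" by simp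
      then have "((m $ k)\<^sup>2 - m $ k) / 2 = of_int c" by (simp add: a)
      then show ?thesis by simp
    qed
    then have k: "S $ k $ k * (((m $ k)\<^sup>2 - m $ k) / 2) \<in> \<int>" using S(1) by (intro Ints_mult) auto
    have off: "(\<Sum>j\<in>F. m $ k * (S $ k $ j * m $ j)) \<in> \<int>"
      using S(1) mi by (intro Ints_sum Ints_mult) auto
    have off': "(\<Sum>i\<in>F. m $ i * (S $ i $ k * m $ k)) = (\<Sum>j\<in>F. m $ k * (S $ k $ j * m $ j))"
      using sym by (intro sum.cong) (auto simp: mult_ac)
    have A: "(\<Sum>i\<in>insert k F. \<Sum>j\<in>insert k F. m $ i * (S $ i $ j * m $ j)) =
        m $ k * (S $ k $ k * m $ k) +
        ((\<Sum>j\<in>F. m $ k * (S $ k $ j * m $ j)) + (\<Sum>i\<in>F. m $ i * (S $ i $ k * m $ k))) +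
        (\<Sum>i\<in>F. \<Sum>j\<in>F. m $ i * (S $ i $ j * m $ j))"
      by (rule sum_insert_insert[OF insert.hyps])
    have B: "(\<Sum>i\<in>insert k F. m $ i * S $ i $ i) = m $ k * S $ k $ k + (\<Sum>i\<in>F. m $ i * S $ i $ i)"
      by (rule sum.insert[OF insert.hyps])
    have "S $ k $ k * (((m $ k)\<^sup>2 - m $ k) / 2) + (\<Sum>j\<in>F. m $ k * (S $ k $ j * m $ j)) +
        ((\<Sum>i\<in>F. \<Sum>j\<in>F. m $ i * (S $ i $ j * m $ j)) - (\<Sum>i\<in>F. m $ i * S $ i $ i)) / 2 \<in> \<int>"
      by (rule Ints_add[OF Ints_add[OF k off] insert.IH])
    then show ?case
      unfolding A B halve_identity[OF off'] .
  qed simp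
  moreover have "m \<star> (S *v m) = (\<Sum>i\<in>UNIV. \<Sum>j\<in>UNIV. m $ i * (S $ i $ j * m $ j))"
    by (simp add: cdot_def matrix_vector_mult_def sum_distrib_left)
  moreover have "m \<star> (\<chi> i. S $ i $ i) = (\<Sum>i\<in>UNIV. m $ i * S $ i $ i)"
    by (simp add: cdot_def)
  ultimately show ?thesis by (simp only: finite)
qed

text \<open>The three relations are the blocks of M^T J M = J for M = (A B; C D). The integral
  matrices are given complex entries so that they act directly on complex vectors.\<close>

locale symplectic_blocks =
  fixes A B C D :: "complex ^ 'g ^ 'g::finite"
  assumes integral: "\<And>i j. A $ i $ j \<in> \<int>" "\<And>i j. B $ i $ j \<in> \<int>" "\<And>i j. C $ i $ j \<in> \<int>" "\<And>i j. D $ i $ j \<in> \<int>"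
    and AC: "transpose A ** C = transpose C ** A"
    and BD: "transpose B ** D = transpose D ** B"
    and AD: "transpose A ** D = mat 1 + transpose C ** B"
begin

lemma DA: "transpose D ** A = mat 1 + transpose B ** C"
proof -
  have "transpose (transpose A ** D) = transpose (mat 1 + transpose C ** B)" by (simp only: AD)
  then show ?thesis by (simp add: transpose_add matrix_transpose_mul)
qed

lemma block_relations:
  "transpose A *v (C *v x) = transpose C *v (A *v x)"
  "transpose B *v (D *v x) = transpose D *v (B *v x)"
  "transpose A *v (D *v x) = x + transpose C *v (B *v x)"
  "transpose D *v (A *v x) = x + transpose B *v (C *v x)"
  using AC BD AD DA
  by (simp_all add: matrix_vector_mul_assoc matrix_vector_mult_add_rdistrib)

definition autf :: "complex ^ 'g ^ 'g \<Rightarrow> complex ^ 'g ^ 'g"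
  where "autf Z = Z ** transpose C + transpose D"

definition act_num :: "complex ^ 'g ^ 'g \<Rightarrow> complex ^ 'g ^ 'g"
  where "act_num Z = Z ** transpose A + transpose B"

text \<open>For symmetric Z this is the transpose of (A Z + B)(C Z + D)^-1, and it equals that
  matrix once the value is known to be symmetric. The form with the inverse on the left matches
  \<open>CM_point\<close>.\<close>

definition act :: "complex ^ 'g ^ 'g \<Rightarrow> complex ^ 'g ^ 'g"
  where "act Z = matrix_inv (autf Z) ** act_num Z"

text \<open>Together with \<open>tr_lo\<close> this is M^-T applied to (r, s); the inverse of a
  symplectic matrix is explicit, which gives M^-T the blocks D, -C; -B, A.\<close>

definition tr_up :: "complex ^ 'g \<Rightarrow> complex ^ 'g \<Rightarrow> complex ^ 'g"
  where "tr_up r s = D *v r - C *v s"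

definition tr_lo :: "complex ^ 'g \<Rightarrow> complex ^ 'g \<Rightarrow> complex ^ 'g"
  where "tr_lo r s = A *v s - B *v r"

lemmas mv_simps = matrix_vector_mul_assoc[symmetric] matrix_vector_right_distrib
  matrix_vector_mult_add_rdistrib matrix_vector_mult_diff_distrib matrix_vector_mult_minus

text \<open>An instance of \<open>siegel_quotient\<close> with H = Im Z: by the block relations the
  hermitian combination of numerator and denominator collapses to Z minus its conjugate.\<close>

lemma siegel_act:
  assumes Z: "Z \<in> siegel"
  shows "invertible (autf Z)" "act Z \<in> siegel"
proof -
  have sym: "transpose Z = Z" using Z by (simp add: siegel_def)
  have c: "cnj_mat A = A" "cnj_mat B = B" "cnj_mat C = C" "cnj_mat D = D"
    using integral by (auto intro: cnj_mat_integral)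
  have tr: "transpose (autf Z) = C ** Z + D" "transpose (act_num Z) = A ** Z + B"
    by (simp_all add: autf_def act_num_def transpose_add matrix_transpose_mul sym)
  define H where "H = (\<chi> i j. complex_of_real (Im (Z $ i $ j)))"
  have H: "Z *v x - cnj_mat Z *v x = 2 * \<i> *s (H *v x)" for x
  proof -
    have "Z $ i $ j - cnj (Z $ i $ j) = 2 * \<i> * H $ i $ j" for i j
      by (simp add: H_def complex_eq_iff)
    then have "(\<Sum>j\<in>UNIV. Z $ i $ j * x $ j) - (\<Sum>j\<in>UNIV. cnj (Z $ i $ j) * x $ j) = 2 * \<i> * (\<Sum>j\<in>UNIV. H $ i $ j * x $ j)" for i
      by (simp flip: sum_subtractf left_diff_distrib add: sum_distrib_left mult.assoc)
    then show ?thesis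
      by (simp add: vec_eq_iff matrix_vector_mult_def cnj_mat_def)
  qed
  have "act_num Z ** transpose (autf Z) = autf Z ** transpose (act_num Z)"
    unfolding tr matrix_eq
    by (simp add: autf_def act_num_def mv_simps block_relations algebra_simps)
  moreover have "act_num Z *v (cnj_mat (transpose (autf Z)) *v x) -
      autf Z *v (cnj_mat (transpose (act_num Z)) *v x) = 2 * \<i> *s (H *v x)" for x
    unfolding tr cnj_mat_add cnj_mat_mult c H[symmetric]
    by (simp add: autf_def act_num_def mv_simps block_relations algebra_simps)
  moreover have "positive_definite H"
    unfolding positive_definite_def
  proof (intro allI impI)
    fix x :: "complex ^ 'g"
    assume "x \<noteq> 0"
    define a where "a = (\<chi> i. Re (x $ i))"
    define b where "b = (\<chi> i. Im (x $ i))"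
    define Y where "Y = (\<chi> i j. Im (Z $ i $ j))"
    have pos: "v \<noteq> 0 \<Longrightarrow> v \<bullet> (Y *v v) > 0" for v using Z by (simp add: siegel_def Y_def)
    then have nn: "v \<bullet> (Y *v v) \<ge> 0" for v by (cases "v = 0") (auto intro: less_imp_le)
    have "a \<noteq> 0 \<or> b \<noteq> 0" using \<open>x \<noteq> 0\<close> by (auto simp: a_def b_def vec_eq_iff complex_eq_iff)
    then have "a \<bullet> (Y *v a) + b \<bullet> (Y *v b) > 0"
      using pos nn by (metis add_nonneg_pos add_pos_nonneg)
    \<comment> \<open>For real Y the cross terms between the real part a and the imaginary part b of
      x are purely imaginary.\<close>
    also have "a \<bullet> (Y *v a) + b \<bullet> (Y *v b) = Re (x \<star> (H *v cnj_vec x))"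
      by (simp add: cdot_def inner_vec_def matrix_vector_mult_def a_def b_def Y_def H_def cnj_vec_def
          sum.distrib[symmetric] ring_distribs sum_negf)
    finally show "0 < Re (x \<star> (H *v cnj_vec x))" .
  qed
  ultimately show "invertible (autf Z)" "act Z \<in> siegel"
    unfolding act_def by (auto intro: siegel_quotient)
qed

lemma autf_mult_act:
  assumes "Z \<in> siegel"
  shows "autf Z *v (act Z *v x) = act_num Z *v x"
  using matrix_inv_right[OF siegel_act(1)[OF assms]]
  by (simp add: act_def matrix_vector_mul_assoc matrix_mul_assoc)

lemma act_vector:
  assumes "Z \<in> siegel"
  shows "autf Z *v (act Z *v tr_up r s + tr_lo r s) = Z *v r + s"
  by (simp add: matrix_vector_right_distrib autf_mult_act[OF assms] tr_up_def tr_lo_def)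
    (simp add: autf_def act_num_def mv_simps block_relations algebra_simps)

text \<open>In the exponent of the normalised theta function, the change under M depends on z = Z r
  + s only, not on r and s separately. This is why the transformed function can be compared with
  theta.\<close>

lemma tr_up_cdot:
  assumes "Z \<in> siegel" and z': "z' = act Z *v tr_up r s + tr_lo r s"
  shows "tr_up r s \<star> z' = r \<star> (Z *v r + s) - (Z *v r + s) \<star> (transpose C *v z')"
proof -
  have sym: "transpose Z = Z" using assms by (simp add: siegel_def)
  have z: "Z *v r + s = Z *v (transpose C *v z') + transpose D *v z'"
    using act_vector[OF assms(1), of r s]
    by (simp add: z' autf_def matrix_vector_mult_add_rdistrib matrix_vector_mul_assoc[symmetric])
  have "r \<star> (Z *v r + s) = (Z *v r) \<star> (transpose C *v z') + (D *v r) \<star> z'"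
    unfolding z by (simp only: cdot_add_right cdot_matrix[of r] sym transpose_transpose)
  moreover have "s \<star> (transpose C *v z') = (C *v s) \<star> z'" by (simp add: cdot_matrix)
  ultimately show ?thesis by (simp add: tr_up_def cdot_linear)
qed

lemma tr_symplectic:
  "tr_up r s \<star> tr_lo m n - tr_up m n \<star> tr_lo r s = r \<star> n - m \<star> s"
proof -
  have *: "(U *v x) \<star> (Y *v y) = x \<star> (transpose U *v (Y *v y))" for U Y :: "complex ^ 'g ^ 'g" and x y
    by (simp add: cdot_matrix)
  have 1: "(D *v x) \<star> (A *v y) = x \<star> y + (B *v x) \<star> (C *v y)" for x y
    by (simp add: * block_relations cdot_add_right)
  have 2: "(D *v x) \<star> (B *v y) = (B *v x) \<star> (D *v y)" for x y
    by (simp add: * block_relations)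
  have 3: "(C *v x) \<star> (A *v y) = (A *v x) \<star> (C *v y)" for x y
    by (simp add: * block_relations)
  show ?thesis
    unfolding tr_up_def tr_lo_def cdot_linear 1 2[of r m] 3[of s n]
    by (simp add: cdot_commute)
qed

lemma tr_add: "tr_up (r + m) (s + n) = tr_up r s + tr_up m n" "tr_lo (r + m) (s + n) = tr_lo r s + tr_lo m n"
  by (simp_all add: tr_up_def tr_lo_def matrix_vector_right_distrib)

lemma tr_minus: "tr_up (- r) (- s) = - tr_up r s" "tr_lo (- r) (- s) = - tr_lo r s"
  by (simp_all add: tr_up_def tr_lo_def matrix_vector_mult_minus)

lemma tr_diff: "tr_up (r - m) (s - n) = tr_up r s - tr_up m n" "tr_lo (r - m) (s - n) = tr_lo r s - tr_lo m n"
  using tr_add[of r "- m" s "- n"] by (simp_all add: tr_minus)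

lemma tr_Zvec:
  assumes "m \<in> Zvec" "n \<in> Zvec"
  shows "tr_up m n \<in> Zvec" "tr_lo m n \<in> Zvec"
  using assms integral
  by (auto simp: Zvec_def tr_up_def tr_lo_def matrix_vector_mult_def intro!: Ints_diff Ints_sum Ints_mult)

text \<open>The characteristic \<open>eps\<close> measures the failure of \<open>m \<star> n\<close> mod 2 to be invariant under the
  symplectic group.\<close>

definition eps_up :: "complex ^ 'g"
  where "eps_up = (\<chi> i. (transpose C ** A) $ i $ i)"

definition eps_lo :: "complex ^ 'g"
  where "eps_lo = (\<chi> i. (transpose D ** B) $ i $ i)"

lemma eps_Zvec [simp]: "eps_up \<in> Zvec" "eps_lo \<in> Zvec"
  using integral
  by (auto simp: Zvec_def eps_up_def eps_lo_def matrix_matrix_mult_def transpose_def intro!: Ints_sum Ints_mult)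

lemma integral_product:
  fixes U Y :: "complex ^ 'g ^ 'g"
  assumes "\<And>i j. U $ i $ j \<in> \<int>" "\<And>i j. Y $ i $ j \<in> \<int>"
  shows "(transpose U ** Y) $ i $ j \<in> \<int>"
  using assms by (auto simp: matrix_matrix_mult_def transpose_def intro!: Ints_sum Ints_mult)

text \<open>Expanding the product leaves, besides m \<star> n and an even term, two integral
  quadratic forms; modulo 2 these are linear by \<open>quadratic_parity\<close>, with coefficients
  \<open>eps_lo\<close> and \<open>eps_up\<close>.\<close>

lemma tr_parity:
  assumes mn: "m \<in> Zvec" "n \<in> Zvec"
  shows "e2pi (tr_up m n \<star> tr_lo m n / 2) = e2pi (m \<star> n / 2 + (m \<star> eps_lo - eps_up \<star> n) / 2)"
proof -
  have *: "(U *v x) \<star> (Y *v y) = x \<star> ((transpose U ** Y) *v y)" for U Y :: "complex ^ 'g ^ 'g" and x y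
    by (simp add: cdot_matrix matrix_vector_mul_assoc[symmetric])
  have "(D *v m) \<star> (A *v n) = m \<star> n + (B *v m) \<star> (C *v n)"
    by (simp add: * DA matrix_vector_mult_add_rdistrib cdot_add_right)
  then have 1: "tr_up m n \<star> tr_lo m n = m \<star> n + 2 * ((B *v m) \<star> (C *v n))
      - m \<star> ((transpose D ** B) *v m) - n \<star> ((transpose C ** A) *v n)"
    unfolding tr_up_def tr_lo_def cdot_linear by (simp add: *[symmetric] cdot_commute)
  have int: "(B *v m) \<star> (C *v n) \<in> \<int>" "m \<star> eps_lo \<in> \<int>"
    using mn integral by (auto simp: Zvec_def matrix_vector_mult_def intro!: cdot_Ints Ints_sum Ints_mult)
      (use eps_Zvec in \<open>auto simp: Zvec_def\<close>)
  have p1: "(m \<star> ((transpose D ** B) *v m) - m \<star> eps_lo) / 2 \<in> \<int>"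
    unfolding eps_lo_def
    by (intro quadratic_parity integral_product integral mn) (simp add: matrix_transpose_mul BD)
  have p2: "(n \<star> ((transpose C ** A) *v n) - n \<star> eps_up) / 2 \<in> \<int>"
    unfolding eps_up_def
    by (intro quadratic_parity integral_product integral mn) (simp add: matrix_transpose_mul AC)
  \<comment> \<open>The integral discrepancy between the two exponents. Its last summand changes the
    sign of m \<star> eps_lo / 2.\<close>
  let ?Q = "(B *v m) \<star> (C *v n) - (m \<star> ((transpose D ** B) *v m) - m \<star> eps_lo) / 2
       - (n \<star> ((transpose C ** A) *v n) - n \<star> eps_up) / 2 - m \<star> eps_lo"
  have "tr_up m n \<star> tr_lo m n / 2 = (m \<star> n / 2 + (m \<star> eps_lo - eps_up \<star> n) / 2) + ?Q"
  proof -
    have "(a + 2 * b - d - c) / 2 = (a / 2 + (l - u) / 2) + (b - (d - l) / 2 - (c - u) / 2 - l)"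
      for a b c d l u :: complex by (simp add: field_simps)
    then show ?thesis unfolding 1 cdot_commute[of eps_up n] .
  qed
  moreover have "?Q \<in> \<int>" using int p1 p2 by (intro Ints_diff)
  ultimately show ?thesis by (simp only: e2pi_add[of _ ?Q] e2pi_Ints mult_1_right)
qed

section \<open>The transformation law of the theta function\<close>

definition eta_up :: "complex ^ 'g"
  where "eta_up = (1 / 2) *s eps_up"

definition eta_lo :: "complex ^ 'g"
  where "eta_lo = (1 / 2) *s eps_lo"

text \<open>Translation by eta and the exponential prefactor each remove half of the linear
  character from \<open>tr_parity\<close>. Only with equal shares do the two modifications leave e(r
  \<star> z / 2) times a function of z = Z r + s.\<close>

definition tr_theta :: "complex ^ 'g ^ 'g \<Rightarrow> complex ^ 'g \<Rightarrow> complex ^ 'g \<Rightarrow> complex"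
  where "tr_theta Z r s = e2pi (- (r \<star> eta_lo - eta_up \<star> s) / 2) *
    theta_phi (act Z) (tr_up (r + eta_up) (s + eta_lo)) (tr_lo (r + eta_up) (s + eta_lo))"

lemma tr_theta_quasi_periodic:
  assumes Z: "Z \<in> siegel" and mn: "m \<in> Zvec" "n \<in> Zvec"
  shows "tr_theta Z (r + m) (s + n) =
    e2pi (m \<star> n / 2 + (r \<star> n - m \<star> s) / 2) * tr_theta Z r s"
proof -
  have sym: "transpose (act Z) = act Z" using siegel_act[OF Z] by (simp add: siegel_def)
  let ?r = "r + eta_up" and ?s = "s + eta_lo"
  have "theta_phi (act Z) (tr_up (?r + m) (?s + n)) (tr_lo (?r + m) (?s + n)) =
    e2pi (tr_up m n \<star> tr_lo m n / 2 + (tr_up ?r ?s \<star> tr_lo m n - tr_up m n \<star> tr_lo ?r ?s) / 2) *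
    theta_phi (act Z) (tr_up ?r ?s) (tr_lo ?r ?s)"
    unfolding tr_add[of ?r m ?s n] by (rule theta_phi_quasi_periodic[OF sym tr_Zvec[OF mn]])
  also have "\<dots> = e2pi (m \<star> n / 2 + (m \<star> eps_lo - eps_up \<star> n) / 2 + (?r \<star> n - m \<star> ?s) / 2) *
    theta_phi (act Z) (tr_up ?r ?s) (tr_lo ?r ?s)"
    unfolding tr_symplectic e2pi_add tr_parity[OF mn] ..
  finally have "tr_theta Z (r + m) (s + n) =
     e2pi (- ((r + m) \<star> eta_lo - eta_up \<star> (s + n)) / 2 +
       (m \<star> n / 2 + (m \<star> eps_lo - eps_up \<star> n) / 2 + (?r \<star> n - m \<star> ?s) / 2)) *
     theta_phi (act Z) (tr_up ?r ?s) (tr_lo ?r ?s)"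
    unfolding tr_theta_def by (simp add: add_ac e2pi_add)
  also have "- ((r + m) \<star> eta_lo - eta_up \<star> (s + n)) / 2 +
       (m \<star> n / 2 + (m \<star> eps_lo - eps_up \<star> n) / 2 + (?r \<star> n - m \<star> ?s) / 2) =
     (m \<star> n / 2 + (r \<star> n - m \<star> s) / 2) + (- (r \<star> eta_lo - eta_up \<star> s) / 2)"
  proof -
    have h: "m \<star> eps_lo = 2 * (m \<star> eta_lo)" "eps_up \<star> n = 2 * (eta_up \<star> n)"
      by (simp_all add: eta_up_def eta_lo_def cdot_scale_left cdot_scale_right)
    have "- (rl + ml - (us + un)) / 2 + (mn / 2 + (2 * ml - 2 * un) / 2 + (rn + un - (ms + ml)) / 2) =
        (mn / 2 + (rn - ms) / 2) + (- (rl - us) / 2)" for rl ml us un mn rn ms :: complex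
      by (simp add: add_divide_distrib diff_divide_distrib)
    then show ?thesis unfolding h cdot_linear .
  qed
  finally show ?thesis by (simp only: e2pi_add tr_theta_def mult.assoc)
qed

definition shift :: "complex ^ 'g ^ 'g \<Rightarrow> complex ^ 'g"
  where "shift Z = Z *v eta_up + eta_lo"

text \<open>\<open>tr_theta\<close> without the factor e(r \<star> z / 2), written explicitly in z:
  this form shows that it is entire on lines, while its identity with \<open>tr_theta\<close>
  supplies the quasi-periods.\<close>

definition tr_fun :: "complex ^ 'g ^ 'g \<Rightarrow> complex ^ 'g \<Rightarrow> complex"
  where "tr_fun Z z = (let z' = matrix_inv (autf Z) *v (z + shift Z) in
    e2pi ((- ((z + shift Z) \<star> (transpose C *v z')) + 2 * (eta_up \<star> z) + eta_up \<star> shift Z) / 2) *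
    riemann_theta (act Z) z')"

lemma tr_theta_eq:
  assumes Z: "Z \<in> siegel"
  shows "tr_theta Z r s = e2pi (r \<star> (Z *v r + s) / 2) * tr_fun Z (Z *v r + s)"
proof -
  have sym: "transpose Z = Z" using Z by (simp add: siegel_def)
  let ?r = "r + eta_up" and ?s = "s + eta_lo" and ?z = "Z *v r + s"
  define z' where "z' = act Z *v tr_up ?r ?s + tr_lo ?r ?s"
  have zz: "Z *v ?r + ?s = ?z + shift Z"
    by (simp add: shift_def matrix_vector_right_distrib)
  have "autf Z *v z' = ?z + shift Z" unfolding z'_def act_vector[OF Z] zz ..
  then have z': "matrix_inv (autf Z) *v (?z + shift Z) = z'"
    using matrix_inv_left[OF siegel_act(1)[OF Z]]
    by (metis matrix_vector_mul_assoc matrix_vector_mul_lid)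
  have "tr_theta Z r s = e2pi (- (r \<star> eta_lo - eta_up \<star> s) / 2 + tr_up ?r ?s \<star> z' / 2) * riemann_theta (act Z) z'"
    by (simp add: tr_theta_def theta_phi_def e2pi_add z'_def)
  also have "- (r \<star> eta_lo - eta_up \<star> s) / 2 + tr_up ?r ?s \<star> z' / 2 = r \<star> ?z / 2 +
      (- ((?z + shift Z) \<star> (transpose C *v z')) + 2 * (eta_up \<star> ?z) + eta_up \<star> shift Z) / 2"
  proof -
    \<comment> \<open>The term r \<star> eta_lo cancels against the prefactor of
      \<open>tr_theta\<close>; by symmetry of Z what remains combines to eta_up \<star> z.\<close>
    have "r \<star> shift Z = eta_up \<star> (Z *v r) + r \<star> eta_lo"
      by (simp add: shift_def cdot_linear cdot_symmetric_matrix[OF sym, of r])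
    then show ?thesis
      unfolding tr_up_cdot[OF Z z'_def] zz
      by (simp add: cdot_linear field_simps)
  qed
  finally show ?thesis by (simp add: tr_fun_def z' e2pi_add)
qed

lemma tr_fun_eq: "Z \<in> siegel \<Longrightarrow> tr_fun Z z = tr_theta Z 0 z"
  by (simp add: tr_theta_eq)

lemma quasi_periodic_tr_fun:
  assumes Z: "Z \<in> siegel"
  shows "quasi_periodic Z (tr_fun Z)"
  unfolding quasi_periodic_def
proof (intro ballI allI conjI)
  fix n z :: "complex ^ 'g"
  assume n: "n \<in> Zvec"
  have 0: "(0 :: complex ^ 'g) \<in> Zvec" by (simp add: Zvec_def)
  show "tr_fun Z (z + n) = tr_fun Z z"
    using tr_theta_quasi_periodic[OF Z 0 n, of 0 z] by (simp add: tr_fun_eq[OF Z])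
  \<comment> \<open>The translated point Z n + z has the coordinates r = n, s = z, and the law of
    \<open>tr_theta\<close> compares these with r = 0, s = z.\<close>
  have "tr_theta Z n z = e2pi (n \<star> (Z *v n + z) / 2) * tr_fun Z (Z *v n + z)"
    by (rule tr_theta_eq[OF Z])
  then have "tr_fun Z (Z *v n + z) = e2pi (- (n \<star> (Z *v n + z) / 2)) * tr_theta Z n z"
    by (simp add: e2pi_minus)
  also have "tr_theta Z n z = e2pi (- (n \<star> z) / 2) * tr_fun Z z"
    using tr_theta_quasi_periodic[OF Z n 0, of 0 z] by (simp add: tr_fun_eq[OF Z])
  also have "e2pi (- (n \<star> (Z *v n + z) / 2)) * (e2pi (- (n \<star> z) / 2) * tr_fun Z z) =
      e2pi (- (n \<star> (Z *v n + z) / 2) + - (n \<star> z) / 2) * tr_fun Z z"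
    by (simp only: e2pi_add mult.assoc)
  also have "- (n \<star> (Z *v n + z) / 2) + - (n \<star> z) / 2 = - (n \<star> (Z *v n)) / 2 - n \<star> z"
    by (simp add: cdot_linear field_simps)
  finally show "tr_fun Z (z + Z *v n) = e2pi (- (n \<star> (Z *v n)) / 2 - n \<star> z) * tr_fun Z z"
    by (simp only: add.commute)
qed

lemma entire_on_lines_tr_fun:
  assumes Z: "Z \<in> siegel"
  shows "entire_on_lines (tr_fun Z)"
proof -
  define Q where "Q = matrix_inv (autf Z)"
  have e: "entire_on_lines (riemann_theta (act Z))"
    using siegel_act[OF Z] by (intro entire_on_lines_riemann_theta)
  have mv: "continuous_on S (\<lambda>x. M *v f x)" if "continuous_on S f" for S M and f :: "complex ^ 'g \<Rightarrow> complex ^ 'g"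
    using that unfolding matrix_vector_mult_def
    by (intro continuous_on_vec_lambda continuous_intros)
  have "continuous_on UNIV (\<lambda>z. riemann_theta (act Z) (Q *v (z + shift Z)))"
    by (rule continuous_on_compose2[of UNIV "riemann_theta (act Z)"])
      (use e in \<open>auto simp: entire_on_lines_def intro!: mv continuous_intros\<close>)
  then have "continuous_on UNIV (tr_fun Z)"
    unfolding tr_fun_def Let_def Q_def[symmetric] by (intro continuous_intros mv) auto
  moreover have "(\<lambda>w. tr_fun Z (z + w *s v)) holomorphic_on UNIV" for z v
  proof -
    have ms: "M *v (w *s x) = w *s (M *v x)" for M :: "complex ^ 'g ^ 'g" and w x
      by (simp add: vector_scalar_commute)
    have sh: "z + w *s v + shift Z = (z + shift Z) + w *s v" for w by (simp add: add_ac)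
    have "(\<lambda>w. riemann_theta (act Z) (Q *v (z + shift Z) + w *s (Q *v v))) holomorphic_on UNIV"
      using e by (simp add: entire_on_lines_def)
    then show ?thesis
      unfolding tr_fun_def Let_def Q_def[symmetric] sh matrix_vector_right_distrib ms cdot_add_left cdot_add_right
        cdot_scale_left cdot_scale_right
      by (intro holomorphic_intros) auto
  qed
  ultimately show ?thesis by (simp add: entire_on_lines_def)
qed

theorem theta_phi_transform:
  assumes Z: "Z \<in> siegel"
  obtains \<kappa> where "\<kappa> \<noteq> 0" "\<And>r s. theta_phi (act Z) (tr_up (r + eta_up) (s + eta_lo)) (tr_lo (r + eta_up) (s + eta_lo)) =
    \<kappa> * e2pi ((r \<star> eta_lo - eta_up \<star> s) / 2) * theta_phi Z r s"
proof -
  obtain \<kappa> where \<kappa>: "\<And>z. tr_fun Z z = \<kappa> * riemann_theta Z z"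
    using quasi_periodic_unique[OF Z entire_on_lines_tr_fun[OF Z] quasi_periodic_tr_fun[OF Z]] by blast
  have "\<kappa> \<noteq> 0"
  proof
    assume "\<kappa> = 0"
    \<comment> \<open>Since \<open>autf Z\<close> is invertible, every argument of theta at
      \<open>act Z\<close> is reached by \<open>tr_fun\<close>, so that function is not identically
      zero.\<close>
    obtain z' where z': "riemann_theta (act Z) z' \<noteq> 0"
      using riemann_theta_nonzero[OF siegel_act(2)[OF Z]] by blast
    have "matrix_inv (autf Z) *v (autf Z *v z') = z'"
      using matrix_inv_left[OF siegel_act(1)[OF Z]] by (simp add: matrix_vector_mul_assoc)
    then have "tr_fun Z (autf Z *v z' - shift Z) \<noteq> 0"
      using z' by (simp add: tr_fun_def)
    with \<kappa> \<open>\<kappa> = 0\<close> show False by simp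
  qed
  moreover have "theta_phi (act Z) (tr_up (r + eta_up) (s + eta_lo)) (tr_lo (r + eta_up) (s + eta_lo)) =
    \<kappa> * e2pi ((r \<star> eta_lo - eta_up \<star> s) / 2) * theta_phi Z r s" for r s
  proof -
    have "tr_theta Z r s = \<kappa> * theta_phi Z r s"
      by (simp add: tr_theta_eq[OF Z] \<kappa> theta_phi_def)
    moreover have "e2pi ((r \<star> eta_lo - eta_up \<star> s) / 2) * e2pi (- (r \<star> eta_lo - eta_up \<star> s) / 2) = 1"
      by (simp only: e2pi_add[symmetric] add_divide_distrib[symmetric] add.right_inverse div_0 e2pi_0)
    moreover have "q = \<kappa> * e * t" if "p * q = \<kappa> * t" "e * p = 1" for p q e t :: complex
    proof -
      have "q = (e * p) * q" by (simp add: that(2))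
      also have "\<dots> = e * (\<kappa> * t)" by (simp only: mult.assoc that(1))
      finally show ?thesis by (simp add: mult_ac)
    qed
    ultimately show ?thesis unfolding tr_theta_def by blast
  qed
  ultimately show ?thesis by (rule that)
qed

text \<open>An arithmetic fact read off from theta. The point (0, s) and its reflection -(0, s) -
  eps become opposite after translation by eta, so evenness of \<open>theta_phi\<close> equates the
  two transformation laws; quasi-periodicity then leaves exactly this factor.\<close>

lemma eps_even:
  fixes Z :: "complex ^ 'g ^ 'g"
  assumes Z: "Z \<in> siegel"
  shows "e2pi (eps_up \<star> eps_lo / 2) = 1"
proof -
  have sym: "transpose Z = Z" using Z by (simp add: siegel_def)
  obtain \<kappa> where \<kappa>: "\<kappa> \<noteq> 0" "\<And>r s. theta_phi (act Z) (tr_up (r + eta_up) (s + eta_lo)) (tr_lo (r + eta_up) (s + eta_lo)) =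
    \<kappa> * e2pi ((r \<star> eta_lo - eta_up \<star> s) / 2) * theta_phi Z r s"
    using theta_phi_transform[OF Z] by blast
  obtain s where "riemann_theta Z s \<noteq> 0" using riemann_theta_nonzero[OF Z] by blast
  then have nz: "theta_phi Z 0 s \<noteq> 0" by (simp add: theta_phi_def)
  have h: "eps_up = eta_up + eta_up" "eps_lo = eta_lo + eta_lo"
    by (simp_all add: eta_up_def eta_lo_def vec_eq_iff)
  have m: "- (0 + eps_up) + eta_up = - (0 + eta_up)" "- (s + eps_lo) + eta_lo = - (s + eta_lo)"
    by (simp_all add: h)
  have "\<kappa> * e2pi ((- (0 + eps_up) \<star> eta_lo - eta_up \<star> - (s + eps_lo)) / 2) * theta_phi Z (0 + eps_up) (s + eps_lo)
      = \<kappa> * e2pi ((0 \<star> eta_lo - eta_up \<star> s) / 2) * theta_phi Z 0 s"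
    using \<kappa>(2)[of "- (0 + eps_up)" "- (s + eps_lo)"] \<kappa>(2)[of 0 s]
    unfolding m tr_minus theta_phi_minus by simp
  moreover have "theta_phi Z (0 + eps_up) (s + eps_lo) =
      e2pi (eps_up \<star> eps_lo / 2 + (0 \<star> eps_lo - eps_up \<star> s) / 2) * theta_phi Z 0 s"
    by (rule theta_phi_quasi_periodic[OF sym]) simp_all
  ultimately have "e2pi ((- (0 + eps_up) \<star> eta_lo - eta_up \<star> - (s + eps_lo)) / 2) *
       e2pi (eps_up \<star> eps_lo / 2 + (0 \<star> eps_lo - eps_up \<star> s) / 2) = e2pi ((0 \<star> eta_lo - eta_up \<star> s) / 2)"
    using nz \<kappa>(1) by simp
  moreover have "(- (0 + eps_up) \<star> eta_lo - eta_up \<star> - (s + eps_lo)) / 2 +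
      (eps_up \<star> eps_lo / 2 + (0 \<star> eps_lo - eps_up \<star> s) / 2) = eps_up \<star> eps_lo / 2 + (0 \<star> eta_lo - eta_up \<star> s) / 2"
    by (simp only: h cdot_linear cdot_zero) (simp add: field_simps)
  ultimately have "e2pi (eps_up \<star> eps_lo / 2) * e2pi ((0 \<star> eta_lo - eta_up \<star> s) / 2) = e2pi ((0 \<star> eta_lo - eta_up \<star> s) / 2)"
    by (simp only: e2pi_add[symmetric])
  then show ?thesis by simp
qed

end


section \<open>Characteristics\<close>

type_synonym 'g chars = "real ^ ('g + 'g)"

definition char_up :: "'g::finite chars \<Rightarrow> complex ^ 'g"
  where "char_up v = (\<chi> i. of_real (v $ Inl i))"

definition char_lo :: "'g::finite chars \<Rightarrow> complex ^ 'g"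
  where "char_lo v = (\<chi> i. of_real (v $ Inr i))"

lemma char_diff: "char_up (a - v) = char_up a - char_up v" "char_lo (a - v) = char_lo a - char_lo v"
  by (simp_all add: char_up_def char_lo_def vec_eq_iff)

lemma of_real_upper_lower: "of_real (upper_half v \<bullet> lower_half v) = char_up v \<star> char_lo v"
  by (simp add: inner_vec_def upper_half_def lower_half_def cdot_def char_up_def char_lo_def)

lemma theta_eq_theta_phi:
  assumes Z: "Z \<in> siegel"
  shows "theta v Z = e2pi (char_up v \<star> char_lo v / 2) * theta_phi Z (char_up v) (char_lo v)"
proof -
  have sym: "transpose Z = Z" using Z by (simp add: siegel_def)
  define r where "r = char_up v"
  define s where "s = char_lo v"
  let ?t = "\<lambda>n z. theta_term Z n z"
  have "theta v Z = (\<Sum>\<^sub>\<infinity>n. e2pi ((of_ivec n + r) \<star> (Z *v (of_ivec n + r)) / 2 + (of_ivec n + r) \<star> s))"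
    unfolding theta_def Let_def
  proof (rule infsum_cong)
    fix n :: "int ^ 'a"
    have "(\<chi> i. complex_of_real (of_int (n $ i) + upper_half v $ i)) = of_ivec n + r"
      by (simp add: r_def char_up_def upper_half_def vec_eq_iff)
    moreover have "complex_of_real (lower_half v $ i) = s $ i" for i
      by (simp add: s_def char_lo_def lower_half_def)
    ultimately show "e2pi (1 / 2 * (\<Sum>i\<in>UNIV. (\<chi> i. complex_of_real (of_int (n $ i) + upper_half v $ i)) $ i *
          (Z *v (\<chi> i. complex_of_real (of_int (n $ i) + upper_half v $ i))) $ i) +
        (\<Sum>i\<in>UNIV. (\<chi> i. complex_of_real (of_int (n $ i) + upper_half v $ i)) $ i * complex_of_real (lower_half v $ i))) =
      e2pi ((of_ivec n + r) \<star> (Z *v (of_ivec n + r)) / 2 + (of_ivec n + r) \<star> s)"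
      by (simp add: cdot_def)
  qed
  also have "(\<lambda>n. e2pi ((of_ivec n + r) \<star> (Z *v (of_ivec n + r)) / 2 + (of_ivec n + r) \<star> s)) =
    (\<lambda>n. e2pi (r \<star> s / 2 + r \<star> (Z *v r + s) / 2) * ?t n (Z *v r + s))"
  proof
    fix n :: "int ^ 'a"
    have "(of_ivec n + r) \<star> (Z *v (of_ivec n + r)) / 2 + (of_ivec n + r) \<star> s =
      r \<star> s / 2 + r \<star> (Z *v r + s) / 2 + (of_ivec n \<star> (Z *v of_ivec n) / 2 + of_ivec n \<star> (Z *v r + s))"
      using cdot_symmetric_matrix[OF sym, of "of_ivec n" r]
      by (simp add: cdot_linear matrix_vector_right_distrib add_divide_distrib)
    then show "e2pi ((of_ivec n + r) \<star> (Z *v (of_ivec n + r)) / 2 + (of_ivec n + r) \<star> s) =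
      e2pi (r \<star> s / 2 + r \<star> (Z *v r + s) / 2) * ?t n (Z *v r + s)"
      by (simp only: e2pi_add)
  qed
  also have "(\<Sum>\<^sub>\<infinity>n. e2pi (r \<star> s / 2 + r \<star> (Z *v r + s) / 2) * ?t n (Z *v r + s)) =
     e2pi (r \<star> s / 2 + r \<star> (Z *v r + s) / 2) * riemann_theta Z (Z *v r + s)"
    unfolding riemann_theta_def by (rule infsum_cmult_right')
  finally show ?thesis by (simp add: theta_phi_def e2pi_add r_def s_def)
qed

section \<open>Counting even and odd half-integral characteristics\<close>

definition half_chars :: "'g::finite chars set"
  where "half_chars = {v. \<forall>i. v $ i \<in> {0, 1/2}}"

definition parity :: "'g::finite chars \<Rightarrow> complex"
  where "parity a = e2pi (2 * (char_up a \<star> char_lo a))"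

lemma S_minus_eq: "S_minus = {a \<in> half_chars. parity a = -1}"
  and S_plus_eq: "S_plus = {a \<in> half_chars. parity a = 1}"
  by (simp_all add: S_minus_def S_plus_def half_chars_def parity_def of_real_upper_lower[symmetric])

lemma half_chars_Zvec:
  assumes "a \<in> half_chars"
  shows "2 *s char_up a \<in> Zvec" "2 *s char_lo a \<in> Zvec"
proof -
  have "2 * complex_of_real (a $ k) \<in> \<int>" for k
  proof -
    have "a $ k = 0 \<or> a $ k = 1 / 2" using assms by (auto simp: half_chars_def)
    then show ?thesis by (elim disjE) (simp_all only:, simp_all)
  qed
  then show "2 *s char_up a \<in> Zvec" "2 *s char_lo a \<in> Zvec"
    by (simp_all add: Zvec_def char_up_def char_lo_def)
qed

lemma parity_cases:
  assumes "a \<in> half_chars"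
  shows "parity a = 1 \<or> parity a = -1"
proof -
  have "(2 *s char_up a) \<star> (2 *s char_lo a) \<in> \<int>"
    by (intro cdot_Ints half_chars_Zvec assms)
  then have "4 * (char_up a \<star> char_lo a) \<in> \<int>" by (simp add: cdot_scale_left cdot_scale_right)
  then have "e2pi (2 * (char_up a \<star> char_lo a) + 2 * (char_up a \<star> char_lo a)) = 1"
    by (simp add: e2pi_Ints)
  then have "(parity a)\<^sup>2 = 1" by (simp only: e2pi_add parity_def power2_eq_square)
  then show ?thesis by (simp only: power2_eq_1_iff)
qed

text \<open>The entries \<open>Inl i\<close> and \<open>Inr i\<close> are grouped into one pair,
  because \<open>parity\<close> is a product over i; sums over all characteristics then factor into
  four-term sums.\<close>

lemma half_chars_bij:
  "bij_betw (\<lambda>p. \<chi> k. case k of Inl i \<Rightarrow> fst (p i) | Inr i \<Rightarrow> snd (p i))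
    (Pi\<^sub>E UNIV (\<lambda>_. {0, 1/2} \<times> {0, 1/2})) (half_chars :: 'g::finite chars set)"
proof (rule bij_betw_byWitness[where f'="\<lambda>a i. (a $ Inl i, a $ Inr i)"])
  show "\<forall>p\<in>Pi\<^sub>E UNIV (\<lambda>_. {0, 1/2} \<times> {0, 1/2}).
    (\<lambda>i. ((\<chi> k. case k of Inl i \<Rightarrow> fst (p i) | Inr i \<Rightarrow> snd (p i)) $ Inl i :: real,
          (\<chi> k. case k of Inl i \<Rightarrow> fst (p i) | Inr i \<Rightarrow> snd (p i)) $ Inr i :: real)) = p"
    by simp
  show "\<forall>a\<in>half_chars. (\<chi> k. case k of Inl i \<Rightarrow> fst (a $ Inl i, a $ Inr i) | Inr i \<Rightarrow> snd (a $ Inl i, a $ Inr i)) = a"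
    by (simp add: vec_eq_iff split: sum.split)
  show "(\<lambda>p. \<chi> k. case k of Inl i \<Rightarrow> fst (p i) | Inr i \<Rightarrow> snd (p i)) ` (Pi\<^sub>E UNIV (\<lambda>_. {0, 1/2} \<times> {0, 1/2})) \<subseteq> (half_chars :: 'g chars set)"
  proof (rule image_subsetI)
    fix p :: "'g \<Rightarrow> real \<times> real"
    assume "p \<in> Pi\<^sub>E UNIV (\<lambda>_. {0, 1/2} \<times> {0, 1/2})"
    then have "p i \<in> {0, 1/2} \<times> {0, 1/2}" for i by (rule PiE_mem) simp
    then have "fst (p i) \<in> {0, 1/2}" "snd (p i) \<in> {0, 1/2}" for i by (simp_all only: mem_Times_iff)
    then show "(\<chi> k. case k of Inl i \<Rightarrow> fst (p i) | Inr i \<Rightarrow> snd (p i)) \<in> half_chars"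
      unfolding half_chars_def by (simp split: sum.split)
  qed
  show "(\<lambda>a i. (a $ Inl i, a $ Inr i)) ` (half_chars :: 'g chars set) \<subseteq> Pi\<^sub>E UNIV (\<lambda>_. {0, 1/2} \<times> {0, 1/2})"
    by (auto simp: half_chars_def PiE_UNIV_domain)
qed

lemma finite_half_chars [simp]: "finite (half_chars :: 'g::finite chars set)"
proof -
  have "finite (Pi\<^sub>E (UNIV :: 'g set) (\<lambda>_. {0, 1/2 :: real} \<times> {0, 1/2 :: real}))"
    by (intro finite_PiE) auto
  then show ?thesis using bij_betw_finite[OF half_chars_bij] by blast
qed

lemma sum_half_chars:
  fixes F :: "'g::finite \<Rightarrow> real \<Rightarrow> real \<Rightarrow> complex"
  shows "(\<Sum>a\<in>half_chars. \<Prod>i\<in>UNIV. F i (a $ Inl i) (a $ Inr i)) =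
    (\<Prod>i\<in>UNIV. F i 0 0 + F i 0 (1/2) + F i (1/2) 0 + F i (1/2) (1/2))"
proof -
  have "(\<Sum>a\<in>half_chars. \<Prod>i\<in>UNIV. F i (a $ Inl i) (a $ Inr i)) =
     (\<Sum>p\<in>Pi\<^sub>E UNIV (\<lambda>_. {0, 1/2} \<times> {0, 1/2}). \<Prod>i\<in>UNIV. F i (fst (p i)) (snd (p i)))"
    by (subst sum.reindex_bij_betw[OF half_chars_bij, symmetric]) simp
  also have "\<dots> = (\<Prod>i\<in>UNIV. \<Sum>x\<in>{0, 1/2} \<times> {0, 1/2}. F i (fst x) (snd x))"
    by (rule prod_sum_PiE[symmetric]) auto
  also have "\<dots> = (\<Prod>i\<in>UNIV. F i 0 0 + F i 0 (1/2) + F i (1/2) 0 + F i (1/2) (1/2))"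
    by (simp add: sum.cartesian_product[symmetric] case_prod_unfold add_ac)
  finally show ?thesis .
qed

lemma e2pi_sum: "e2pi (\<Sum>i\<in>A. f i) = (\<Prod>i\<in>A. e2pi (f i))"
  by (induction A rule: infinite_finite_induct) (simp_all add: e2pi_add)

lemma parity_prod: "parity a = (\<Prod>i\<in>UNIV. e2pi (2 * (of_real (a $ Inl i) * of_real (a $ Inr i))))"
  by (simp add: parity_def cdot_def char_up_def char_lo_def sum_distrib_left e2pi_sum)

lemma e2pi_half: "e2pi (1 / 2) = -1"
  by (simp add: e2pi_def)

text \<open>Each coordinate contributes 1 + 1 + 1 + e(1/2) = 2.\<close>

lemma sum_parity: "(\<Sum>a\<in>(half_chars :: 'g::finite chars set). parity a) = 2 ^ CARD('g)"
proof -
  let ?f = "\<lambda>x y. e2pi (2 * (of_real x * of_real y))"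
  have "(\<Sum>a\<in>(half_chars :: 'g chars set). parity a) =
      (\<Prod>i\<in>(UNIV :: 'g set). ?f 0 0 + ?f 0 (1/2) + ?f (1/2) 0 + ?f (1/2) (1/2))"
    unfolding parity_prod by (rule sum_half_chars)
  then show ?thesis by (simp add: e2pi_half)
qed

lemma card_half_chars: "of_nat (card (half_chars :: 'g::finite chars set)) = (4 :: complex) ^ CARD('g)"
  using sum_half_chars[where F="\<lambda>(_::'g) _ _. 1"] by simp

lemma sum_S_minus_plus:
  fixes f :: "'g::finite chars \<Rightarrow> complex"
  shows "(\<Sum>a\<in>half_chars. f a) = (\<Sum>a\<in>S_plus. f a) + (\<Sum>a\<in>S_minus. f a)"
    and "(\<Sum>a\<in>half_chars. parity a * f a) = (\<Sum>a\<in>S_plus. f a) - (\<Sum>a\<in>S_minus. f a)"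
proof -
  have un: "half_chars = S_plus \<union> (S_minus :: 'g chars set)"
    using parity_cases by (auto simp: S_plus_eq S_minus_eq)
  have fin: "finite (S_plus :: 'g chars set)" "finite (S_minus :: 'g chars set)"
    by (simp_all add: S_plus_eq S_minus_eq)
  have disj: "S_plus \<inter> S_minus = ({} :: 'g chars set)"
    by (auto simp: S_plus_eq S_minus_eq)
  show "(\<Sum>a\<in>half_chars. f a) = (\<Sum>a\<in>S_plus. f a) + (\<Sum>a\<in>S_minus. f a)"
    unfolding un by (rule sum.union_disjoint[OF fin disj])
  have "(\<Sum>a\<in>half_chars. parity a * f a) = (\<Sum>a\<in>S_plus. parity a * f a) + (\<Sum>a\<in>S_minus. parity a * f a)"
    unfolding un by (rule sum.union_disjoint[OF fin disj])
  also have "(\<Sum>a\<in>S_plus. parity a * f a) = (\<Sum>a\<in>S_plus. f a)"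
    by (intro sum.cong) (auto simp: S_plus_eq)
  also have "(\<Sum>a\<in>S_minus. parity a * f a) = - (\<Sum>a\<in>S_minus. f a)"
    by (subst sum_negf[symmetric], intro sum.cong) (auto simp: S_minus_eq)
  finally show "(\<Sum>a\<in>half_chars. parity a * f a) = (\<Sum>a\<in>S_plus. f a) - (\<Sum>a\<in>S_minus. f a)" by simp
qed

text \<open>Solved from the sum \<open>4^g\<close> and the difference \<open>2^g\<close> of the two
  cardinalities. Doubling keeps an exponent g - 1 out of the formulas.\<close>

lemma card_S:
  "2 * card (S_plus :: 'g::finite chars set) = 2 ^ CARD('g) * (2 ^ CARD('g) + 1)"
  "2 * card (S_minus :: 'g::finite chars set) = 2 ^ CARD('g) * (2 ^ CARD('g) - 1)"
proof -
  let ?P = "card (S_plus :: 'g chars set)" and ?M = "card (S_minus :: 'g chars set)"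
  let ?G = "2 ^ CARD('g) :: nat"
  have 1: "of_nat ?P + of_nat ?M = (4 :: complex) ^ CARD('g)"
    using sum_S_minus_plus(1)[of "\<lambda>_ :: 'g chars. 1"] by (simp add: card_half_chars)
  have 2: "of_nat ?P - of_nat ?M = (2 :: complex) ^ CARD('g)"
    using sum_S_minus_plus(2)[of "\<lambda>_ :: 'g chars. 1"] by (simp add: sum_parity)
  have G: "(4 :: complex) ^ CARD('g) = of_nat (?G * ?G)" "(2 :: complex) ^ CARD('g) = of_nat ?G"
    by (simp_all add: power_mult_distrib[symmetric])
  have "(of_nat (?P + ?M) :: complex) = of_nat (?G * ?G)" using 1 G(1) by simp
  then have s: "?P + ?M = ?G * ?G" by (simp only: of_nat_eq_iff)
  have "(of_nat ?P :: complex) = of_nat (?M + ?G)"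
    using 2 unfolding of_nat_add G(2)[symmetric] by (simp only: diff_eq_eq add.commute)
  then have d: "?P = ?M + ?G" by (simp only: of_nat_eq_iff)
  show "2 * ?P = ?G * (?G + 1)" using s d by (simp add: algebra_simps)
  have "2 * ?M + ?G = ?G * ?G" using s d by linarith
  then show "2 * ?M = ?G * (?G - 1)" by (simp add: diff_mult_distrib2)
qed

lemma prod_single_factor:
  fixes f g :: "'g::finite \<Rightarrow> complex"
  shows "(\<Prod>i\<in>UNIV. if i = k then f i * g i else f i) = (\<Prod>i\<in>UNIV. f i) * g k"
proof -
  have "(\<Prod>i\<in>UNIV. if i = k then f i * g i else f i) = (\<Prod>i\<in>UNIV. f i * (if i = k then g k else 1))"
    by (intro prod.cong) auto
  then show ?thesis by (simp add: prod.distrib)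
qed

text \<open>In the product over coordinates the weighted one contributes (1 + e(1/2)) / 2 = 0. Hence
  even and odd characteristics have the same sum, entry by entry.\<close>

lemma sum_parity_coord:
  "(\<Sum>a\<in>(half_chars :: 'g::finite chars set). parity a * of_real (a $ k)) = 0"
proof -
  let ?f = "\<lambda>x y. e2pi (2 * (of_real x * of_real y))"
  show ?thesis
  proof (cases k)
    case (Inl j)
    let ?F = "\<lambda>i x y. if i = j then ?f x y * of_real x else ?f x y"
    have "parity a * of_real (a $ Inl j) = (\<Prod>i\<in>UNIV. ?F i (a $ Inl i) (a $ Inr i))"
      for a :: "'g chars"
      unfolding parity_prod by (rule prod_single_factor[symmetric])
    then have "(\<Sum>a\<in>(half_chars :: 'g chars set). parity a * of_real (a $ Inl j)) =
        (\<Sum>a\<in>(half_chars :: 'g chars set). \<Prod>i\<in>UNIV. ?F i (a $ Inl i) (a $ Inr i))"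
      by (rule sum.cong[OF refl])
    also have "\<dots> = (\<Prod>i\<in>UNIV. ?F i 0 0 + ?F i 0 (1/2) + ?F i (1/2) 0 + ?F i (1/2) (1/2))"
      by (rule sum_half_chars[where F="?F"])
    also have "\<dots> = 0" by (intro prod_zero bexI[of _ j]) (simp_all add: e2pi_half)
    finally show ?thesis using Inl by simp
  next
    case (Inr j)
    let ?F = "\<lambda>i x y. if i = j then ?f x y * of_real y else ?f x y"
    have "parity a * of_real (a $ Inr j) = (\<Prod>i\<in>UNIV. ?F i (a $ Inl i) (a $ Inr i))"
      for a :: "'g chars"
      unfolding parity_prod by (rule prod_single_factor[symmetric])
    then have "(\<Sum>a\<in>(half_chars :: 'g chars set). parity a * of_real (a $ Inr j)) =
        (\<Sum>a\<in>(half_chars :: 'g chars set). \<Prod>i\<in>UNIV. ?F i (a $ Inl i) (a $ Inr i))"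
      by (rule sum.cong[OF refl])
    also have "\<dots> = (\<Prod>i\<in>UNIV. ?F i 0 0 + ?F i 0 (1/2) + ?F i (1/2) 0 + ?F i (1/2) (1/2))"
      by (rule sum_half_chars[where F="?F"])
    also have "\<dots> = 0" by (intro prod_zero bexI[of _ j]) (simp_all add: e2pi_half)
    finally show ?thesis using Inr by simp
  qed
qed

lemma sum_S_coord:
  "(\<Sum>a\<in>S_plus. of_real (a $ k)) = (\<Sum>a\<in>(S_minus :: 'g::finite chars set). complex_of_real (a $ k))"
  using sum_S_minus_plus(2)[of "\<lambda>a. of_real (a $ k)"] by (simp add: sum_parity_coord)

lemma sum_S_cdot:
  fixes x y :: "complex ^ 'g::finite"
  shows "(\<Sum>a\<in>S_plus. char_up a \<star> x - y \<star> char_lo a) = (\<Sum>a\<in>S_minus. char_up a \<star> x - y \<star> char_lo a)"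
proof -
  have "(\<Sum>a\<in>A. char_up a \<star> x - y \<star> char_lo a) =
      (\<Sum>i\<in>UNIV. (\<Sum>a\<in>A. of_real (a $ Inl i)) * x $ i) - (\<Sum>i\<in>UNIV. y $ i * (\<Sum>a\<in>A. of_real (a $ Inr i)))"
    for A :: "'g chars set"
    unfolding sum_subtractf cdot_def char_up_def char_lo_def sum_distrib_left sum_distrib_right
    by (simp add: sum.swap[of _ UNIV A])
  then show ?thesis by (simp only: sum_S_coord)
qed

text \<open>The weights in \<open>Theta\<close> are chosen so that every factor that does not depend on the characteristic
  cancels between numerator and denominator.\<close>

lemma card_S_weights:
  "(2 ^ CARD('g) + 1) * card (S_minus :: 'g::finite chars set) =
   (2 ^ CARD('g) - 1) * card (S_plus :: 'g chars set)"
proof -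
  let ?G = "2 ^ CARD('g) :: nat"
  have "2 * ((?G + 1) * card (S_minus :: 'g chars set)) = (?G + 1) * (?G * (?G - 1))"
    using card_S(2)[where 'g='g] by (metis mult.left_commute)
  moreover have "2 * ((?G - 1) * card (S_plus :: 'g chars set)) = (?G - 1) * (?G * (?G + 1))"
    using card_S(1)[where 'g='g] by (metis mult.left_commute)
  ultimately have "2 * ((?G + 1) * card (S_minus :: 'g chars set)) =
      2 * ((?G - 1) * card (S_plus :: 'g chars set))"
    by (simp only: mult_ac)
  moreover have "p = q" if "2 * p = 2 * q" for p q :: nat using that by simp
  ultimately show ?thesis by blast
qed

text \<open>This explains the exponential prefactor in \<open>Theta_num\<close>: it cancels the
  factors e(r \<star> s / 2) that the characteristic v brings into all factors over
  \<open>S_minus\<close>, whose number supplies the constant. The mixed terms in a and v are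
  integral because 2 a and N v are.\<close>

lemma Theta_num_eq:
  fixes Z :: "complex ^ 'g ^ 'g::finite"
  assumes Z: "Z \<in> siegel" and v: "of_nat N *s char_up v \<in> Zvec" "of_nat N *s char_lo v \<in> Zvec"
  shows "Theta_num N v Z = 2 ^ (4 * N) *
    (\<Prod>a\<in>(S_minus :: 'g chars set). e2pi (of_nat (2 * N * (2 ^ CARD('g) + 1)) * (char_up a \<star> char_lo a))) *
    (\<Prod>a\<in>S_minus. theta_phi Z (char_up a - char_up v) (char_lo a - char_lo v) ^ (4 * N * (2 ^ CARD('g) + 1)))"
proof -
  define G :: nat where "G = 2 ^ CARD('g) + 1"
  let ?w = "char_up v \<star> char_lo v"
  let ?S = "S_minus :: 'g chars set"
  have "theta (a - v) Z ^ (4 * N * G) = e2pi (of_nat (2 * N * G) * ?w) *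
     (e2pi (of_nat (2 * N * G) * (char_up a \<star> char_lo a)) *
      theta_phi Z (char_up a - char_up v) (char_lo a - char_lo v) ^ (4 * N * G))" if "a \<in> ?S" for a
  proof -
    have a: "a \<in> half_chars" using that by (simp add: S_minus_eq)
    have "(of_nat N *s char_up v) \<star> (2 *s char_lo a) \<in> \<int>" "(2 *s char_up a) \<star> (of_nat N *s char_lo v) \<in> \<int>"
      by (intro cdot_Ints half_chars_Zvec a v)+
    then have int: "of_nat G * ((of_nat N *s char_up v) \<star> (2 *s char_lo a)) \<in> \<int>"
      "of_nat G * ((2 *s char_up a) \<star> (of_nat N *s char_lo v)) \<in> \<int>"
      by (auto intro: Ints_mult)
    have "of_nat (4 * N * G) * ((char_up a - char_up v) \<star> (char_lo a - char_lo v) / 2) =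
      of_nat (2 * N * G) * ?w + of_nat (2 * N * G) * (char_up a \<star> char_lo a)
      + (- (of_nat G * ((of_nat N *s char_up v) \<star> (2 *s char_lo a)))
      - of_nat G * ((2 *s char_up a) \<star> (of_nat N *s char_lo v)))"
    proof -
      have half: "of_nat (4 * N * G) * (x / 2) = of_nat (2 * N * G) * x" for x :: complex by simp
      show ?thesis
        unfolding half cdot_linear cdot_scale_left cdot_scale_right by (simp add: algebra_simps)
    qed
    then have "e2pi (of_nat (4 * N * G) * ((char_up a - char_up v) \<star> (char_lo a - char_lo v) / 2)) =
       e2pi (of_nat (2 * N * G) * ?w) * e2pi (of_nat (2 * N * G) * (char_up a \<star> char_lo a))"
      using int by (simp only: e2pi_add e2pi_Ints[OF Ints_diff[OF Ints_minus[OF int(1)] int(2)]] mult_1_right)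
    then show ?thesis
      by (simp only: theta_eq_theta_phi[OF Z] char_diff power_mult_distrib e2pi_of_nat_mult mult.assoc)
  qed
  then have "(\<Prod>a\<in>?S. theta (a - v) Z ^ (4 * N * G)) = (\<Prod>a\<in>?S. e2pi (of_nat (2 * N * G) * ?w) *
     (e2pi (of_nat (2 * N * G) * (char_up a \<star> char_lo a)) *
      theta_phi Z (char_up a - char_up v) (char_lo a - char_lo v) ^ (4 * N * G)))"
    by (rule prod.cong[OF refl])
  also have "\<dots> = e2pi (of_nat (2 * N * G) * ?w) ^ card ?S *
      ((\<Prod>a\<in>?S. e2pi (of_nat (2 * N * G) * (char_up a \<star> char_lo a))) *
       (\<Prod>a\<in>?S. theta_phi Z (char_up a - char_up v) (char_lo a - char_lo v) ^ (4 * N * G)))"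
    by (simp only: prod.distrib prod_constant)
  also have "e2pi (of_nat (2 * N * G) * ?w) ^ card ?S = e2pi (of_nat (card ?S) * (of_nat (2 * N * G) * ?w))"
    by (simp only: e2pi_of_nat_mult)
  also have "of_nat (card ?S) * (of_nat (2 * N * G) * ?w) = of_nat (N * G * (2 * card ?S)) * ?w"
    by simp
  also have "N * G * (2 * card ?S) = 2 ^ CARD('g) * N * (2 ^ CARD('g) - 1) * G"
    unfolding card_S by (simp add: mult_ac)
  finally have 1: "(\<Prod>a\<in>?S. theta (a - v) Z ^ (4 * N * G)) =
    e2pi (of_nat (2 ^ CARD('g) * N * (2 ^ CARD('g) - 1) * G) * ?w) *
      ((\<Prod>a\<in>?S. e2pi (of_nat (2 * N * G) * (char_up a \<star> char_lo a))) *
       (\<Prod>a\<in>?S. theta_phi Z (char_up a - char_up v) (char_lo a - char_lo v) ^ (4 * N * G)))" .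
  have "real (2 ^ CARD('g) - 1) = 2 ^ CARD('g) - 1" by (simp add: of_nat_diff)
  then have "2 ^ CARD('g) * real N * (2 ^ CARD('g) - 1) * (2 ^ CARD('g) + 1) =
      real (2 ^ CARD('g) * N * (2 ^ CARD('g) - 1) * G)"
    unfolding G_def by (simp add: ring_distribs)
  then have 2: "- complex_of_real (2 ^ CARD('g) * real N * (2 ^ CARD('g) - 1) * (2 ^ CARD('g) + 1)
          * (upper_half v \<bullet> lower_half v)) = - (of_nat (2 ^ CARD('g) * N * (2 ^ CARD('g) - 1) * G) * ?w)"
    by (simp only: of_real_mult of_real_upper_lower of_real_of_nat_eq)
  show ?thesis
    unfolding Theta_num_def 2 G_def[symmetric] 1 e2pi_minus by simp
qed

lemma Theta_den_eq:
  fixes Z :: "complex ^ 'g ^ 'g::finite"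
  assumes Z: "Z \<in> siegel"
  shows "Theta_den N Z =
    (\<Prod>a\<in>(S_plus :: 'g chars set). e2pi (char_up a \<star> char_lo a / 2) ^ (4 * N * (2 ^ CARD('g) - 1))) *
    (\<Prod>a\<in>S_plus. theta_phi Z (char_up a) (char_lo a) ^ (4 * N * (2 ^ CARD('g) - 1)))"
  by (simp only: Theta_den_def theta_eq_theta_phi[OF Z] power_mult_distrib prod.distrib)

section \<open>The affine action on half-integral characteristics\<close>

definition half_residue :: "complex \<Rightarrow> real"
  where "half_residue c = (if c \<in> \<int> then 0 else 1 / 2)"

lemma half_residue_diff:
  assumes "2 * c \<in> \<int>"
  shows "c - of_real (half_residue c) \<in> \<int>"
proof (cases "c \<in> \<int>")
  case False
  obtain k where k: "2 * c = of_int k" using assms by (elim Ints_cases)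
  have "odd k"
  proof
    assume "even k"
    then obtain l where "k = 2 * l" by (elim evenE)
    with k have "c = of_int l" by simp
    with False show False by simp
  qed
  then obtain l where "k = 2 * l + 1" by (elim oddE)
  with k have "c - 1 / 2 = of_int l" by (simp add: field_simps)
  with False show ?thesis by (simp add: half_residue_def)
qed (simp add: half_residue_def)

context symplectic_blocks
begin

definition char_act :: "'g chars \<Rightarrow> 'g chars"
  where "char_act a = (\<chi> k. case k of
     Inl i \<Rightarrow> half_residue (tr_up (char_up a + eta_up) (char_lo a + eta_lo) $ i)
   | Inr i \<Rightarrow> half_residue (tr_lo (char_up a + eta_up) (char_lo a + eta_lo) $ i))"

lemma char_act_half_chars: "char_act a \<in> half_chars"
  by (auto simp: half_chars_def char_act_def half_residue_def split: sum.split)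

lemma tr_scale: "tr_up (c *s r) (c *s s) = c *s tr_up r s" "tr_lo (c *s r) (c *s s) = c *s tr_lo r s"
  by (simp_all add: tr_up_def tr_lo_def vector_scalar_commute vector_ssub_ldistrib)

lemma two_eta: "2 *s eta_up = eps_up" "2 *s eta_lo = eps_lo"
  by (simp_all add: eta_up_def eta_lo_def vec_eq_iff)

lemma char_act_diff:
  assumes "a \<in> half_chars"
  shows "tr_up (char_up a + eta_up) (char_lo a + eta_lo) - char_up (char_act a) \<in> Zvec"
    "tr_lo (char_up a + eta_up) (char_lo a + eta_lo) - char_lo (char_act a) \<in> Zvec"
proof -
  let ?r = "char_up a + eta_up" and ?s = "char_lo a + eta_lo"
  have rs: "2 *s ?r \<in> Zvec" "2 *s ?s \<in> Zvec"
    using half_chars_Zvec[OF assms] by (auto simp: vector_add_ldistrib two_eta)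
  have "2 *s tr_up ?r ?s \<in> Zvec" "2 *s tr_lo ?r ?s \<in> Zvec"
    using tr_Zvec[OF rs] by (simp_all only: tr_scale)
  then have "2 * tr_up ?r ?s $ i \<in> \<int>" "2 * tr_lo ?r ?s $ i \<in> \<int>" for i
    by (auto simp: Zvec_def)
  then show "tr_up ?r ?s - char_up (char_act a) \<in> Zvec" "tr_lo ?r ?s - char_lo (char_act a) \<in> Zvec"
    using half_residue_diff by (auto simp: Zvec_def char_up_def char_lo_def char_act_def)
qed

text \<open>\<open>tr_parity\<close> applied to 2 (a + eta), an integral vector. Besides integers,
  the only extra term is eps_up \<star> eps_lo / 2, which \<open>eps_even\<close> removes.\<close>

lemma parity_char_act:
  assumes Z: "(Z :: complex ^ 'g ^ 'g) \<in> siegel" and a: "a \<in> half_chars"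
  shows "parity (char_act a) = parity a"
proof -
  let ?u = "char_up a" and ?l = "char_lo a" and ?u' = "char_up (char_act a)" and ?l' = "char_lo (char_act a)"
  define m where "m = tr_up (?u + eta_up) (?l + eta_lo) - ?u'"
  define n where "n = tr_lo (?u + eta_up) (?l + eta_lo) - ?l'"
  have mn: "m \<in> Zvec" "n \<in> Zvec" using char_act_diff[OF a] by (simp_all add: m_def n_def)
  define x where "x = 2 *s ?u + eps_up"
  define y where "y = 2 *s ?l + eps_lo"
  have xy: "x \<in> Zvec" "y \<in> Zvec" using half_chars_Zvec[OF a] by (simp_all add: x_def y_def)
  have t: "tr_up x y = 2 *s (m + ?u')" "tr_lo x y = 2 *s (n + ?l')"
  proof -
    have "x = 2 *s (?u + eta_up)" "y = 2 *s (?l + eta_lo)"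
      unfolding x_def y_def two_eta[symmetric] vector_add_ldistrib by (rule refl)+
    moreover have "m + ?u' = tr_up (?u + eta_up) (?l + eta_lo)" "n + ?l' = tr_lo (?u + eta_up) (?l + eta_lo)"
      by (simp_all add: m_def n_def)
    ultimately show "tr_up x y = 2 *s (m + ?u')" "tr_lo x y = 2 *s (n + ?l')"
      by (simp_all only: tr_scale)
  qed
  have u'l': "2 *s ?u' \<in> Zvec" "2 *s ?l' \<in> Zvec"
    by (intro half_chars_Zvec char_act_half_chars)+
  have int: "m \<star> (2 *s ?l') \<in> \<int>" "(2 *s ?u') \<star> n \<in> \<int>" "2 * (m \<star> n) \<in> \<int>"
    by (intro cdot_Ints mn u'l' Ints_mult Ints_numeral)+
  have "tr_up x y \<star> tr_lo x y / 2 = 2 * (?u' \<star> ?l') + (m \<star> (2 *s ?l') + (2 *s ?u') \<star> n + 2 * (m \<star> n))"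
    unfolding t cdot_linear cdot_scale_left cdot_scale_right by simp
  then have "parity (char_act a) = e2pi (tr_up x y \<star> tr_lo x y / 2)"
    by (simp only: parity_def e2pi_add e2pi_Ints[OF int(1)] e2pi_Ints[OF int(2)] e2pi_Ints[OF int(3)] mult_1_right)
  also have "\<dots> = e2pi (x \<star> y / 2 + (x \<star> eps_lo - eps_up \<star> y) / 2)"
    by (rule tr_parity[OF xy])
  also have "x \<star> y / 2 + (x \<star> eps_lo - eps_up \<star> y) / 2 =
      2 * (?u \<star> ?l) + (2 *s ?u) \<star> eps_lo + eps_up \<star> eps_lo / 2"
    unfolding x_def y_def cdot_linear cdot_scale_left cdot_scale_right
    by (simp add: add_divide_distrib diff_divide_distrib)
  also have "e2pi \<dots> = parity a"
    using cdot_Ints[OF half_chars_Zvec(1)[OF a] eps_Zvec(2)]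
    by (simp only: e2pi_add e2pi_Ints eps_even[OF Z] parity_def mult_1_right)
  finally show ?thesis .
qed

lemma tr_inverse:
  "transpose A *v tr_up r s + transpose C *v tr_lo r s = r"
  "transpose B *v tr_up r s + transpose D *v tr_lo r s = s"
  by (simp_all add: tr_up_def tr_lo_def mv_simps block_relations)

text \<open>In a difference the translation by eta drops out, and M^T maps integral vectors to
  integral ones; so equal images force a - b to be integral, hence 0 for entries in {0,
  1/2}.\<close>

lemma char_act_inj: "inj_on char_act half_chars"
proof (rule inj_onI)
  fix a b
  assume ab: "a \<in> half_chars" "b \<in> half_chars" "char_act a = char_act b"
  define x where "x = tr_up (char_up a - char_up b) (char_lo a - char_lo b)"
  define y where "y = tr_lo (char_up a - char_up b) (char_lo a - char_lo b)"
  have d: "(p + q) - (r + q) = p - r" for p q r :: "complex ^ 'g" by simp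
  have "x = tr_up (char_up a + eta_up) (char_lo a + eta_lo) - char_up (char_act a)
     - (tr_up (char_up b + eta_up) (char_lo b + eta_lo) - char_up (char_act b))"
    by (simp add: x_def ab(3) d flip: tr_diff)
  then have x: "x \<in> Zvec"
    using Zvec_diff[OF char_act_diff(1)[OF ab(1)] char_act_diff(1)[OF ab(2)]] by (simp only:)
  have "y = tr_lo (char_up a + eta_up) (char_lo a + eta_lo) - char_lo (char_act a)
     - (tr_lo (char_up b + eta_up) (char_lo b + eta_lo) - char_lo (char_act b))"
    by (simp add: y_def ab(3) d flip: tr_diff)
  then have y: "y \<in> Zvec"
    using Zvec_diff[OF char_act_diff(2)[OF ab(1)] char_act_diff(2)[OF ab(2)]] by (simp only:)
  have mv: "transpose M *v w \<in> Zvec" if "\<And>i j. M $ i $ j \<in> \<int>" "w \<in> Zvec" for M :: "complex ^ 'g ^ 'g" and w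
    using that by (auto simp: Zvec_def matrix_vector_mult_def transpose_def intro!: Ints_sum Ints_mult)
  have "char_up a - char_up b = transpose A *v x + transpose C *v y"
    "char_lo a - char_lo b = transpose B *v x + transpose D *v y"
    by (simp_all add: x_def y_def tr_inverse)
  then have "char_up a - char_up b \<in> Zvec" "char_lo a - char_lo b \<in> Zvec"
    using mv integral x y by simp_all
  then have "complex_of_real (a $ k - b $ k) \<in> \<int>" for k
    by (cases k) (auto simp: Zvec_def char_up_def char_lo_def)
  then have int: "a $ k - b $ k \<in> \<int>" for k using of_real_in_Ints_iff by blast
  have "a $ k = b $ k" for k
  proof -
    have "a $ k \<in> {0, 1/2}" "b $ k \<in> {0, 1/2}" using ab by (auto simp: half_chars_def)
    then have "\<bar>a $ k - b $ k\<bar> < 1" by auto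
    moreover obtain l where l: "a $ k - b $ k = of_int l" using int[of k] by (elim Ints_cases)
    ultimately have "l = 0" by simp
    with l show ?thesis by simp
  qed
  then show "a = b" by (simp add: vec_eq_iff)
qed

lemma char_act_bij:
  assumes Z: "(Z :: complex ^ 'g ^ 'g) \<in> siegel"
  shows "bij_betw char_act S_minus S_minus" "bij_betw char_act S_plus S_plus"
proof -
  have "bij_betw char_act S S"
    if "S = {a \<in> half_chars. parity a = c}" for S :: "'g chars set" and c
  proof -
    have fin: "finite S" using that by simp
    have sub: "char_act ` S \<subseteq> S"
      using that char_act_half_chars parity_char_act[OF Z] by auto
    have inj: "inj_on char_act S" using char_act_inj that by (auto intro: inj_on_subset)
    show ?thesis using endo_inj_surj[OF fin sub inj] inj by (simp add: bij_betw_def)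
  qed
  then show "bij_betw char_act S_minus S_minus" "bij_betw char_act S_plus S_plus"
    using S_minus_eq S_plus_eq by blast+
qed

text \<open>Reduction modulo 1 costs a quasi-period (m, n), whose multiplier is a 4N-th root of
  unity: 2 a' and N times the transformed (r, s) are integral. In the factor of the transformation
  law the power 4N also removes (r, s), so the surviving exponential depends on a alone.\<close>

lemma theta_phi_char_act:
  assumes Z: "Z \<in> siegel" and a: "a \<in> half_chars"
    and v: "of_nat N *s r \<in> Zvec" "of_nat N *s s \<in> Zvec"
    and \<kappa>: "\<And>r s. theta_phi (act Z) (tr_up (r + eta_up) (s + eta_lo)) (tr_lo (r + eta_up) (s + eta_lo)) =
      \<kappa> * e2pi ((r \<star> eta_lo - eta_up \<star> s) / 2) * theta_phi Z r s"
  shows "theta_phi (act Z) (char_up (char_act a) - tr_up r s) (char_lo (char_act a) - tr_lo r s) ^ (4 * N) =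
    \<kappa> ^ (4 * N) * e2pi (of_nat (2 * N) * (char_up a \<star> eta_lo - eta_up \<star> char_lo a)) *
      theta_phi Z (char_up a - r) (char_lo a - s) ^ (4 * N)"
proof -
  have sym: "transpose (act Z) = act Z" using siegel_act[OF Z] by (simp add: siegel_def)
  let ?u = "char_up a" and ?l = "char_lo a" and ?u' = "char_up (char_act a)" and ?l' = "char_lo (char_act a)"
  let ?r = "tr_up r s" and ?s = "tr_lo r s"
  define m where "m = tr_up (?u + eta_up) (?l + eta_lo) - ?u'"
  define n where "n = tr_lo (?u + eta_up) (?l + eta_lo) - ?l'"
  have mn: "m \<in> Zvec" "n \<in> Zvec" using char_act_diff[OF a] by (simp_all add: m_def n_def)
  have c: "?u - r + eta_up = (?u + eta_up) - r" "?l - s + eta_lo = (?l + eta_lo) - s" by simp_all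
  have t: "tr_up (?u - r + eta_up) (?l - s + eta_lo) = (?u' - ?r) + m"
    "tr_lo (?u - r + eta_up) (?l - s + eta_lo) = (?l' - ?s) + n"
    unfolding c tr_diff by (simp_all add: m_def n_def)
  let ?E = "m \<star> n / 2 + ((?u' - ?r) \<star> n - m \<star> (?l' - ?s)) / 2"
  let ?F = "((?u - r) \<star> eta_lo - eta_up \<star> (?l - s)) / 2"
  have eq: "e2pi ?E * theta_phi (act Z) (?u' - ?r) (?l' - ?s) = \<kappa> * e2pi ?F * theta_phi Z (?u - r) (?l - s)"
    using \<kappa>[of "?u - r" "?l - s"] unfolding t theta_phi_quasi_periodic[OF sym mn] .
  have Nv: "of_nat N *s ?r \<in> Zvec" "of_nat N *s ?s \<in> Zvec"
    using tr_Zvec[OF v] by (simp_all add: tr_scale)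
  have u'l': "2 *s ?u' \<in> Zvec" "2 *s ?l' \<in> Zvec"
    by (intro half_chars_Zvec char_act_half_chars)+
  have int: "of_nat (2 * N) * (m \<star> n) + of_nat N * ((2 *s ?u') \<star> n - m \<star> (2 *s ?l')) -
      of_nat 2 * ((of_nat N *s ?r) \<star> n - m \<star> (of_nat N *s ?s)) \<in> \<int>"
    by (intro Ints_add Ints_diff Ints_mult Ints_of_nat cdot_Ints mn u'l' Nv)
  have "of_nat (4 * N) * ?E = of_nat (2 * N) * (m \<star> n) + of_nat N * ((2 *s ?u') \<star> n - m \<star> (2 *s ?l')) -
      of_nat 2 * ((of_nat N *s ?r) \<star> n - m \<star> (of_nat N *s ?s))"
  proof -
    have half: "of_nat (4 * N) * (x / 2 + y / 2) = of_nat (2 * N) * (x + y)" for x y :: complex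
      by (simp add: ring_distribs)
    show ?thesis
      unfolding half cdot_linear cdot_scale_left cdot_scale_right by (simp add: algebra_simps)
  qed
  then have 1: "e2pi ?E ^ (4 * N) = 1"
    using e2pi_Ints[OF int] by (simp only: e2pi_of_nat_mult[symmetric])
  have int': "eps_up \<star> (of_nat N *s s) - (of_nat N *s r) \<star> eps_lo \<in> \<int>"
    by (intro Ints_diff cdot_Ints eps_Zvec v)
  have "of_nat (4 * N) * ?F = of_nat (2 * N) * (?u \<star> eta_lo - eta_up \<star> ?l) +
      (eps_up \<star> (of_nat N *s s) - (of_nat N *s r) \<star> eps_lo)"
  proof -
    have half: "of_nat (4 * N) * (y / 2) = of_nat (2 * N) * y" for y :: complex by simp
    show ?thesis
      unfolding half two_eta[symmetric] cdot_linear cdot_scale_left cdot_scale_right by (simp add: algebra_simps)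
  qed
  then have 2: "e2pi ?F ^ (4 * N) = e2pi (of_nat (2 * N) * (?u \<star> eta_lo - eta_up \<star> ?l))"
    using e2pi_Ints[OF int'] by (simp only: e2pi_of_nat_mult[symmetric] e2pi_add mult_1_right)
  have "(e2pi ?E * theta_phi (act Z) (?u' - ?r) (?l' - ?s)) ^ (4 * N) =
     (\<kappa> * e2pi ?F * theta_phi Z (?u - r) (?l - s)) ^ (4 * N)" by (simp only: eq)
  then show ?thesis unfolding power_mult_distrib 1 2 mult_1_left .
qed

theorem Theta_transform:
  assumes Z: "Z \<in> siegel"
    and v: "of_nat N *s char_up v \<in> Zvec" "of_nat N *s char_lo v \<in> Zvec"
    and v': "char_up v' = tr_up (char_up v) (char_lo v)" "char_lo v' = tr_lo (char_up v) (char_lo v)"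
  obtains c where "c \<noteq> 0" "Theta_num N v' (act Z) = c * Theta_num N v Z" "Theta_den N (act Z) = c * Theta_den N Z"
proof -
  obtain \<kappa> where \<kappa>: "\<kappa> \<noteq> 0" "\<And>r s. theta_phi (act Z) (tr_up (r + eta_up) (s + eta_lo)) (tr_lo (r + eta_up) (s + eta_lo)) =
      \<kappa> * e2pi ((r \<star> eta_lo - eta_up \<star> s) / 2) * theta_phi Z r s"
    using theta_phi_transform[OF Z] by blast
  have Z': "act Z \<in> siegel" by (rule siegel_act[OF Z])
  have Nv': "of_nat N *s char_up v' \<in> Zvec" "of_nat N *s char_lo v' \<in> Zvec"
    using tr_Zvec[OF v] by (simp_all add: v' tr_scale)
  define \<omega> where "\<omega> a = char_up a \<star> eta_lo - eta_up \<star> char_lo a" for a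
  let ?G = "2 ^ CARD('g) :: nat"
  \<comment> \<open>The weight w and the characteristic stay free: the numerator takes
    \<open>S_minus\<close>, v and \<open>2^g\<close> + 1, the denominator \<open>S_plus\<close>, 0
    and \<open>2^g\<close> - 1.\<close>
  have prod_transform: "(\<Prod>a\<in>S. theta_phi (act Z) (char_up a - tr_up r s) (char_lo a - tr_lo r s) ^ (4 * N * w)) =
      \<kappa> ^ (4 * N * (w * card S)) * e2pi (of_nat (2 * N * w) * (\<Sum>a\<in>S. \<omega> a)) *
      (\<Prod>a\<in>S. theta_phi Z (char_up a - r) (char_lo a - s) ^ (4 * N * w))"
    if S: "bij_betw char_act S S" "S \<subseteq> half_chars" and rs: "of_nat N *s r \<in> Zvec" "of_nat N *s s \<in> Zvec"
    for S r s w
  proof -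
    have "(\<Prod>a\<in>S. theta_phi (act Z) (char_up a - tr_up r s) (char_lo a - tr_lo r s) ^ (4 * N * w)) =
      (\<Prod>a\<in>S. theta_phi (act Z) (char_up (char_act a) - tr_up r s) (char_lo (char_act a) - tr_lo r s) ^ (4 * N * w))"
      by (rule prod.reindex_bij_betw[OF S(1), symmetric])
    also have "\<dots> = (\<Prod>a\<in>S. \<kappa> ^ (4 * N * w) * (e2pi (of_nat (2 * N * w) * \<omega> a) *
      theta_phi Z (char_up a - r) (char_lo a - s) ^ (4 * N * w)))"
    proof (rule prod.cong[OF refl])
      fix a assume "a \<in> S"
      then have a: "a \<in> half_chars" using S by blast
      have "e2pi (of_nat (2 * N * w) * \<omega> a) = e2pi (of_nat (2 * N) * \<omega> a) ^ w"
        by (simp add: mult_ac flip: e2pi_of_nat_mult)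
      then show "theta_phi (act Z) (char_up (char_act a) - tr_up r s) (char_lo (char_act a) - tr_lo r s) ^ (4 * N * w) =
        \<kappa> ^ (4 * N * w) * (e2pi (of_nat (2 * N * w) * \<omega> a) * theta_phi Z (char_up a - r) (char_lo a - s) ^ (4 * N * w))"
        unfolding power_mult[of _ "4 * N" w] theta_phi_char_act[OF Z a rs \<kappa>(2)] \<omega>_def[symmetric]
        by (simp only: power_mult_distrib mult.assoc)
    qed
    also have "\<dots> = (\<kappa> ^ (4 * N * w)) ^ card S * ((\<Prod>a\<in>S. e2pi (of_nat (2 * N * w) * \<omega> a)) *
      (\<Prod>a\<in>S. theta_phi Z (char_up a - r) (char_lo a - s) ^ (4 * N * w)))"
      by (simp only: prod.distrib prod_constant power_mult)
    also have "(\<Prod>a\<in>S. e2pi (of_nat (2 * N * w) * \<omega> a)) = e2pi (of_nat (2 * N * w) * (\<Sum>a\<in>S. \<omega> a))"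
      by (simp only: e2pi_sum[symmetric] sum_distrib_left)
    finally show ?thesis by (simp only: power_mult mult.assoc)
  qed
  have sub: "S_minus \<subseteq> half_chars" "S_plus \<subseteq> half_chars" by (auto simp: S_minus_eq S_plus_eq)
  define c where "c = \<kappa> ^ (4 * N * ((?G + 1) * card (S_minus :: 'g chars set))) *
    e2pi (of_nat (2 * N * (?G + 1)) * (\<Sum>a\<in>S_minus. \<omega> a))"
  have "c \<noteq> 0" using \<kappa>(1) by (simp add: c_def)
  moreover have "Theta_num N v' (act Z) = c * Theta_num N v Z"
    unfolding Theta_num_eq[OF Z' Nv'] Theta_num_eq[OF Z v] v'
      prod_transform[OF char_act_bij(1)[OF Z] sub(1) v] c_def
    by (simp only: mult_ac)
  moreover have "Theta_den N (act Z) = c * Theta_den N Z"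
  proof -
    have 0: "of_nat N *s (0 :: complex ^ 'g) \<in> Zvec" by (simp add: Zvec_def)
    have tr0: "tr_up 0 0 = 0" "tr_lo 0 0 = 0" by (simp_all add: tr_up_def tr_lo_def)
    have \<omega>: "(\<Sum>a\<in>S_plus. \<omega> a) = (\<Sum>a\<in>S_minus. \<omega> a)" unfolding \<omega>_def by (rule sum_S_cdot)
    have int: "of_nat (4 * N) * (\<Sum>a\<in>S_minus. \<omega> a) \<in> \<int>"
    proof -
      have "of_nat (4 * N) * \<omega> a \<in> \<int>" if "a \<in> S_minus" for a
      proof -
        have a: "a \<in> half_chars" using that sub by blast
        have "of_nat (4 * N) * \<omega> a = of_nat N * ((2 *s char_up a) \<star> eps_lo - eps_up \<star> (2 *s char_lo a))"
          unfolding two_eta[symmetric] \<omega>_def cdot_scale_left cdot_scale_right by (simp add: algebra_simps)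
        also have "\<dots> \<in> \<int>"
          by (intro Ints_mult Ints_diff Ints_of_nat cdot_Ints half_chars_Zvec a eps_Zvec)
        finally show ?thesis .
      qed
      then show ?thesis unfolding sum_distrib_left by (rule Ints_sum)
    qed
    \<comment> \<open>The two weights differ by 2, so the exponents differ by 4N times the common
      sum of \<omega>, an integer by the preceding fact.\<close>
    have "(of_nat (2 * N * (?G + 1)) :: complex) = of_nat (2 * N * (?G - 1)) + of_nat (4 * N)"
    proof -
      have "?G + 1 = (?G - 1) + 2" by simp
      then have "2 * N * (?G + 1) = 2 * N * (?G - 1) + 4 * N" by (simp only: distrib_left)
      then show ?thesis by (simp only: of_nat_add[symmetric])
    qed
    then have "e2pi (of_nat (2 * N * (?G + 1)) * (\<Sum>a\<in>S_minus. \<omega> a)) =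
        e2pi (of_nat (2 * N * (?G - 1)) * (\<Sum>a\<in>S_minus. \<omega> a))"
      using e2pi_Ints[OF int] by (simp only: distrib_right e2pi_add mult_1_right)
    then have c: "c = \<kappa> ^ (4 * N * ((?G - 1) * card (S_plus :: 'g chars set))) *
        e2pi (of_nat (2 * N * (?G - 1)) * (\<Sum>a\<in>S_plus. \<omega> a))"
      unfolding c_def card_S_weights \<omega> by simp
    show ?thesis
      using prod_transform[OF char_act_bij(2)[OF Z] sub(2) 0 0, of "?G - 1"]
      unfolding Theta_den_eq[OF Z'] Theta_den_eq[OF Z] tr0 diff_0_right c
      by (simp only: mult_ac)
  qed
  ultimately show ?thesis by (rule that)
qed

end


section \<open>Holomorphy of the symplectic action\<close>

text \<open>The local condition in \<open>holomorphic_on_siegel\<close>, split off to get a calculus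
  for it. The derivative is taken within U, since symmetry of Z keeps \<open>siegel\<close> from
  being open among all matrices in general.\<close>

definition cdiff_within ::
    "(complex ^ 'g::finite ^ 'g \<Rightarrow> complex) \<Rightarrow> complex ^ 'g ^ 'g \<Rightarrow> (complex ^ 'g ^ 'g) set \<Rightarrow> bool"
  where "cdiff_within F Z U \<longleftrightarrow>
    (\<exists>D. (F has_derivative D) (at Z within U) \<and> (\<forall>c A. D (\<chi> i j. c * A $ i $ j) = c * D A))"

lemma cdiff_within_const: "cdiff_within (\<lambda>_. c) Z U"
  unfolding cdiff_within_def by (intro exI[of _ "\<lambda>_. 0"]) simp

lemma cdiff_within_entry: "cdiff_within (\<lambda>Z. Z $ i $ j) Z U"
proof -
  have "bounded_linear (\<lambda>Z :: complex ^ 'a ^ 'a. Z $ i $ j)"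
    by (rule bounded_linear_compose[OF bounded_linear_vec_nth bounded_linear_vec_nth])
  then have "((\<lambda>Z :: complex ^ 'a ^ 'a. Z $ i $ j) has_derivative (\<lambda>Z. Z $ i $ j)) (at Z within U)"
    by (rule bounded_linear_imp_has_derivative)
  then show ?thesis unfolding cdiff_within_def by fastforce
qed

lemma cdiff_within_add:
  assumes "cdiff_within F Z U" "cdiff_within G Z U"
  shows "cdiff_within (\<lambda>Z. F Z + G Z) Z U"
proof -
  obtain D E where D: "(F has_derivative D) (at Z within U)" "\<And>c A. D (\<chi> i j. c * A $ i $ j) = c * D A"
    and E: "(G has_derivative E) (at Z within U)" "\<And>c A. E (\<chi> i j. c * A $ i $ j) = c * E A"
    using assms unfolding cdiff_within_def by blast
  show ?thesis unfolding cdiff_within_def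
    by (rule exI, rule conjI[OF has_derivative_add[OF D(1) E(1)]]) (simp add: D E ring_distribs)
qed

lemma cdiff_within_mult:
  assumes "cdiff_within F Z U" "cdiff_within G Z U"
  shows "cdiff_within (\<lambda>Z. F Z * G Z) Z U"
proof -
  obtain D E where D: "(F has_derivative D) (at Z within U)" "\<And>c A. D (\<chi> i j. c * A $ i $ j) = c * D A"
    and E: "(G has_derivative E) (at Z within U)" "\<And>c A. E (\<chi> i j. c * A $ i $ j) = c * E A"
    using assms unfolding cdiff_within_def by blast
  show ?thesis unfolding cdiff_within_def
    by (rule exI, rule conjI[OF has_derivative_mult[OF D(1) E(1)]]) (simp add: D E ring_distribs mult_ac)
qed

lemma cdiff_within_inverse:
  assumes "cdiff_within F Z U" "F Z \<noteq> 0"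
  shows "cdiff_within (\<lambda>Z. inverse (F Z)) Z U"
proof -
  obtain D where D: "(F has_derivative D) (at Z within U)" "\<And>c A. D (\<chi> i j. c * A $ i $ j) = c * D A"
    using assms unfolding cdiff_within_def by blast
  show ?thesis unfolding cdiff_within_def
    by (rule exI, rule conjI[OF Deriv.has_derivative_inverse[OF assms(2) D(1)]]) (simp add: D mult_ac)
qed

lemma cdiff_within_sum:
  "(\<And>a. a \<in> A \<Longrightarrow> cdiff_within (F a) Z U) \<Longrightarrow>
    cdiff_within (\<lambda>Z. \<Sum>a\<in>A. F a Z) Z U"
  by (induction A rule: infinite_finite_induct)
    (auto intro: cdiff_within_const cdiff_within_add)

lemma cdiff_within_prod:
  "(\<And>a. a \<in> A \<Longrightarrow> cdiff_within (F a) Z U) \<Longrightarrow>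
    cdiff_within (\<lambda>Z. \<Prod>a\<in>A. F a Z) Z U"
  by (induction A rule: infinite_finite_induct)
    (auto intro: cdiff_within_const cdiff_within_mult)

lemma cdiff_within_det:
  assumes "\<And>i j. cdiff_within (\<lambda>Z. M Z $ i $ j) Z U"
  shows "cdiff_within (\<lambda>Z. det (M Z :: complex ^ 'n ^ 'n::finite)) Z U"
  unfolding det_def
  by (intro cdiff_within_sum cdiff_within_mult
      cdiff_within_const cdiff_within_prod assms)

lemma bounded_linear_axis: "bounded_linear (axis i :: 'a::real_normed_vector \<Rightarrow> 'a ^ 'n::finite)"
proof (rule bounded_linear_intro[where K=1])
  show "norm (axis i x :: 'a ^ 'n) \<le> norm x * 1" for x :: 'a by (simp add: norm_axis)
qed (auto simp: axis_def vec_eq_iff)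

lemma has_derivative_vec_lambda:
  fixes f :: "'n::finite \<Rightarrow> 'a::real_normed_vector \<Rightarrow> 'b::real_normed_vector"
  assumes "\<And>i. (f i has_derivative f' i) F"
  shows "((\<lambda>x. \<chi> i. f i x) has_derivative (\<lambda>h. \<chi> i. f' i h)) F"
proof -
  have eq: "(\<lambda>x. \<chi> i. g i x) = (\<lambda>x. \<Sum>i\<in>UNIV. axis i (g i x))" for g :: "'n \<Rightarrow> 'a \<Rightarrow> 'b"
    by (intro ext) (simp add: vec_eq_iff axis_def)
  show ?thesis
    unfolding eq by (intro has_derivative_sum bounded_linear.has_derivative[OF bounded_linear_axis] assms)
qed

section \<open>Complex differentiability of the action and pullback of values\<close>

context symplectic_blocks
begin

abbreviation cramer_entry :: "'g \<Rightarrow> 'g \<Rightarrow> complex ^ 'g ^ 'g \<Rightarrow> complex"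
  where "cramer_entry k l Z \<equiv> det (\<chi> i j. if j = k then act_num Z $ i $ l else autf Z $ i $ j) * inverse (det (autf Z))"

text \<open>Cramer's rule replaces \<open>matrix_inv\<close>, which is given by choice and offers
  nothing to differentiate, by a rational function of the entries of Z.\<close>

lemma act_entry:
  assumes "Z \<in> siegel"
  shows "act Z $ k $ l = cramer_entry k l Z"
proof -
  have det: "det (autf Z) \<noteq> 0" using siegel_act(1)[OF assms] by (simp add: invertible_det_nz)
  have "autf Z *v (\<chi> k. act Z $ k $ l) = (\<chi> i. act_num Z $ i $ l)"
  proof -
    have "autf Z ** act Z = act_num Z"
      by (simp add: act_def matrix_mul_assoc matrix_inv_right[OF siegel_act(1)[OF assms]])
    then show ?thesis
      by (auto simp: vec_eq_iff matrix_vector_mult_def matrix_matrix_mult_def)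
  qed
  then have "(\<chi> k. act Z $ k $ l) =
    (\<chi> k. det (\<chi> i j. if j = k then (\<chi> i. act_num Z $ i $ l) $ i else autf Z $ i $ j) / det (autf Z))"
    using cramer[OF det] by blast
  from arg_cong[OF this, of "\<lambda>x. x $ k"] show ?thesis
    by (simp add: divide_inverse cong: if_cong)
qed

lemma act_has_derivative:
  assumes Z: "Z \<in> siegel"
  obtains d where "(act has_derivative d) (at Z within siegel)"
    "\<And>c h. d (\<chi> i j. c * h $ i $ j) = (\<chi> i j. c * d h $ i $ j)"
proof -
  have autf: "cdiff_within (\<lambda>Z. autf Z $ i $ j) Z siegel"
    and num: "cdiff_within (\<lambda>Z. act_num Z $ i $ j) Z siegel" for i j
    unfolding autf_def act_num_def matrix_matrix_mult_def vector_add_component vec_lambda_beta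
    by (intro cdiff_within_sum cdiff_within_mult cdiff_within_add
        cdiff_within_const cdiff_within_entry)+
  have "cdiff_within (cramer_entry k l) Z siegel"
    for k l
  proof -
    have "det (autf Z) \<noteq> 0" using siegel_act(1)[OF Z] by (simp add: invertible_det_nz)
    then have "cdiff_within (\<lambda>Z. inverse (det (autf Z))) Z siegel"
      by (rule cdiff_within_inverse[OF cdiff_within_det[OF autf]])
    moreover have "cdiff_within (\<lambda>Z. det (\<chi> i j. if j = k then act_num Z $ i $ l else autf Z $ i $ j)) Z siegel"
    proof (rule cdiff_within_det)
      fix i j
      show "cdiff_within (\<lambda>Z. (\<chi> i j. if j = k then act_num Z $ i $ l else autf Z $ i $ j) $ i $ j) Z siegel"
        using num autf by (cases "j = k") simp_all
    qed
    ultimately show ?thesis by (intro cdiff_within_mult)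
  qed
  then have ex: "\<exists>d. ((cramer_entry k l)
      has_derivative d) (at Z within siegel) \<and> (\<forall>c h. d (\<chi> i j. c * h $ i $ j) = c * d h)" for k l
    unfolding cdiff_within_def .
  define d where "d k l = (SOME d. ((cramer_entry k l)
      has_derivative d) (at Z within siegel) \<and> (\<forall>c h. d (\<chi> i j. c * h $ i $ j) = c * d h))" for k l
  have d: "((cramer_entry k l)
      has_derivative d k l) (at Z within siegel)"
    "\<And>c h. d k l (\<chi> i j. c * h $ i $ j) = c * d k l h" for k l
    using someI_ex[OF ex[of k l]] unfolding d_def[symmetric] by blast+
  have der: "((\<lambda>Z. \<chi> k l. cramer_entry k l Z)
      has_derivative (\<lambda>x. \<chi> k l. d k l x)) (at Z within siegel)"
    by (rule has_derivative_vec_lambda, rule has_derivative_vec_lambda, rule d(1))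
  have eq: "act Z = (\<chi> k l. cramer_entry k l Z)"
    if "Z \<in> siegel" for Z
    by (simp add: vec_eq_iff act_entry[OF that])
  have "(act has_derivative (\<lambda>x. \<chi> k l. d k l x)) (at Z within siegel)"
    by (rule has_derivative_transform[OF Z eq der])
  then show ?thesis by (rule that) (simp add: d(2))
qed

lemma continuous_on_act: "continuous_on siegel act"
  unfolding continuous_on_eq_continuous_within
proof
  fix Z :: "complex ^ 'g ^ 'g"
  assume "Z \<in> siegel"
  then obtain d where "(act has_derivative d) (at Z within siegel)" by (rule act_has_derivative)
  then show "continuous (at Z within siegel) act" by (rule has_derivative_continuous)
qed

text \<open>A local extension F near \<open>act Z\<close> yields F composed with \<open>act\<close>
  near Z. The constant c may vary with the point: being nonzero, it cancels in each quotient and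
  preserves the nonvanishing of the denominator.\<close>

lemma Theta_has_value_pullback:
  assumes Z: "Z \<in> siegel"
    and v: "of_nat N *s char_up v \<in> Zvec" "of_nat N *s char_lo v \<in> Zvec"
    and v': "char_up v' = tr_up (char_up v) (char_lo v)" "char_lo v' = tr_lo (char_up v) (char_lo v)"
    and w: "Theta_has_value N v' (act Z) w"
  shows "Theta_has_value N v Z w"
proof -
  obtain U F where U: "openin (top_of_set siegel) U" "act Z \<in> U" and F: "holomorphic_on_siegel F U"
    and eq: "\<And>Z'. Z' \<in> U \<Longrightarrow> Theta_den N Z' \<noteq> 0 \<Longrightarrow> F Z' = Theta_num N v' Z' / Theta_den N Z'"
    and Fw: "F (act Z) = w"
    using w unfolding Theta_has_value_def by blast
  define U' where "U' = siegel \<inter> act -` U"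
  have "act ` siegel \<subseteq> siegel" using siegel_act(2) by blast
  then have "openin (top_of_set siegel) U'"
    unfolding U'_def using continuous_openin_preimage[OF continuous_on_act _ U(1)] by blast
  moreover have "Z \<in> U'" using Z U by (simp add: U'_def)
  moreover have "holomorphic_on_siegel (\<lambda>Z. F (act Z)) U'"
    unfolding holomorphic_on_siegel_def
  proof
    fix Z' assume Z': "Z' \<in> U'"
    then have Z's: "Z' \<in> siegel" and aU: "act Z' \<in> U" by (auto simp: U'_def)
    obtain d where d: "(act has_derivative d) (at Z' within siegel)"
      "\<And>c h. d (\<chi> i j. c * h $ i $ j) = (\<chi> i j. c * d h $ i $ j)"
      using act_has_derivative[OF Z's] by blast
    obtain e where e: "(F has_derivative e) (at (act Z') within U)" "\<And>c h. e (\<chi> i j. c * h $ i $ j) = c * e h"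
      using F aU unfolding holomorphic_on_siegel_def by blast
    have 1: "(act has_derivative d) (at Z' within U')"
      by (rule has_derivative_subset[OF d(1)]) (auto simp: U'_def)
    have 2: "(F has_derivative e) (at (act Z') within act ` U')"
      by (rule has_derivative_subset[OF e(1)]) (auto simp: U'_def)
    have "((\<lambda>Z. F (act Z)) has_derivative (\<lambda>x. e (d x))) (at Z' within U')"
      by (rule has_derivative_in_compose[OF 1 2])
    then show "\<exists>d. ((\<lambda>Z. F (act Z)) has_derivative d) (at Z' within U') \<and> (\<forall>c h. d (\<chi> i j. c * h $ i $ j) = c * d h)"
      by (intro exI[of _ "\<lambda>x. e (d x)"] conjI) (simp_all add: d(2) e(2))
  qed
  moreover have "F (act Z') = Theta_num N v Z' / Theta_den N Z'" if "Z' \<in> U'" "Theta_den N Z' \<noteq> 0" for Z'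
  proof -
    have Z': "Z' \<in> siegel" "act Z' \<in> U" using that by (auto simp: U'_def)
    obtain c where "c \<noteq> 0" "Theta_num N v' (act Z') = c * Theta_num N v Z'" "Theta_den N (act Z') = c * Theta_den N Z'"
      using Theta_transform[OF Z'(1) v v'] by blast
    with eq[OF Z'(2)] that show ?thesis by simp
  qed
  ultimately show ?thesis using Fw unfolding Theta_has_value_def by blast
qed

end


section \<open>Period matrices of symplectic bases\<close>

lemma sum_UNIV_Plus:
  fixes f :: "'a::finite + 'b::finite \<Rightarrow> 'c::comm_monoid_add"
  shows "(\<Sum>k\<in>UNIV. f k) = (\<Sum>i\<in>UNIV. f (Inl i)) + (\<Sum>i\<in>UNIV. f (Inr i))"
  by (simp add: sum.Plus flip: UNIV_Plus_UNIV)

definition J_mat :: "complex ^ ('g + 'g) ^ ('g::finite + 'g)"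
  where "J_mat = (\<chi> i j. standard_symplectic i j)"

lemma J_mat_nth:
  "J_mat $ Inl i $ Inl j = 0" "J_mat $ Inr i $ Inr j = 0"
  "J_mat $ Inl i $ Inr j = (if i = j then -1 else 0)" "J_mat $ Inr i $ Inl j = (if i = j then 1 else 0)"
  by (simp_all add: J_mat_def)

lemma J_mat_mult:
  fixes U :: "complex ^ ('g::finite + 'g) ^ 'n"
  shows "(U ** J_mat) $ a $ Inl i = U $ a $ Inr i" "(U ** J_mat) $ a $ Inr i = - U $ a $ Inl i"
  by (simp_all add: matrix_matrix_mult_def J_mat_def sum_UNIV_Plus if_distrib[of "(*) _"] sum_negf cong: if_cong)

lemma J_mat_form:
  fixes U :: "complex ^ ('g::finite + 'g) ^ 'n" and V :: "complex ^ ('g + 'g) ^ 'm"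
  shows "(U ** J_mat ** transpose V) $ a $ b =
    (\<Sum>i\<in>UNIV. U $ a $ Inr i * V $ b $ Inl i) - (\<Sum>i\<in>UNIV. U $ a $ Inl i * V $ b $ Inr i)"
proof -
  have "(U ** J_mat ** transpose V) $ a $ b = (\<Sum>k\<in>UNIV. (U ** J_mat) $ a $ k * V $ b $ k)"
    by (simp add: matrix_matrix_mult_def[of "U ** J_mat"] transpose_def)
  then show ?thesis by (simp add: sum_UNIV_Plus J_mat_mult sum_negf)
qed

lemma J_mat_square: "J_mat ** - J_mat = mat 1"
proof -
  have J: "(J_mat ** J_mat) $ a $ b = - (mat 1 $ a $ b)" for a b :: "'a + 'a"
    by (cases a; cases b) (auto simp: J_mat_mult J_mat_nth mat_def)
  have "(J_mat ** - J_mat) $ a $ b = - ((J_mat ** J_mat) $ a $ b)" for a b :: "'a + 'a"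
    by (simp add: matrix_matrix_mult_def sum_negf)
  then show ?thesis by (simp add: vec_eq_iff J)
qed

text \<open>J times M^T times -J is a right inverse of M, and for square matrices it is also a left
  inverse.\<close>

lemma symplectic_transpose:
  fixes M :: "complex ^ ('g + 'g) ^ ('g::finite + 'g)"
  assumes "M ** J_mat ** transpose M = J_mat"
  shows "transpose M ** J_mat ** M = J_mat"
proof -
  have neg: "U ** - V = - (U ** V)" "- U ** V = - (U ** V)" for U V :: "complex ^ ('g + 'g) ^ ('g + 'g)"
    by (simp_all add: matrix_matrix_mult_def vec_eq_iff sum_negf)
  have "M ** (J_mat ** transpose M ** - J_mat) = (M ** J_mat ** transpose M) ** - J_mat"
    by (simp add: matrix_mul_assoc)
  also have "\<dots> = mat 1" by (simp only: assms J_mat_square)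
  finally have "J_mat ** transpose M ** - J_mat ** M = mat 1"
    using matrix_left_right_inverse by blast
  then have "- J_mat ** (J_mat ** transpose M ** - J_mat ** M) = - J_mat" by simp
  moreover have "- J_mat ** J_mat = (mat 1 :: complex ^ ('g + 'g) ^ ('g + 'g))"
    unfolding J_mat_square[symmetric] neg ..
  ultimately have "transpose M ** - J_mat ** M = - J_mat"
    by (simp add: matrix_mul_assoc)
  then show ?thesis by (simp add: neg)
qed

lemma matrix_inv_unique:
  fixes A B :: "complex ^ 'n ^ 'n::finite"
  assumes "A ** B = mat 1"
  shows "matrix_inv A = B"
proof -
  have "invertible A" using assms matrix_left_right_inverse[of A B] by (auto simp: invertible_def)
  then have "matrix_inv A ** A = mat 1" by (rule matrix_inv_left)
  then have "matrix_inv A ** A ** B = B" by simp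
  then show ?thesis using assms by (simp add: matrix_mul_assoc[symmetric])
qed

text \<open>An abstract stand-in for the polarized torus: c j is m times the imaginary part of
  \<psi> j \<xi>, positive by (P1).\<close>

locale symplectic_basis_pair =
  fixes c :: "'g::finite \<Rightarrow> real" and E :: "complex ^ 'g \<Rightarrow> complex ^ 'g \<Rightarrow> complex"
    and \<Lambda> :: "(complex ^ 'g) set" and b b' :: "'g + 'g \<Rightarrow> complex ^ 'g"
  assumes c: "\<And>j. c j > 0"
    and E: "\<And>u v. E u v = (\<Sum>j\<in>UNIV. \<i> * of_real (c j) * (u $ j * cnj (v $ j) - cnj (u $ j) * v $ j))"
    and b: "symplectic_basis \<Lambda> E b" and b': "symplectic_basis \<Lambda> E b'"
begin

definition p1 :: "complex ^ 'g ^ 'g" where "p1 = (\<chi> i j. b (Inl j) $ i)"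
definition p2 :: "complex ^ 'g ^ 'g" where "p2 = (\<chi> i j. b (Inr j) $ i)"

lemma CM_point_eq: "CM_point b = matrix_inv p2 ** p1"
  by (simp add: CM_point_def p1_def p2_def)

text \<open>The relation \<open>W\<^sup>t G W = J\<close> says that \<open>b\<close> is symplectic; inverting it gives Riemann's
  bilinear relations for the period matrix.\<close>

lemma period_relations:
  "p1 ** transpose p2 = p2 ** transpose p1"
  "(p1 ** transpose (cnj_mat p2)) $ k $ m - (p2 ** transpose (cnj_mat p1)) $ k $ m =
    (if k = m then \<i> / of_real (c k) else 0)"
proof -
  \<comment> \<open>W stacks the basis vectors on their conjugates and G is the Gram matrix of E in
    these doubled coordinates, so that the sesquilinear form becomes a bilinear one.\<close>
  define W :: "complex ^ ('g + 'g) ^ ('g + 'g)"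
    where "W = (\<chi> a j. case a of Inl k \<Rightarrow> b j $ k | Inr k \<Rightarrow> cnj (b j $ k))"
  define G :: "complex ^ ('g + 'g) ^ ('g + 'g)"
    where "G = (\<chi> a d. case a of
       Inl k \<Rightarrow> (if d = Inr k then \<i> * of_real (c k) else 0)
     | Inr k \<Rightarrow> (if d = Inl k then - (\<i> * of_real (c k)) else 0))"
  have GV: "(G ** V) $ Inl k $ j = \<i> * of_real (c k) * V $ Inr k $ j"
    "(G ** V) $ Inr k $ j = - (\<i> * of_real (c k)) * V $ Inl k $ j" for V :: "complex ^ ('g + 'g) ^ ('g + 'g)" and k j
    by (simp_all add: matrix_matrix_mult_def G_def sum_UNIV_Plus if_distrib[of "\<lambda>x. x * _"] cong: if_cong)
  have "(transpose W ** (G ** W)) $ i $ j = J_mat $ i $ j" for i j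
  proof -
    have "(transpose W ** (G ** W)) $ i $ j = (\<Sum>a\<in>UNIV. W $ a $ i * (G ** W) $ a $ j)"
      unfolding matrix_matrix_mult_def[of "transpose W"] by (simp add: transpose_def)
    also have "\<dots> = E (b i) (b j)"
      by (simp add: sum_UNIV_Plus GV E W_def algebra_simps sum_subtractf sum_negf)
    also have "\<dots> = J_mat $ i $ j" using b by (simp add: symplectic_basis_def J_mat_def)
    finally show ?thesis .
  qed
  then have "transpose W ** (G ** W) = J_mat" by (simp add: vec_eq_iff)
  then have "transpose W ** (G ** W) ** - J_mat = mat 1"
    by (simp only: J_mat_square)
  then have "transpose W ** (G ** W ** - J_mat) = mat 1"
    by (simp only: matrix_mul_assoc)
  then have 1: "G ** W ** - J_mat ** transpose W = mat 1"
    using matrix_left_right_inverse by blast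
  define V where "V = W ** J_mat ** transpose W"
  have "W ** - J_mat ** transpose W = - V"
    by (simp add: V_def vec_eq_iff matrix_matrix_mult_def sum_negf)
  with 1 have GV1: "(G ** - V) $ a $ d = mat 1 $ a $ d" for a d
    by (simp add: matrix_mul_assoc[symmetric])
  have c0: "complex_of_real (c k) \<noteq> 0" for k using c[of k] by simp
  have V: "V $ Inl k $ Inl m = 0" "V $ Inl k $ Inr m = (if k = m then - \<i> / of_real (c k) else 0)" for k m
  proof -
    have "- (\<i> * of_real (c k)) * - V $ Inl k $ Inl m = 0"
      using GV1[of "Inr k" "Inl m"] by (simp add: GV mat_def)
    then show "V $ Inl k $ Inl m = 0" using c0 by simp
    have "- (\<i> * of_real (c k)) * - V $ Inl k $ Inr m = (if k = m then 1 else 0)"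
      using GV1[of "Inr k" "Inr m"] by (simp add: GV mat_def)
    then show "V $ Inl k $ Inr m = (if k = m then - \<i> / of_real (c k) else 0)"
      using c0[of k] by (auto simp: field_simps complex_eq_iff split: if_splits)
  qed
  have "(p1 ** transpose p2) $ k $ m = (p2 ** transpose p1) $ k $ m" for k m
    using V(1)[of k m] unfolding V_def J_mat_form
    by (simp add: W_def p1_def p2_def matrix_matrix_mult_def transpose_def)
  then show "p1 ** transpose p2 = p2 ** transpose p1" by (simp add: vec_eq_iff)
  show "(p1 ** transpose (cnj_mat p2)) $ k $ m - (p2 ** transpose (cnj_mat p1)) $ k $ m =
    (if k = m then \<i> / of_real (c k) else 0)"
    using V(2)[of k m] unfolding V_def J_mat_form
    by (auto simp: W_def p1_def p2_def cnj_mat_def matrix_matrix_mult_def transpose_def algebra_simps split: if_splits)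
qed

lemma p2_invertible: "invertible p2" and CM_point_siegel: "CM_point b \<in> siegel"
proof -
  \<comment> \<open>Chosen so that 2 i H is the diagonal matrix with entries i / c k from
    \<open>period_relations\<close>.\<close>
  define H :: "complex ^ 'g ^ 'g" where "H = (\<chi> k m. if k = m then 1 / of_real (2 * c k) else 0)"
  have Hx: "(H *v x) $ k = x $ k / of_real (2 * c k)" for x k
    by (simp add: matrix_vector_mult_def H_def if_distrib[of "\<lambda>x. x * _"] cong: if_cong)
  have "p1 *v (cnj_mat (transpose p2) *v x) - p2 *v (cnj_mat (transpose p1) *v x) = 2 * \<i> *s (H *v x)" for x
  proof -
    define K where "K = p1 ** transpose (cnj_mat p2) - p2 ** transpose (cnj_mat p1)"
    have "K $ k $ m = (2 * \<i>) * H $ k $ m" for k m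
      using period_relations(2)[of k m] by (auto simp: K_def H_def)
    then have "K *v x = 2 * \<i> *s (H *v x)"
      by (simp add: vec_eq_iff matrix_vector_mult_def sum_distrib_left mult.assoc)
    moreover have "K *v x = p1 *v (cnj_mat (transpose p2) *v x) - p2 *v (cnj_mat (transpose p1) *v x)"
      by (simp add: K_def matrix_vector_mult_diff_rdistrib matrix_vector_mul_assoc transpose_cnj_mat)
    ultimately show ?thesis by simp
  qed
  moreover have "positive_definite H"
    unfolding positive_definite_def
  proof (intro allI impI)
    fix x :: "complex ^ 'g"
    assume "x \<noteq> 0"
    then obtain j where j: "x $ j \<noteq> 0" by (auto simp: vec_eq_iff)
    have "Re (x \<star> (H *v cnj_vec x)) = (\<Sum>i\<in>UNIV. (cmod (x $ i))\<^sup>2 / (2 * c i))"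
    proof -
      have "Re (x $ i * (cnj (x $ i) / of_real (2 * c i))) = (cmod (x $ i))\<^sup>2 / (2 * c i)" for i
      proof -
        have "x $ i * (cnj (x $ i) / of_real (2 * c i)) = (x $ i * cnj (x $ i)) / of_real (2 * c i)" by simp
        also have "\<dots> = of_real ((cmod (x $ i))\<^sup>2 / (2 * c i))" by (simp only: complex_norm_square of_real_divide)
        finally show ?thesis by (simp only: Re_complex_of_real)
      qed
      then show ?thesis by (simp only: cdot_def Hx cnj_vec_def vec_lambda_beta Re_sum)
    qed
    also have "\<dots> > 0"
    proof (rule sum_pos2[of _ j])
      show "0 < (cmod (x $ j))\<^sup>2 / (2 * c j)" using j c[of j] by simp
      show "0 \<le> (cmod (x $ i))\<^sup>2 / (2 * c i)" for i using c[of i] by simp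
    qed auto
    finally show "0 < Re (x \<star> (H *v cnj_vec x))" .
  qed
  ultimately show "invertible p2" "CM_point b \<in> siegel"
    unfolding CM_point_eq by (auto intro: siegel_quotient period_relations(1))
qed

text \<open>Writing b' = M b, the period matrices acquire the common left factor \<open>p2\<close>,
  which cancels in the CM-point and leaves the action of M; coordinates satisfy r = M^T r', which is
  inverted to r' = M^-T r.\<close>

lemma change_of_basis:
  fixes r r' :: "'g + 'g \<Rightarrow> int"
  assumes r: "(\<Sum>j\<in>UNIV. of_int (r j) *s b j) = (\<Sum>j\<in>UNIV. of_int (r' j) *s b' j)"
  obtains A B C D where "symplectic_blocks A B C D"
    "CM_point b' = symplectic_blocks.act A B C D (CM_point b)"
    "(\<chi> i. of_int (r' (Inl i))) = symplectic_blocks.tr_up C D (\<chi> i. of_int (r (Inl i))) (\<chi> i. of_int (r (Inr i)))"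
    "(\<chi> i. of_int (r' (Inr i))) = symplectic_blocks.tr_lo A B (\<chi> i. of_int (r (Inl i))) (\<chi> i. of_int (r (Inr i)))"
proof -
  have bij: "bij_betw (\<lambda>k. \<Sum>j\<in>UNIV. of_int (k j) *s b j) UNIV \<Lambda>"
    and bij': "bij_betw (\<lambda>k. \<Sum>j\<in>UNIV. of_int (k j) *s b' j) UNIV \<Lambda>"
    using b b' by (auto simp: symplectic_basis_def is_Z_basis_def)
  have "b' i \<in> \<Lambda>" for i
  proof -
    have "b' i = (\<Sum>j\<in>UNIV. of_int (if j = i then 1 else 0) *s b' j)"
      by (simp add: vec_eq_iff if_distrib[of of_int] if_distrib[of "\<lambda>x. x * _"] cong: if_cong)
    then have "b' i \<in> range (\<lambda>k. \<Sum>j\<in>UNIV. of_int (k j) *s b' j)" 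
      by (rule range_eqI[where x="\<lambda>j. if j = i then 1 else 0"])
    then show ?thesis using bij_betw_imp_surj_on[OF bij'] by (simp only:)
  qed
  then have "b' i \<in> range (\<lambda>k. \<Sum>j\<in>UNIV. of_int (k j) *s b j)" for i
    using bij_betw_imp_surj_on[OF bij] by (simp only:)
  then have "\<forall>i. \<exists>k. b' i = (\<Sum>j\<in>UNIV. of_int (k j) *s b j)" by (simp add: image_iff)
  from choice[OF this] obtain m where m: "\<And>i. b' i = (\<Sum>j\<in>UNIV. of_int (m i j) *s b j)" by blast
  define M :: "complex ^ ('g + 'g) ^ ('g + 'g)" where "M = (\<chi> i j. of_int (m i j))"
  have mk: "b' i $ k = (\<Sum>j\<in>UNIV. of_int (m i j) * b j $ k)" for i k
    by (simp add: m)
  \<comment> \<open>Expanding both sides in b and using uniqueness of integral coordinates gives r =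
    M^T r'.\<close>
  have rr: "r = (\<lambda>j. \<Sum>i\<in>UNIV. r' i * m i j)"
  proof -
    have "(\<Sum>j\<in>UNIV. of_int (r' j) *s b' j) = (\<Sum>j\<in>UNIV. of_int (\<Sum>i\<in>UNIV. r' i * m i j) *s b j)"
    proof -
      have "(\<Sum>i\<in>UNIV. of_int (r' i) * (\<Sum>j\<in>UNIV. of_int (m i j) * b j $ k)) =
          (\<Sum>j\<in>UNIV. (\<Sum>i\<in>UNIV. of_int (r' i) * of_int (m i j)) * b j $ k)" for k
        unfolding sum_distrib_left sum_distrib_right by (subst sum.swap) (simp add: mult.assoc)
      then show ?thesis by (simp add: vec_eq_iff mk)
    qed
    with r have "(\<Sum>j\<in>UNIV. of_int (r j) *s b j) = (\<Sum>j\<in>UNIV. of_int (\<Sum>i\<in>UNIV. r' i * m i j) *s b j)"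
      by (rule trans)
    then show ?thesis by (rule injD[OF bij_betw_imp_inj_on[OF bij]])
  qed
  have "(M ** J_mat ** transpose M) $ i $ j = J_mat $ i $ j" for i j
  proof -
    have lin1: "E (\<Sum>k\<in>UNIV. of_int (f k) *s b k) v = (\<Sum>k\<in>UNIV. of_int (f k) * E (b k) v)" for f :: "'g + 'g \<Rightarrow> int" and v
    proof -
      have "(\<Sum>k\<in>UNIV. of_int (f k) * (\<Sum>j\<in>UNIV. \<i> * of_real (c j) * (b k $ j * cnj (v $ j) - cnj (b k $ j) * v $ j))) =
        (\<Sum>j\<in>UNIV. \<Sum>k\<in>UNIV. of_int (f k) * (\<i> * of_real (c j) * (b k $ j * cnj (v $ j) - cnj (b k $ j) * v $ j)))"
        unfolding sum_distrib_left by (rule sum.swap)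
      also have "\<dots> = (\<Sum>j\<in>UNIV. \<i> * of_real (c j) *
          ((\<Sum>k\<in>UNIV. of_int (f k) * b k $ j) * cnj (v $ j) - cnj (\<Sum>k\<in>UNIV. of_int (f k) * b k $ j) * v $ j))"
        by (intro sum.cong refl) (simp add: sum_distrib_left sum_distrib_right sum_subtractf[symmetric] algebra_simps)
      finally show ?thesis by (simp add: E)
    qed
    have swap: "E u v = - E v u" for u v
      by (simp add: E sum_negf[symmetric] algebra_simps)
    have lin2: "E u (\<Sum>k\<in>UNIV. of_int (f k) *s b k) = (\<Sum>k\<in>UNIV. of_int (f k) * E u (b k))" for f :: "'g + 'g \<Rightarrow> int" and u
      unfolding swap[of u] lin1 by (simp add: sum_negf)
    have "E (b' i) (b' j) = (\<Sum>l\<in>UNIV. of_int (m j l) * (\<Sum>k\<in>UNIV. of_int (m i k) * E (b k) (b l)))"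
      unfolding m lin1 lin2 ..
    also have "\<dots> = (\<Sum>l\<in>UNIV. (\<Sum>k\<in>UNIV. of_int (m i k) * standard_symplectic k l) * of_int (m j l))"
      using b by (simp add: symplectic_basis_def mult.commute)
    also have "\<dots> = (M ** J_mat ** transpose M) $ i $ j"
      by (simp add: matrix_matrix_mult_def M_def J_mat_def transpose_def)
    finally show ?thesis using b' by (simp add: symplectic_basis_def J_mat_def)
  qed
  then have MJ: "M ** J_mat ** transpose M = J_mat" by (simp add: vec_eq_iff)
  have tr: "transpose M ** J_mat ** transpose (transpose M) = J_mat"
    using symplectic_transpose[OF MJ] by simp
  define A :: "complex ^ 'g ^ 'g" where "A = (\<chi> i j. M $ Inl i $ Inl j)"
  define B :: "complex ^ 'g ^ 'g" where "B = (\<chi> i j. M $ Inl i $ Inr j)"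
  define C :: "complex ^ 'g ^ 'g" where "C = (\<chi> i j. M $ Inr i $ Inl j)"
  define D :: "complex ^ 'g ^ 'g" where "D = (\<chi> i j. M $ Inr i $ Inr j)"
  note blocks = A_def B_def C_def D_def
  have left: "(\<Sum>i\<in>UNIV. M $ Inr i $ k * M $ Inl i $ l) - (\<Sum>i\<in>UNIV. M $ Inl i $ k * M $ Inr i $ l) = J_mat $ k $ l" for k l
    using J_mat_form[of "transpose M" "transpose M" k l] unfolding tr by (simp add: transpose_def)
  have right: "(\<Sum>i\<in>UNIV. M $ k $ Inr i * M $ l $ Inl i) - (\<Sum>i\<in>UNIV. M $ k $ Inl i * M $ l $ Inr i) = J_mat $ k $ l" for k l
    using J_mat_form[of M M k l] unfolding MJ by simp
  interpret symplectic_blocks A B C D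
  proof
    show "A $ i $ j \<in> \<int>" "B $ i $ j \<in> \<int>" "C $ i $ j \<in> \<int>" "D $ i $ j \<in> \<int>" for i j
      by (simp_all add: blocks M_def)
    have "(transpose A ** C) $ i $ j = (transpose C ** A) $ i $ j" for i j
      using left[of "Inl i" "Inl j"] by (simp add: blocks matrix_matrix_mult_def transpose_def J_mat_def)
    then show "transpose A ** C = transpose C ** A" by (simp add: vec_eq_iff)
    have "(transpose B ** D) $ i $ j = (transpose D ** B) $ i $ j" for i j
      using left[of "Inr i" "Inr j"] by (simp add: blocks matrix_matrix_mult_def transpose_def J_mat_def)
    then show "transpose B ** D = transpose D ** B" by (simp add: vec_eq_iff)
    have "(transpose A ** D) $ i $ j = (mat 1 + transpose C ** B) $ i $ j" for i j
      using left[of "Inl i" "Inr j"]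
      by (auto simp: blocks matrix_matrix_mult_def transpose_def J_mat_def mat_def algebra_simps split: if_splits)
    then show "transpose A ** D = mat 1 + transpose C ** B" by (simp add: vec_eq_iff)
  qed
  let ?Z = "CM_point b"
  have Z: "?Z \<in> siegel" by (rule CM_point_siegel)
  have p1: "p1 = p2 ** ?Z"
    by (simp add: CM_point_eq matrix_mul_assoc matrix_inv_right[OF p2_invertible])
  have "(\<chi> i j. b' (Inr j) $ i) = p1 ** transpose C + p2 ** transpose D"
    "(\<chi> i j. b' (Inl j) $ i) = p1 ** transpose A + p2 ** transpose B"
    by (simp_all add: vec_eq_iff mk sum_UNIV_Plus p1_def p2_def blocks M_def matrix_matrix_mult_def transpose_def mult.commute)
  then have q: "(\<chi> i j. b' (Inr j) $ i) = p2 ** autf ?Z" "(\<chi> i j. b' (Inl j) $ i) = p2 ** act_num ?Z"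
    unfolding p1 autf_def act_num_def by (simp_all add: matrix_mul_assoc matrix_add_ldistrib)
  have "p2 ** autf ?Z ** (matrix_inv (autf ?Z) ** matrix_inv p2) = p2 ** (autf ?Z ** matrix_inv (autf ?Z)) ** matrix_inv p2"
    by (simp only: matrix_mul_assoc)
  then have "p2 ** autf ?Z ** (matrix_inv (autf ?Z) ** matrix_inv p2) = mat 1"
    by (simp add: matrix_inv_right[OF siegel_act(1)[OF Z]] matrix_inv_right[OF p2_invertible])
  then have inv: "matrix_inv (p2 ** autf ?Z) = matrix_inv (autf ?Z) ** matrix_inv p2"
    by (rule matrix_inv_unique)
  have "CM_point b' = matrix_inv (autf ?Z) ** (matrix_inv p2 ** p2) ** act_num ?Z"
    unfolding CM_point_def[of b'] q inv by (simp only: matrix_mul_assoc)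
  then have "CM_point b' = act ?Z"
    by (simp add: act_def matrix_inv_left[OF p2_invertible])
  moreover
  define x :: "complex ^ 'g" where "x = (\<chi> i. of_int (r' (Inl i)))"
  define y :: "complex ^ 'g" where "y = (\<chi> i. of_int (r' (Inr i)))"
  have r_up: "(\<chi> i. of_int (r (Inl i))) = transpose A *v x + transpose C *v y"
    and r_lo: "(\<chi> i. of_int (r (Inr i))) = transpose B *v x + transpose D *v y"
    by (simp_all add: vec_eq_iff rr sum_UNIV_Plus x_def y_def blocks M_def matrix_vector_mult_def transpose_def mult.commute)
  \<comment> \<open>Solving for r' needs the row relations M J M^T = J, whereas the locale above
    rests on the column relations M^T J M = J.\<close>
  have "(D ** transpose A) $ i $ j = (mat 1 + C ** transpose B) $ i $ j"
     "(D ** transpose C) $ i $ j = (C ** transpose D) $ i $ j"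
     "(A ** transpose D) $ i $ j = (mat 1 + B ** transpose C) $ i $ j"
     "(A ** transpose B) $ i $ j = (B ** transpose A) $ i $ j" for i j
    using right[of "Inr i" "Inl j"] right[of "Inr i" "Inr j"] right[of "Inl i" "Inr j"] right[of "Inl i" "Inl j"]
    by (auto simp: blocks matrix_matrix_mult_def transpose_def J_mat_def mat_def algebra_simps split: if_splits)
  then have rel: "D ** transpose A = mat 1 + C ** transpose B" "D ** transpose C = C ** transpose D"
    "A ** transpose D = mat 1 + B ** transpose C" "A ** transpose B = B ** transpose A"
    by (simp_all add: vec_eq_iff)
  have rel': "D *v (transpose A *v w) = w + C *v (transpose B *v w)" "D *v (transpose C *v w) = C *v (transpose D *v w)"
    "A *v (transpose D *v w) = w + B *v (transpose C *v w)" "A *v (transpose B *v w) = B *v (transpose A *v w)" for w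
    using rel by (simp_all add: matrix_vector_mul_assoc matrix_vector_mult_add_rdistrib)
  have "x = tr_up (\<chi> i. of_int (r (Inl i))) (\<chi> i. of_int (r (Inr i)))"
    "y = tr_lo (\<chi> i. of_int (r (Inl i))) (\<chi> i. of_int (r (Inr i)))"
    unfolding tr_up_def tr_lo_def r_up r_lo by (simp_all add: matrix_vector_right_distrib rel')
  ultimately show ?thesis
    using that[OF symplectic_blocks_axioms] by (simp add: x_def y_def)
qed

end


section \<open>Galois groups and the lattice ideal\<close>

lemma CC_simps:
  "carrier CC = UNIV" "x \<otimes>\<^bsub>CC\<^esub> y = x * y" "x \<oplus>\<^bsub>CC\<^esub> y = x + y" "\<one>\<^bsub>CC\<^esub> = 1" "\<zero>\<^bsub>CC\<^esub> = 0"
  by (simp_all add: ring_of_type_algebra_def)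

lemma ring_CC: "ring CC"
  by (rule ring_from_type_algebra)

lemma a_inv_CC: "\<ominus>\<^bsub>CC\<^esub> x = - x"
proof -
  interpret ring CC by (rule ring_CC)
  show ?thesis by (rule minus_equality) (simp_all add: CC_simps)
qed

lemma number_field_closed:
  assumes "number_field L"
  shows "0 \<in> L" "1 \<in> L" "x \<in> L \<Longrightarrow> y \<in> L \<Longrightarrow> x + y \<in> L" "x \<in> L \<Longrightarrow> y \<in> L \<Longrightarrow> x * y \<in> L"
    "x \<in> L \<Longrightarrow> - x \<in> L" "x \<in> L \<Longrightarrow> x \<noteq> 0 \<Longrightarrow> inverse x \<in> L"
proof -
  have L: "subfield L CC" using assms by (simp add: number_field_def)
  interpret ring CC by (rule ring_CC)
  have sub: "subring L CC" using subfieldE(1)[OF L] .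
  show "0 \<in> L" "1 \<in> L" using subringE(2,3)[OF sub] by (simp_all add: CC_simps)
  show "x \<in> L \<Longrightarrow> y \<in> L \<Longrightarrow> x + y \<in> L" "x \<in> L \<Longrightarrow> y \<in> L \<Longrightarrow> x * y \<in> L" "x \<in> L \<Longrightarrow> - x \<in> L"
    using subringE(5)[OF sub, of x] subringE(6)[OF sub, of x y] subringE(7)[OF sub, of x y]
    by (simp_all add: CC_simps a_inv_CC)
  show "inverse x \<in> L" if x: "x \<in> L" "x \<noteq> 0"
  proof -
    interpret F: field "CC\<lparr>carrier := L\<rparr>" using subfield_iff(2)[OF L] .
    have "x \<in> Units (CC\<lparr>carrier := L\<rparr>)" using x F.field_Units by (simp add: CC_simps)
    then obtain y where "y \<in> L" "x * y = 1" by (auto simp: Units_def CC_simps)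
    moreover from this x have "y = inverse x" by (simp add: field_simps)
    ultimately show ?thesis by simp
  qed
qed

lemma embeddings_hom:
  assumes "\<sigma> \<in> embeddings L" "number_field L"
  shows "x \<in> L \<Longrightarrow> y \<in> L \<Longrightarrow> \<sigma> (x + y) = \<sigma> x + \<sigma> y" "x \<in> L \<Longrightarrow> y \<in> L \<Longrightarrow> \<sigma> (x * y) = \<sigma> x * \<sigma> y"
    "\<sigma> 1 = 1" "\<sigma> 0 = 0" "x \<in> L \<Longrightarrow> \<sigma> (- x) = - \<sigma> x"
proof -
  have h: "\<sigma> \<in> ring_hom (CC\<lparr>carrier := L\<rparr>) CC" using assms by (simp add: embeddings_def)
  show add: "\<sigma> (x + y) = \<sigma> x + \<sigma> y" if "x \<in> L" "y \<in> L" for x y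
    using ring_hom_add[OF h, of x y] that by (simp add: CC_simps)
  show "x \<in> L \<Longrightarrow> y \<in> L \<Longrightarrow> \<sigma> (x * y) = \<sigma> x * \<sigma> y"
    using ring_hom_mult[OF h, of x y] by (simp add: CC_simps)
  show "\<sigma> 1 = 1" using ring_hom_one[OF h] by (simp add: CC_simps)
  show 0: "\<sigma> 0 = 0" using add[of 0 0] number_field_closed(1)[OF assms(2)] by simp
  show "\<sigma> (- x) = - \<sigma> x" if "x \<in> L"
    using add[of x "- x"] 0 that number_field_closed(5)[OF assms(2)] by (simp add: eq_neg_iff_add_eq_0 add.commute)
qed

lemma embeddings_of_int:
  assumes "\<sigma> \<in> embeddings L" "number_field L"
  shows "of_int k \<in> L" "\<sigma> (of_int k) = of_int k"
proof -
  note cl = number_field_closed[OF assms(2)] and hom = embeddings_hom[OF assms]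
  have nat: "of_nat n \<in> L \<and> \<sigma> (of_nat n) = of_nat n" for n :: nat
    by (induction n) (auto simp: cl hom)
  have "of_int k \<in> L \<and> \<sigma> (of_int k) = of_int k"
  proof (cases k rule: int_cases2)
    case (nonneg n)
    then show ?thesis using nat[of n] by simp
  next
    case (nonpos n)
    then show ?thesis using nat[of n] cl(5)[of "of_nat n"] hom(5)[of "of_nat n"] by simp
  qed
  then show "of_int k \<in> L" "\<sigma> (of_int k) = of_int k" by auto
qed

text \<open>Makes the group inverse in \<open>inv_lifts\<close> meaningful, and cosets and generated
  subgroups amenable to group laws.\<close>

lemma gal_group_group:
  assumes L: "number_field L"
  shows "group (gal_group L)"
proof (rule groupI)
  note cl = number_field_closed[OF L]
  fix \<sigma> \<tau> \<rho>
  have G: "\<sigma> \<in> embeddings L" "\<sigma> ` L = L" if "\<sigma> \<in> carrier (gal_group L)" for \<sigma>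
    using that by (auto simp: gal_group_def Gal_def)
  have mem: "\<sigma> x \<in> L" if "\<sigma> \<in> carrier (gal_group L)" "x \<in> L" for \<sigma> x
    using G(2)[OF that(1)] that(2) by blast
  have GI: "f \<in> carrier (gal_group L)"
    if "f \<in> extensional L" "f ` L = L" "f 1 = 1" "\<And>x y. x \<in> L \<Longrightarrow> y \<in> L \<Longrightarrow> f (x + y) = f x + f y"
      "\<And>x y. x \<in> L \<Longrightarrow> y \<in> L \<Longrightarrow> f (x * y) = f x * f y" for f
    using that by (auto simp: gal_group_def Gal_def embeddings_def ring_hom_def CC_simps)
  show "\<one>\<^bsub>gal_group L\<^esub> \<in> carrier (gal_group L)"
    by (rule GI) (auto simp: gal_group_def cl)
  show "\<sigma> \<otimes>\<^bsub>gal_group L\<^esub> \<tau> \<in> carrier (gal_group L)"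
    if s: "\<sigma> \<in> carrier (gal_group L)" and t: "\<tau> \<in> carrier (gal_group L)"
  proof (rule GI)
    note hs = embeddings_hom[OF G(1)[OF s] L] and ht = embeddings_hom[OF G(1)[OF t] L]
    have m: "\<sigma> \<otimes>\<^bsub>gal_group L\<^esub> \<tau> = compose L \<tau> \<sigma>" by (simp add: gal_group_def)
    show "\<sigma> \<otimes>\<^bsub>gal_group L\<^esub> \<tau> \<in> extensional L" by (simp add: m)
    show "(\<sigma> \<otimes>\<^bsub>gal_group L\<^esub> \<tau>) ` L = L"
      unfolding m using G(2)[OF s] G(2)[OF t] by (auto simp: compose_def image_iff) (metis imageE)
    show "(\<sigma> \<otimes>\<^bsub>gal_group L\<^esub> \<tau>) 1 = 1" by (simp add: m compose_def cl hs ht)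
  qed (use mem[OF s] in \<open>simp_all add: gal_group_def compose_def cl embeddings_hom[OF G(1)[OF s] L] embeddings_hom[OF G(1)[OF t] L]\<close>)
  show "\<sigma> \<otimes>\<^bsub>gal_group L\<^esub> \<tau> \<otimes>\<^bsub>gal_group L\<^esub> \<rho> = \<sigma> \<otimes>\<^bsub>gal_group L\<^esub> (\<tau> \<otimes>\<^bsub>gal_group L\<^esub> \<rho>)"
    if "\<sigma> \<in> carrier (gal_group L)" "\<tau> \<in> carrier (gal_group L)" "\<rho> \<in> carrier (gal_group L)"
    using mem that by (auto simp: gal_group_def compose_def restrict_def fun_eq_iff)
  show "\<one>\<^bsub>gal_group L\<^esub> \<otimes>\<^bsub>gal_group L\<^esub> \<sigma> = \<sigma>" if "\<sigma> \<in> carrier (gal_group L)"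
    using G(1)[OF that] by (auto simp: gal_group_def compose_def embeddings_def extensional_def restrict_def fun_eq_iff)
  show "\<exists>\<tau>\<in>carrier (gal_group L). \<tau> \<otimes>\<^bsub>gal_group L\<^esub> \<sigma> = \<one>\<^bsub>gal_group L\<^esub>"
    if s: "\<sigma> \<in> carrier (gal_group L)"
  proof -
    note hs = embeddings_hom[OF G(1)[OF s] L]
    \<comment> \<open>Otherwise x - y would be invertible in L and yet sent to 0, contradicting
      \<sigma> 1 = 1.\<close>
    have inj: "x = y" if xy: "x \<in> L" "y \<in> L" "\<sigma> x = \<sigma> y" for x y
    proof (rule ccontr)
      assume ne: "x \<noteq> y"
      have d: "x - y \<in> L" using cl(3)[OF xy(1) cl(5)[OF xy(2)]] by simp
      have "\<sigma> (x - y) = 0" using hs(1)[OF xy(1) cl(5)[OF xy(2)]] hs(5)[OF xy(2)] xy(3) by simp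
      moreover have "\<sigma> ((x - y) * inverse (x - y)) = \<sigma> (x - y) * \<sigma> (inverse (x - y))"
        using d ne by (intro hs cl) auto
      ultimately show False using ne hs(3) by simp
    qed
    define \<tau> where "\<tau> = restrict (inv_into L \<sigma>) L"
    have st: "\<tau> (\<sigma> x) = x" if "x \<in> L" for x
      using that inj mem[OF s] by (simp add: \<tau>_def inv_into_f_f inj_on_def)
    have ts: "\<tau> y \<in> L" "\<sigma> (\<tau> y) = y" if "y \<in> L" for y
      using that G(2)[OF s] by (simp_all add: \<tau>_def inv_into_into f_inv_into_f)
    have "\<tau> \<in> carrier (gal_group L)"
    proof (rule GI)
      show "\<tau> \<in> extensional L" by (simp add: \<tau>_def)
      show "\<tau> ` L = L" using ts(1) st mem[OF s] by (auto simp: image_iff) metis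
      show "\<tau> 1 = 1" using st[OF cl(2)] hs(3) by simp
      show "\<tau> (x + y) = \<tau> x + \<tau> y" if "x \<in> L" "y \<in> L" for x y
        using st[of "\<tau> x + \<tau> y"] hs(1)[of "\<tau> x" "\<tau> y"] ts that cl by simp
      show "\<tau> (x * y) = \<tau> x * \<tau> y" if "x \<in> L" "y \<in> L" for x y
        using st[of "\<tau> x * \<tau> y"] hs(2)[of "\<tau> x" "\<tau> y"] ts that cl by simp
    qed
    moreover have "\<tau> \<otimes>\<^bsub>gal_group L\<^esub> \<sigma> = \<one>\<^bsub>gal_group L\<^esub>"
      using ts by (auto simp: gal_group_def compose_def restrict_def fun_eq_iff)
    ultimately show ?thesis by blast
  qed
qed

lemma lifts_carrier: "lifts L K \<Phi> \<subseteq> carrier (gal_group L)"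
  by (auto simp: lifts_def gal_group_def)

lemma inv_lifts_carrier:
  assumes "number_field L"
  shows "inv_lifts L K \<Phi> \<subseteq> carrier (gal_group L)"
proof -
  interpret group "gal_group L" by (rule gal_group_group[OF assms])
  show ?thesis by (auto simp: inv_lifts_def SET_INV_def intro!: inv_closed intro: subsetD[OF lifts_carrier[of L K \<Phi>]])
qed

lemma fixed_field_closed:
  assumes L: "number_field L" and A: "A \<subseteq> Gal L" and xy: "x \<in> fixed_field L A" "y \<in> fixed_field L A"
  shows "x + y \<in> fixed_field L A" "x * y \<in> fixed_field L A"
proof -
  have "\<gamma> (x + y) = x + y \<and> \<gamma> (x * y) = x * y" if "\<gamma> \<in> A" for \<gamma>
  proof -
    have "\<gamma> \<in> embeddings L" using that A by (auto simp: Gal_def)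
    then have "\<gamma> (x + y) = \<gamma> x + \<gamma> y" "\<gamma> (x * y) = \<gamma> x * \<gamma> y"
      using xy by (auto simp: fixed_field_def intro!: embeddings_hom L)
    then show ?thesis using that xy by (auto simp: fixed_field_def)
  qed
  then show "x + y \<in> fixed_field L A" "x * y \<in> fixed_field L A"
    using xy number_field_closed(3,4)[OF L] by (auto simp: fixed_field_def)
qed

lemma reflex_field_closed:
  assumes L: "number_field L"
  shows "reflex_field L K \<Phi> \<subseteq> L"
    "x \<in> reflex_field L K \<Phi> \<Longrightarrow> y \<in> reflex_field L K \<Phi> \<Longrightarrow> x + y \<in> reflex_field L K \<Phi>"
    "x \<in> reflex_field L K \<Phi> \<Longrightarrow> y \<in> reflex_field L K \<Phi> \<Longrightarrow> x * y \<in> reflex_field L K \<Phi>"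
    "of_int k \<in> reflex_field L K \<Phi>"
proof -
  have A: "{\<gamma> \<in> Gal L. \<gamma> <#\<^bsub>gal_group L\<^esub> inv_lifts L K \<Phi> = inv_lifts L K \<Phi>} \<subseteq> Gal L" by blast
  show "reflex_field L K \<Phi> \<subseteq> L" by (auto simp: reflex_field_def fixed_field_def)
  show "x \<in> reflex_field L K \<Phi> \<Longrightarrow> y \<in> reflex_field L K \<Phi> \<Longrightarrow> x + y \<in> reflex_field L K \<Phi>"
    "x \<in> reflex_field L K \<Phi> \<Longrightarrow> y \<in> reflex_field L K \<Phi> \<Longrightarrow> x * y \<in> reflex_field L K \<Phi>"
    unfolding reflex_field_def by (rule fixed_field_closed[OF L A]; assumption)+
  have "of_nat n \<in> L" for n
    by (induction n) (auto intro: number_field_closed[OF L])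
  then have "of_int k \<in> L"
    using number_field_closed(5)[OF L] by (cases k rule: int_cases2) auto
  moreover have "\<gamma> (of_int k) = of_int k" if "\<gamma> \<in> Gal L" for \<gamma>
    using that embeddings_of_int(2)[OF _ L] by (auto simp: Gal_def)
  ultimately show "of_int k \<in> reflex_field L K \<Phi>" by (auto simp: reflex_field_def fixed_field_def)
qed

text \<open>If \<gamma> stabilises the set of inverses of S, then \<gamma> s^-1 = t^-1 for some s, t
  in S, so \<gamma> = t^-1 s lies in the subgroup generated by S; fixed fields reverse this
  inclusion.\<close>

lemma base_field_subset_reflex_field:
  assumes L: "number_field L" and ne: "lifts L K \<Phi> \<noteq> {}"
  shows "base_field L K \<Phi> \<subseteq> reflex_field L K \<Phi>"
proof
  interpret group "gal_group L" by (rule gal_group_group[OF L])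
  fix x assume x: "x \<in> base_field L K \<Phi>"
  have "\<gamma> x = x" if \<gamma>: "\<gamma> \<in> Gal L" "\<gamma> <#\<^bsub>gal_group L\<^esub> inv_lifts L K \<Phi> = inv_lifts L K \<Phi>" for \<gamma>
  proof -
    have \<gamma>G: "\<gamma> \<in> carrier (gal_group L)" using \<gamma>(1) by (simp add: gal_group_def)
    obtain s where s: "s \<in> lifts L K \<Phi>" using ne by blast
    then have sG: "s \<in> carrier (gal_group L)" using lifts_carrier by blast
    have "inv\<^bsub>gal_group L\<^esub> s \<in> inv_lifts L K \<Phi>" using s by (auto simp: inv_lifts_def SET_INV_def)
    then have "\<gamma> \<otimes>\<^bsub>gal_group L\<^esub> inv\<^bsub>gal_group L\<^esub> s \<in> \<gamma> <#\<^bsub>gal_group L\<^esub> inv_lifts L K \<Phi>"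
      by (auto simp: l_coset_def)
    then obtain t where t: "t \<in> lifts L K \<Phi>" "\<gamma> \<otimes>\<^bsub>gal_group L\<^esub> inv\<^bsub>gal_group L\<^esub> s = inv\<^bsub>gal_group L\<^esub> t"
      unfolding \<gamma>(2) by (auto simp: inv_lifts_def SET_INV_def)
    have "\<gamma> = \<gamma> \<otimes>\<^bsub>gal_group L\<^esub> inv\<^bsub>gal_group L\<^esub> s \<otimes>\<^bsub>gal_group L\<^esub> s"
      using \<gamma>G sG by (simp add: m_assoc)
    also have "\<dots> \<in> generate (gal_group L) (lifts L K \<Phi>)"
      unfolding t(2) using s t(1) by (intro generate.eng generate.inv generate.incl)
    finally show ?thesis using x by (auto simp: base_field_def fixed_field_def)
  qed
  then show "x \<in> reflex_field L K \<Phi>"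
    using x by (auto simp: reflex_field_def base_field_def fixed_field_def)
qed

section \<open>The lattice ideal inside the reflex field\<close>

lemma ideal_prod_CC_subset:
  assumes "I \<subseteq> S" "J \<subseteq> S" "\<And>x y. x \<in> S \<Longrightarrow> y \<in> S \<Longrightarrow> x + y \<in> S" "\<And>x y. x \<in> S \<Longrightarrow> y \<in> S \<Longrightarrow> x * y \<in> S"
  shows "I \<cdot>\<^bsub>CC\<^esub> J \<subseteq> S"
proof
  fix x assume "x \<in> I \<cdot>\<^bsub>CC\<^esub> J"
  then show "x \<in> S"
  proof (induction rule: ideal_prod.induct)
    case (prod i j)
    then show ?case using assms(4)[of i j] assms(1,2) by (auto simp: CC_simps)
  next
    case (sum s1 s2)
    then show ?case using assms(3)[of s1 s2] by (simp add: CC_simps)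
  qed
qed

lemma lattice_ideal_subset:
  assumes L: "number_field L" and ne: "lifts L K \<Phi> \<noteq> {}" and f: "\<ff>0 \<subseteq> base_field L K \<Phi>"
  shows "lattice_ideal L K \<Phi> \<ff>0 \<cc> \<subseteq> reflex_field L K \<Phi>"
  unfolding lattice_ideal_def extend_ideal_def
proof (intro ideal_prod_CC_subset)
  show "\<ff>0 \<subseteq> reflex_field L K \<Phi>" using f base_field_subset_reflex_field[OF L ne] by blast
qed (auto simp: ring_of_integers_def ideal_inverse_def intro: reflex_field_closed[OF L])

text \<open>Each \<psi> j is a homomorphism only on F and a restricted function elsewhere. The
  induction therefore carries membership of the partial sums in F along with additivity.\<close>

lemma Psi_sum:
  assumes L: "number_field L"
    and \<psi>: "\<And>j. \<exists>\<sigma>\<in>embeddings L. \<psi> j = restrict \<sigma> F"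
    and F: "F \<subseteq> L" "\<And>x y. x \<in> F \<Longrightarrow> y \<in> F \<Longrightarrow> x + y \<in> F" "\<And>x y. x \<in> F \<Longrightarrow> y \<in> F \<Longrightarrow> x * y \<in> F"
      "\<And>k. of_int k \<in> F"
    and y: "\<And>i. y i \<in> F"
  shows "Psi \<psi> (\<Sum>i\<in>(UNIV :: 'i::finite set). of_int (k i) * y i) = (\<Sum>i\<in>UNIV. of_int (k i) *s Psi \<psi> (y i))"
proof -
  have "\<psi> j (\<Sum>i\<in>UNIV. of_int (k i) * y i) = (\<Sum>i\<in>UNIV. of_int (k i) * \<psi> j (y i))" for j
  proof -
    obtain \<sigma> where \<sigma>: "\<sigma> \<in> embeddings L" "\<psi> j = restrict \<sigma> F" using \<psi> by blast
    note hom = embeddings_hom[OF \<sigma>(1) L]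
    have "(\<Sum>i\<in>A. of_int (k i) * y i) \<in> F \<and> \<sigma> (\<Sum>i\<in>A. of_int (k i) * y i) = (\<Sum>i\<in>A. of_int (k i) * \<sigma> (y i))"
      if "finite A" for A
      using that
    proof (induction A rule: finite_induct)
      case empty
      show ?case using F(4)[of 0] hom(4) by simp
    next
      case (insert a A)
      have *: "of_int (k a) * y a \<in> F" by (intro F y)
      have "\<sigma> (of_int (k a) * y a) = of_int (k a) * \<sigma> (y a)"
        using hom(2)[of "of_int (k a)" "y a"] embeddings_of_int[OF \<sigma>(1) L] y[of a] F(1) by auto
      moreover have "\<sigma> (of_int (k a) * y a + (\<Sum>i\<in>A. of_int (k i) * y i)) =
          \<sigma> (of_int (k a) * y a) + \<sigma> (\<Sum>i\<in>A. of_int (k i) * y i)"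
        using * insert.IH F(1) by (intro hom) auto
      ultimately show ?case using insert * F(2) by simp
    qed
    from this[of UNIV] show ?thesis using \<sigma>(2) y by simp
  qed
  then show ?thesis by (simp add: Psi_def vec_eq_iff)
qed

section \<open>Invariance under change of the symplectic basis\<close>

lemma Theta_has_value_change_of_basis:
  fixes r r' :: "'g::finite + 'g \<Rightarrow> int"
  assumes c: "\<And>j. c j > 0"
    and E: "\<And>u v. E u v = (\<Sum>j\<in>UNIV. \<i> * of_real (c j) * (u $ j * cnj (v $ j) - cnj (u $ j) * v $ j))"
    and b: "symplectic_basis \<Lambda> E b" and b': "symplectic_basis \<Lambda> E b'"
    and rr: "(\<Sum>j\<in>UNIV. of_int (r j) *s b j) = (\<Sum>j\<in>UNIV. of_int (r' j) *s b' j)"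
    and w: "Theta_has_value N (\<chi> j. of_int (r' j) / real N) (CM_point b') w"
  shows "Theta_has_value N (\<chi> j. of_int (r j) / real N) (CM_point b) w"
proof -
  interpret B: symplectic_basis_pair c E \<Lambda> b b'
    by unfold_locales (fact c E b b')+
  define R where "R f = (\<chi> i. complex_of_int (f i))" for f :: "'g \<Rightarrow> int"
  obtain A B C D where sb: "symplectic_blocks A B C D"
    and Z: "CM_point b' = symplectic_blocks.act A B C D (CM_point b)"
    and up: "R (\<lambda>i. r' (Inl i)) = symplectic_blocks.tr_up C D (R (\<lambda>i. r (Inl i))) (R (\<lambda>i. r (Inr i)))"
    and lo: "R (\<lambda>i. r' (Inr i)) = symplectic_blocks.tr_lo A B (R (\<lambda>i. r (Inl i))) (R (\<lambda>i. r (Inr i)))"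
    unfolding R_def using B.change_of_basis[OF rr] by blast
  interpret symplectic_blocks A B C D by (rule sb)
  have char: "char_up (\<chi> j. of_int (f j) / real N) = (1 / of_nat N) *s R (\<lambda>i. f (Inl i))"
    "char_lo (\<chi> j. of_int (f j) / real N) = (1 / of_nat N) *s R (\<lambda>i. f (Inr i))" for f :: "'g + 'g \<Rightarrow> int"
    by (simp_all add: char_up_def char_lo_def R_def vec_eq_iff)
  have Nint: "of_nat N *s ((1 / of_nat N) *s R f) \<in> Zvec" for f :: "'g \<Rightarrow> int"
    \<comment> \<open>For N = 0 the scaled vector is 0; otherwise the factors N and 1 / N
      cancel.\<close>
    by (cases "N = 0") (auto simp: Zvec_def R_def)
  show ?thesis
  proof (rule Theta_has_value_pullback[OF B.CM_point_siegel])
    show "Theta_has_value N (\<chi> j. of_int (r' j) / real N) (act (CM_point b)) w"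
      using w by (simp only: Z)
  qed (simp_all only: char Nint tr_scale up lo)
qed

theorem proposition5p5:
  fixes K L Ks K0 \<ff>0 \<ff> \<cc> \<aa> :: "complex set"
    and \<Phi> :: "(complex \<Rightarrow> complex) set"
    and \<psi> :: "'g::finite \<Rightarrow> complex \<Rightarrow> complex"
    and \<xi> :: complex and C :: "complex set set" and N :: nat
    and \<Lambda> :: "(complex ^ 'g) set"
    and E :: "complex ^ 'g \<Rightarrow> complex ^ 'g \<Rightarrow> complex"
    and b b' :: "'g + 'g \<Rightarrow> complex ^ 'g"
    and y y' :: "'g + 'g \<Rightarrow> complex"
    and r r' :: "'g + 'g \<Rightarrow> int"
  assumes K: "CM_field K" and \<Phi>: "CM_type K \<Phi>"
    and L: "finite_galois L" "K \<subseteq> L"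
    and Ks: "Ks = reflex_field L K \<Phi>"
    and \<psi>: "bij_betw \<psi> UNIV (reflex_type L K \<Phi>)"
    and C1: "\<exists>E\<^sub>1. principal_polarization (Psi \<psi> ` ring_of_integers Ks) E\<^sub>1"
    and C2: "reflex_field L Ks (reflex_type L K \<Phi>) = K"
    and \<xi>: "\<xi> \<in> Ks"
    and P1: "\<And>j. Re (\<psi> j \<xi>) = 0 \<and> Im (\<psi> j \<xi>) > 0"
    and P2: "riemann_form (Psi \<psi> ` ring_of_integers Ks) (E_form \<psi> \<xi>)"
    and P3: "ideal_inverse Ks (different Ks) = principal_ideal Ks \<xi>"
    and K0: "K0 = base_field L K \<Phi>"
    and \<ff>0: "ideal \<ff>0 (CC\<lparr>carrier := ring_of_integers K0\<rparr>)"
            "\<ff>0 \<noteq> {0}" "\<ff>0 \<noteq> ring_of_integers K0"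
    and \<ff>: "\<ff> = extend_ideal K \<ff>0"
    and N: "N = (LEAST n. n > 0 \<and> of_nat n \<in> \<ff>)"
    and C: "C \<in> carrier (ray_class_group K \<ff>)"
    and \<cc>: "integral_ideal K \<cc>" "\<cc> \<in> C"
    and \<aa>: "\<aa> = lattice_ideal L K \<Phi> \<ff>0 \<cc>"
    and \<Lambda>: "\<Lambda> = Psi \<psi> ` \<aa>"
    and E: "E = scaled_E_form \<psi> \<xi> (polar_scale CARD('g) L K \<Phi> \<ff>0 \<cc>)"
    and b: "symplectic_basis \<Lambda> E b" "\<And>j. y j \<in> \<aa> \<and> b j = Psi \<psi> (y j)"
    and r: "of_nat N = (\<Sum>j\<in>UNIV. of_int (r j) * y j)"
    and b': "symplectic_basis \<Lambda> E b'" "\<And>j. y' j \<in> \<aa> \<and> b' j = Psi \<psi> (y' j)"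
    and r': "of_nat N = (\<Sum>j\<in>UNIV. of_int (r' j) * y' j)"
  shows "(Theta_finite N (\<chi> j. of_int (r' j) / real N) (CM_point b') \<longleftrightarrow>
          Theta_finite N (\<chi> j. of_int (r j) / real N) (CM_point b)) \<and>
         (Theta_finite N (\<chi> j. of_int (r j) / real N) (CM_point b) \<longrightarrow>
          Theta N (\<chi> j. of_int (r' j) / real N) (CM_point b') =
          Theta N (\<chi> j. of_int (r j) / real N) (CM_point b))"
proof -
  have nf: "number_field L" using L(1) by (simp add: finite_galois_def)
  \<comment> \<open>The index type of \<psi> is nonempty, so its bijective image, the reflex type,
    is nonempty as well.\<close>
  have reflex_ne: "inv_lifts L K \<Phi> \<noteq> {}"
    using bij_betw_imp_surj_on[OF \<psi>] by (auto simp: reflex_type_def)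
  then have lifts_ne: "lifts L K \<Phi> \<noteq> {}" by (auto simp: inv_lifts_def SET_INV_def)
  have "\<ff>0 \<subseteq> ring_of_integers K0"
    using additive_subgroup.a_subset[OF ideal.axioms(1)[OF \<ff>0(1)]] by simp
  then have "\<ff>0 \<subseteq> base_field L K \<Phi>" using K0 by (auto simp: ring_of_integers_def)
  then have sub: "\<aa> \<subseteq> Ks" unfolding \<aa> Ks by (rule lattice_ideal_subset[OF nf lifts_ne])
  have emb: "\<exists>\<sigma>\<in>embeddings L. \<psi> j = restrict \<sigma> Ks" for j
  proof -
    have "\<psi> j \<in> reflex_type L K \<Phi>" using \<psi> by (auto simp: bij_betw_def)
    then obtain \<sigma> where "\<sigma> \<in> inv_lifts L K \<Phi>" "\<psi> j = restrict \<sigma> Ks" by (auto simp: reflex_type_def Ks)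
    then show ?thesis using inv_lifts_carrier[OF nf] by (auto simp: gal_group_def Gal_def)
  qed
  note Psi_sum = Psi_sum[OF nf emb, unfolded Ks, OF reflex_field_closed[OF nf], folded Ks]
  have "(\<Sum>j\<in>UNIV. of_int (r j) *s b j) = Psi \<psi> (\<Sum>j\<in>UNIV. of_int (r j) * y j)"
    using b(2) sub by (subst Psi_sum) auto
  also have "\<dots> = Psi \<psi> (\<Sum>j\<in>UNIV. of_int (r' j) * y' j)" by (simp only: r[symmetric] r'[symmetric])
  also have "\<dots> = (\<Sum>j\<in>UNIV. of_int (r' j) *s b' j)"
    using b'(2) sub by (subst Psi_sum) auto
  finally have rr: "(\<Sum>j\<in>UNIV. of_int (r j) *s b j) = (\<Sum>j\<in>UNIV. of_int (r' j) *s b' j)" .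
  define m where "m = polar_scale CARD('g) L K \<Phi> \<ff>0 \<cc>"
  define c where "c j = m * Im (\<psi> j \<xi>)" for j
  have E': "E u w = (\<Sum>j\<in>UNIV. \<i> * of_real (c j) * (u $ j * cnj (w $ j) - cnj (u $ j) * w $ j))" for u w
  proof -
    have "of_real m * \<psi> j \<xi> = \<i> * of_real (c j)" for j
      using P1[of j] by (simp add: c_def complex_eq_iff)
    then show ?thesis by (simp add: E scaled_E_form_def m_def[symmetric])
  qed
  have "m \<ge> 0" unfolding m_def polar_scale_def ideal_norm_def by simp
  \<comment> \<open>Read off from the given symplectic basis instead of computing a norm: for m = 0
    the form would vanish, but its value on the first pair is -1.\<close>
  moreover have "m \<noteq> 0"
  proof
    assume "m = 0"
    then have "E (b (Inl undefined)) (b (Inr undefined)) = 0" by (simp add: E' c_def)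
    then show False using b(1) by (simp add: symplectic_basis_def)
  qed
  ultimately have c: "c j > 0" for j using P1[of j] by (simp add: c_def)
  \<comment> \<open>The situation is symmetric in the two bases, so the one-sided pullback gives
    both directions. Since finiteness and \<open>Theta\<close> are defined from
    \<open>Theta_has_value\<close> alone, this equivalence settles both claims.\<close>
  have iff: "Theta_has_value N (\<chi> j. of_int (r' j) / real N) (CM_point b') w \<longleftrightarrow>
      Theta_has_value N (\<chi> j. of_int (r j) / real N) (CM_point b) w" for w
    using Theta_has_value_change_of_basis[OF c E' b(1) b'(1) rr]
      Theta_has_value_change_of_basis[OF c E' b'(1) b(1) rr[symmetric]] by blast
  then show ?thesis by (simp add: Theta_finite_def Theta_def)
qed

end
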